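(* There is a randomized algorithm which, given query access to a function $f:[n]^d\to\{0,1\}$ and a parameter $\varepsilon\in(0,1)$, makes $O\!\left(d^{5/6}\cdot \log^{3/2}d\cdot (\log n + \log d)^{4/3} \cdot \varepsilon^{-4/3}\right)$ non-adaptive queries and (a) returns YES with probability $1$ if $f$ is monotone, and (b) returns NO with probability $>2/3$ if $f$ is $\varepsilon$-far from being monotone.
   Context: $[n]=\{1,\dots,n\}$ and $[n]^d$ is partially ordered coordinatewise: $x\preceq y$ iff $x_i\le y_i$ for all $i$. A function $f:[n]^d\to\{0,1\}$ is monotone if $f(x)\le f(y)$ whenever $x\preceq y$. The distance between two functions is the fraction of points of $[n]^d$ on which they differ; the distance of $f$ to monotonicity is the minimum distance from $f$ to a monotone function, and $f$ is $\varepsilon$-far from monotone if this distance is at least $\varepsilon$. Non-adaptive means all queries are chosen before any answer is seen. *)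

theory Defs
  imports "HOL-Probability.Probability_Mass_Function"
begin

type_synonym point = "nat \<Rightarrow> nat"

text \<open>The hypergrid \<open>[n]\<^sup>d\<close>. Points are extensional functions on \<open>{1..d}\<close>, so that each point
  has exactly one representative and the cardinality is \<open>n\<^sup>d\<close>.\<close>

definition grid :: "nat \<Rightarrow> nat \<Rightarrow> point set" where
  "grid n d = {1..d} \<rightarrow>\<^sub>E {1..n}"

definition coord_le :: "nat \<Rightarrow> point \<Rightarrow> point \<Rightarrow> bool" where
  "coord_le d x y \<longleftrightarrow> (\<forall>i\<in>{1..d}. x i \<le> y i)"

text \<open>Functions \<open>[n]\<^sup>d \<rightarrow> {0,1}\<close> are total functions into \<^typ>\<open>bool\<close> (with \<open>0 = False < True = 1\<close>);
  everything below depends only on their values on the grid.\<close>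

definition grid_mono :: "nat \<Rightarrow> nat \<Rightarrow> (point \<Rightarrow> bool) \<Rightarrow> bool" where
  "grid_mono n d f \<longleftrightarrow> monotone_on (grid n d) (coord_le d) (\<le>) f"

definition rel_dist :: "nat \<Rightarrow> nat \<Rightarrow> (point \<Rightarrow> bool) \<Rightarrow> (point \<Rightarrow> bool) \<Rightarrow> real" where
  "rel_dist n d f g = real (card {x \<in> grid n d. f x \<noteq> g x}) / real (card (grid n d))"

definition mono_dist :: "nat \<Rightarrow> nat \<Rightarrow> (point \<Rightarrow> bool) \<Rightarrow> real" where
  "mono_dist n d f = Min {rel_dist n d f g | g. grid_mono n d g}"

definition far_from_mono :: "nat \<Rightarrow> nat \<Rightarrow> real \<Rightarrow> (point \<Rightarrow> bool) \<Rightarrow> bool" where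
  "far_from_mono n d \<epsilon> f \<longleftrightarrow> mono_dist n d f \<ge> \<epsilon>"

text \<open>The minimum in \<^const>\<open>mono_dist\<close> is over a finite nonempty set, as \<^const>\<open>Min\<close> requires.\<close>

lemma finite_grid: "finite (grid n d)"
  unfolding grid_def by (intro finite_PiE) auto

lemma finite_mono_dists: "finite {rel_dist n d f g | g. grid_mono n d g}"
proof (rule finite_subset)
  show "{rel_dist n d f g | g. grid_mono n d g}
      \<subseteq> (\<lambda>A. real (card A) / real (card (grid n d))) ` Pow (grid n d)"
    unfolding rel_dist_def by blast
qed (simp add: finite_grid)

lemma mono_dists_nonempty: "{rel_dist n d f g | g. grid_mono n d g} \<noteq> {}"
proof -
  have "grid_mono n d (\<lambda>_. True)"
    by (simp add: grid_mono_def monotone_on_def)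
  then show ?thesis by blast
qed

datatype answer = YES | NO

text \<open>A deterministic non-adaptive algorithm fixes its list of queries in advance and computes its
  answer from the list of values received. A randomized one is a probability distribution over
  deterministic ones: all coins, including those used only after the values are received, may be
  tossed at the start.\<close>

datatype nonadaptive = Nonadaptive (queries: "point list") (verdict: "bool list \<Rightarrow> answer")

type_synonym randomized_nonadaptive = "nonadaptive pmf"

definition run :: "nonadaptive \<Rightarrow> (point \<Rightarrow> bool) \<Rightarrow> answer" where
  "run A f = verdict A (map f (queries A))"

definition prob_returns :: "randomized_nonadaptive \<Rightarrow> (point \<Rightarrow> bool) \<Rightarrow> answer \<Rightarrow> real" where
  "prob_returns R f a = measure_pmf.prob R {A. run A f = a}"

definition queries_within :: "randomized_nonadaptive \<Rightarrow> point set \<Rightarrow> bool" where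
  "queries_within R S \<longleftrightarrow> (\<forall>A\<in>set_pmf R. set (queries A) \<subseteq> S)"

text \<open>A worst-case bound over the random choices; repeated queries count with multiplicity.\<close>

definition makes_at_most :: "randomized_nonadaptive \<Rightarrow> real \<Rightarrow> bool" where
  "makes_at_most R q \<longleftrightarrow> (\<forall>A\<in>set_pmf R. real (length (queries A)) \<le> q)"

end

theory Submission
  imports Defs
begin

text \<open>
  For a scale \<open>h = 2 ^ k\<close> let \<open>I\<close> be the density of violated edges \<open>(x, x + h e\<^sub>i)\<close> and \<open>\<sigma>\<close> the density
  of a maximal matching among them. The main inequality is \<open>\<epsilon> \<le> C (\<Sum>k. sqrt (I \<sigma>))\<close>. To prove it,
  run Shellsort on the ones of \<open>f\<close>, sorting all directions modulo \<open>2 ^ k\<close> for decreasing \<open>k\<close>;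
  Knuth's lemma shows that this increases neither \<open>I\<close> nor the size of a vertex cover of the violated
  edges at the smaller scales. At one scale let \<open>f\<^sub>T\<close> be the function sorted in the directions \<open>T\<close>.
  For fixed \<open>x\<close>, a robust Talagrand inequality applies to \<open>T \<mapsto> f\<^sub>T x\<close> and shows that \<open>f\<^sub>T\<close> and
  \<open>f\<^sub>T\<^sub>'\<close> are close for random \<open>T\<close> and \<open>T'\<close> of density 1/8. If \<open>T\<^sub>1, ..., T\<^sub>8\<close> is a random partition of
  the directions, then sorting \<open>f\<^sub>T\<^sub>1\<close> in the remaining directions hardly changes it, and
  passing from \<open>f\<close> to \<open>f\<^sub>T\<^sub>1\<close> is the same problem with \<open>I\<close> divided by 8.

  A random edge is violated with probability \<open>I / d\<close>. For the walk, move each coordinate of a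
  uniform \<open>x\<close> down (to get \<open>z\<close>) or up (to get \<open>w\<close>) by \<open>h\<close> with probability \<open>p\<close>, using the same
  coordinates for \<open>z\<close> and \<open>w\<close>. If \<open>x\<close> lies on a matching edge whose direction is among them, then
  \<open>z\<close> and \<open>w\<close> are obtained from its lower and upper end, so they reveal a violation unless one of
  these moves changes the value of \<open>f\<close>. The latter has probability at most \<open>O(p sqrt d)\<close>, a bound on the
  total variation distance of \<open>z\<close> or \<open>w\<close> from \<open>x\<close>, plus the probability that \<open>x\<close>
  together with \<open>z\<close> or \<open>w\<close> is itself a violation. So \<open>p \<approx> \<sigma> / sqrt d\<close> gives success
  probability of order \<open>\<sigma>\<^sup>2 / sqrt d\<close>; combined with \<open>I / d\<close> this is of order \<open>(I \<sigma>) powr (2/3) / d powr (5/6)\<close>.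
\<close>

section \<open>Averages and random subsets\<close>

definition avg :: "'a set \<Rightarrow> ('a \<Rightarrow> real) \<Rightarrow> real" where
  "avg A f = sum f A / real (card A)"

lemma avg_mono: "(\<And>x. x \<in> A \<Longrightarrow> f x \<le> g x) \<Longrightarrow> avg A f \<le> avg A g"
  unfolding avg_def by (intro divide_right_mono sum_mono) auto

lemma avg_cong: "(\<And>x. x \<in> A \<Longrightarrow> f x = g x) \<Longrightarrow> avg A f = avg A g"
  unfolding avg_def by (metis (mono_tags, lifting) sum.cong)

lemma avg_add: "avg A (\<lambda>x. f x + g x) = avg A f + avg A g"
  unfolding avg_def by (simp add: sum.distrib add_divide_distrib)

lemma avg_diff: "avg A (\<lambda>x. f x - g x) = avg A f - avg A g"
  unfolding avg_def by (simp add: sum_subtractf diff_divide_distrib)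

lemma avg_cmult: "avg A (\<lambda>x. c * f x) = c * avg A f"
  unfolding avg_def by (simp add: sum_distrib_left)

lemma avg_sum: "avg A (\<lambda>x. \<Sum>i\<in>I. f i x) = (\<Sum>i\<in>I. avg A (f i))"
  unfolding avg_def by (subst sum.swap) (simp add: sum_divide_distrib)

lemma avg_const: "finite A \<Longrightarrow> A \<noteq> {} \<Longrightarrow> avg A (\<lambda>_. c) = c"
  unfolding avg_def by simp

lemma avg_nonneg: "(\<And>x. x \<in> A \<Longrightarrow> 0 \<le> f x) \<Longrightarrow> 0 \<le> avg A f"
  unfolding avg_def by (intro divide_nonneg_nonneg sum_nonneg) auto

lemma avg_PiE_insert:
  assumes I: "finite I" "i \<notin> I"
  shows "avg (PiE (insert i I) (\<lambda>_. B)) \<phi> =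
    avg B (\<lambda>b. avg (PiE I (\<lambda>_. B)) (\<lambda>c. \<phi> (c(i := b))))"
proof -
  let ?P = "PiE I (\<lambda>_. B)"
  have inj: "inj_on (\<lambda>(y, g). g(i := y)) (B \<times> ?P)"
    using inj_combinator[OF I(2), of "\<lambda>_. B"] by simp
  have "sum \<phi> (PiE (insert i I) (\<lambda>_. B)) = (\<Sum>(b, c)\<in>B \<times> ?P. \<phi> (c(i := b)))"
    unfolding PiE_insert_eq by (subst sum.reindex[OF inj]) (simp add: case_prod_unfold o_def)
  also have "\<dots> = (\<Sum>b\<in>B. \<Sum>c\<in>?P. \<phi> (c(i := b)))"
    by (simp add: sum.cartesian_product)
  finally have *: "sum \<phi> (PiE (insert i I) (\<lambda>_. B)) = (\<Sum>b\<in>B. \<Sum>c\<in>?P. \<phi> (c(i := b)))" .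
  have "card (PiE (insert i I) (\<lambda>_. B)) = card B * card ?P"
    using I by (simp add: card_PiE)
  then show ?thesis
    unfolding avg_def * by (simp add: sum_divide_distrib[symmetric] mult.commute)
qed

lemma avg_times:
  assumes "finite A" "finite B"
  shows "avg (A \<times> B) \<phi> = avg A (\<lambda>a. avg B (\<lambda>b. \<phi> (a, b)))"
proof -
  have "sum \<phi> (A \<times> B) = (\<Sum>a\<in>A. \<Sum>b\<in>B. \<phi> (a, b))"
    by (simp add: sum.cartesian_product)
  then show ?thesis
    by (simp add: avg_def card_cartesian_product sum_divide_distrib[symmetric] mult.commute)
qed

lemma avg_ge_single:
  assumes "finite A" "a \<in> A" "\<And>x. x \<in> A \<Longrightarrow> 0 \<le> f x"
  shows "f a / real (card A) \<le> avg A f"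
  unfolding avg_def using member_le_sum[of a A f] assms by (intro divide_right_mono) auto

lemma avg_le_one:
  assumes "finite A" "A \<noteq> {}" "\<And>x. x \<in> A \<Longrightarrow> f x \<le> 1"
  shows "avg A f \<le> 1"
  using avg_mono[of A f "\<lambda>_. 1"] avg_const[of A 1] assms by auto

lemma avg_prod:
  assumes "finite I"
  shows "avg (PiE I (\<lambda>_. B)) (\<lambda>x. \<Prod>i\<in>I. g (x i)) = avg B g ^ card I"
  using assms
proof (induction I rule: finite_induct)
  case empty
  then show ?case by (simp add: avg_def)
next
  case (insert i I)
  have "avg (PiE (insert i I) (\<lambda>_. B)) (\<lambda>x. \<Prod>j\<in>insert i I. g (x j)) =
      avg B (\<lambda>b. avg (PiE I (\<lambda>_. B)) (\<lambda>x. g b * (\<Prod>j\<in>I. g (x j))))"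
    unfolding avg_PiE_insert[OF insert.hyps]
  proof (intro avg_cong)
    fix b x
    have "(\<Prod>j\<in>I. g ((x(i := b)) j)) = (\<Prod>j\<in>I. g (x j))"
      using insert.hyps by (intro prod.cong) auto
    then show "(\<Prod>j\<in>insert i I. g ((x(i := b)) j)) = g b * (\<Prod>j\<in>I. g (x j))"
      using insert.hyps by simp
  qed
  also have "\<dots> = avg B (\<lambda>b. g b * avg B g ^ card I)"
    by (simp only: avg_cmult insert.IH)
  also have "\<dots> = avg B (\<lambda>b. (avg B g ^ card I) * g b)"
    by (simp only: mult.commute)
  also have "\<dots> = avg B g ^ card I * avg B g" by (rule avg_cmult)
  finally show ?case using insert.hyps by simp
qed

text \<open>The variance of \<open>\<bar>f x\<bar>\<close> is nonnegative.\<close>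

lemma avg_jensen_abs:
  assumes "finite A" "A \<noteq> {}"
  shows "avg A (\<lambda>x. \<bar>f x\<bar>) \<le> sqrt (avg A (\<lambda>x. (f x)\<^sup>2))"
proof -
  define m where "m = avg A (\<lambda>x. \<bar>f x\<bar>)"
  have "0 \<le> avg A (\<lambda>x. (\<bar>f x\<bar> - m)\<^sup>2)" by (intro avg_nonneg) auto
  also have "\<dots> = avg A (\<lambda>x. (f x)\<^sup>2 + ((-2 * m) * \<bar>f x\<bar> + m\<^sup>2))"
    by (intro avg_cong) (simp add: power2_diff algebra_simps)
  also have "\<dots> = avg A (\<lambda>x. (f x)\<^sup>2) + ((-2 * m) * m + m\<^sup>2)"
    unfolding avg_add avg_cmult m_def[symmetric] using assms by (simp add: avg_const)
  finally have "m\<^sup>2 \<le> avg A (\<lambda>x. (f x)\<^sup>2)" by (simp add: power2_eq_square)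
  then show ?thesis unfolding m_def by (rule real_le_rsqrt)
qed

section \<open>Biased random subsets\<close>

definition bexp :: "real \<Rightarrow> 'a set \<Rightarrow> ('a set \<Rightarrow> real) \<Rightarrow> real" where
  "bexp q I \<phi> = (\<Sum>T\<in>Pow I. q ^ card T * (1 - q) ^ card (I - T) * \<phi> T)"

lemma bexp_empty [simp]: "bexp q {} \<phi> = \<phi> {}"
  by (simp add: bexp_def)

lemma bexp_insert:
  assumes I: "finite I" "i \<notin> I"
  shows "bexp q (insert i I) \<phi> = q * bexp q I (\<lambda>T. \<phi> (insert i T)) + (1 - q) * bexp q I \<phi>"
proof -
  let ?w = "\<lambda>T. q ^ card T * (1 - q) ^ card (insert i I - T) * \<phi> T"
  have inj: "inj_on (insert i) (Pow I)"
    using I(2) by (intro inj_onI) (metis Pow_iff insert_ident subsetD)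
  have "bexp q (insert i I) \<phi> = sum ?w (Pow I) + sum ?w (insert i ` Pow I)"
    unfolding bexp_def Pow_insert using I by (subst sum.union_disjoint) auto
  also have "sum ?w (insert i ` Pow I) = q * bexp q I (\<lambda>T. \<phi> (insert i T))"
    unfolding sum.reindex[OF inj] bexp_def sum_distrib_left
  proof (intro sum.cong refl)
    fix T assume T: "T \<in> Pow I"
    then have "card (insert i T) = Suc (card T)" "insert i I - insert i T = I - T"
      using I by (auto simp: finite_subset[of T I] subset_iff intro!: card_insert_disjoint)
    then show "(?w \<circ> insert i) T = q * (q ^ card T * (1 - q) ^ card (I - T) * \<phi> (insert i T))"
      by simp
  qed
  also have "sum ?w (Pow I) = (1 - q) * bexp q I \<phi>"
    unfolding bexp_def sum_distrib_left
  proof (intro sum.cong refl)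
    fix T assume T: "T \<in> Pow I"
    then have "insert i I - T = insert i (I - T)" using I by auto
    then have "card (insert i I - T) = Suc (card (I - T))" using I by simp
    then show "?w T = (1 - q) * (q ^ card T * (1 - q) ^ card (I - T) * \<phi> T)" by simp
  qed
  finally show ?thesis by simp
qed

lemma bexp_add: "bexp q I (\<lambda>T. f T + g T) = bexp q I f + bexp q I g"
  unfolding bexp_def by (simp add: sum.distrib distrib_left)

lemma bexp_cmult: "bexp q I (\<lambda>T. c * f T) = c * bexp q I f"
  unfolding bexp_def by (simp add: sum_distrib_left mult_ac)

lemma bexp_sum: "bexp q I (\<lambda>T. \<Sum>i\<in>J. f i T) = (\<Sum>i\<in>J. bexp q I (f i))"
  unfolding bexp_def by (subst sum.swap) (simp add: sum_distrib_left)

lemma bexp_const: "finite I \<Longrightarrow> bexp q I (\<lambda>_. c) = c"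
  by (induction I rule: finite_induct) (auto simp: bexp_insert algebra_simps)

lemma bexp_mono:
  assumes "0 \<le> q" "q \<le> 1" "\<And>T. T \<subseteq> I \<Longrightarrow> f T \<le> g T"
  shows "bexp q I f \<le> bexp q I g"
  unfolding bexp_def using assms by (intro sum_mono mult_left_mono) auto

lemma bexp_cong: "(\<And>T. T \<subseteq> I \<Longrightarrow> f T = g T) \<Longrightarrow> bexp q I f = bexp q I g"
  unfolding bexp_def by (intro sum.cong) auto

lemma bexp_nonneg:
  assumes "0 \<le> q" "q \<le> 1" "\<And>T. T \<subseteq> I \<Longrightarrow> 0 \<le> f T"
  shows "0 \<le> bexp q I f"
  unfolding bexp_def using assms by (intro sum_nonneg mult_nonneg_nonneg) auto

text \<open>Whether \<open>i\<close> belongs to \<open>T\<close> is independent of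
  \<open>T - {i}\<close>.\<close>

lemma bexp_member:
  assumes "finite I" "i \<in> I"
  shows "bexp q I (\<lambda>T. of_bool (i \<in> T) * \<phi> (T - {i})) = q * bexp q I (\<lambda>T. \<phi> (T - {i}))"
proof -
  define J where "J = I - {i}"
  have J: "I = insert i J" "finite J" "i \<notin> J" using assms by (auto simp: J_def)
  have 1: "bexp q J (\<lambda>T. of_bool (i \<in> T) * \<phi> (T - {i})) = bexp q J (\<lambda>T. 0)"
    using J by (intro bexp_cong) auto
  have 2: "bexp q J (\<lambda>T. of_bool (i \<in> insert i T) * \<phi> (insert i T - {i})) = bexp q J \<phi>"
    "bexp q J (\<lambda>T. \<phi> (insert i T - {i})) = bexp q J \<phi>"
    "bexp q J (\<lambda>T. \<phi> (T - {i})) = bexp q J \<phi>"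
    using J by (auto intro!: bexp_cong arg_cong[where f = \<phi>])
  show ?thesis unfolding J(1) bexp_insert[OF J(2,3)] 1 2 bexp_const[OF J(2)]
    by (simp add: algebra_simps)
qed

text \<open>Under a uniform colouring the elements with colour in \<open>S\<close> are chosen
  independently of each other. This turns random partitions, and random sets of several densities,
  into averages over one finite set.\<close>

lemma avg_random_class:
  assumes I: "finite I" and S: "finite B" "B \<noteq> {}" "S \<subseteq> B"
  shows "avg (PiE I (\<lambda>_. B)) (\<lambda>c. \<phi> {i \<in> I. c i \<in> S}) = bexp (real (card S) / real (card B)) I \<phi>"
  using I
proof (induction I arbitrary: \<phi> rule: finite_induct)
  case empty
  then show ?case by (simp add: avg_def)
next
  case (insert i I)
  let ?E = "bexp (real (card S) / real (card B)) I"
  have set_eq: "{j \<in> insert i I. (c(i := b)) j \<in> S} =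
      (if b \<in> S then insert i {j \<in> I. c j \<in> S} else {j \<in> I. c j \<in> S})" for c :: "'a \<Rightarrow> 'b" and b
    using insert.hyps by auto
  have "avg (PiE (insert i I) (\<lambda>_. B)) (\<lambda>c. \<phi> {j \<in> insert i I. c j \<in> S}) =
      avg B (\<lambda>b. if b \<in> S then ?E (\<lambda>T. \<phi> (insert i T)) else ?E \<phi>)"
    unfolding avg_PiE_insert[OF insert.hyps] set_eq
    by (intro avg_cong) (auto simp: insert.IH[symmetric])
  also have "\<dots> = (\<Sum>b\<in>B. (if b \<in> S then ?E (\<lambda>T. \<phi> (insert i T)) - ?E \<phi> else 0) + ?E \<phi>) / real (card B)"
    unfolding avg_def by (auto intro!: arg_cong2[where f = "(/)"] sum.cong)
  also have "(\<Sum>b\<in>B. (if b \<in> S then ?E (\<lambda>T. \<phi> (insert i T)) - ?E \<phi> else 0) + ?E \<phi>) =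
      real (card S) * (?E (\<lambda>T. \<phi> (insert i T)) - ?E \<phi>) + real (card B) * ?E \<phi>"
    unfolding sum.distrib using S by (simp add: sum.If_cases Int_absorb1)
  also have "\<dots> / real (card B) = bexp (real (card S) / real (card B)) (insert i I) \<phi>"
    unfolding bexp_insert[OF insert.hyps] using S by (simp add: field_simps)
  finally show ?case .
qed

text \<open>Convexity of the Euclidean norm on the plane, by one use of the triangle inequality for
  each element of \<open>I\<close>.\<close>

lemma bexp_minkowski:
  assumes "finite I" "0 \<le> q" "q \<le> 1"
  shows "sqrt ((bexp q I \<phi>)\<^sup>2 + (bexp q I \<psi>)\<^sup>2) \<le> bexp q I (\<lambda>T. sqrt ((\<phi> T)\<^sup>2 + (\<psi> T)\<^sup>2))"
  using assms(1)
proof (induction I arbitrary: \<phi> \<psi> rule: finite_induct)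
  case empty
  then show ?case by simp
next
  case (insert i I)
  define a b c e where "a = bexp q I (\<lambda>T. \<phi> (insert i T))" and "b = bexp q I (\<lambda>T. \<psi> (insert i T))"
    and "c = bexp q I \<phi>" and "e = bexp q I \<psi>"
  have scale: "sqrt ((r * x)\<^sup>2 + (r * y)\<^sup>2) = r * sqrt (x\<^sup>2 + y\<^sup>2)" if "r \<ge> 0" for r x y :: real
    using that by (simp add: power_mult_distrib distrib_left[symmetric] real_sqrt_mult)
  have "sqrt ((q * a + (1 - q) * c)\<^sup>2 + (q * b + (1 - q) * e)\<^sup>2)
      \<le> sqrt ((q * a)\<^sup>2 + (q * b)\<^sup>2) + sqrt (((1 - q) * c)\<^sup>2 + ((1 - q) * e)\<^sup>2)"
    by (rule real_sqrt_sum_squares_triangle_ineq)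
  also have "\<dots> = q * sqrt (a\<^sup>2 + b\<^sup>2) + (1 - q) * sqrt (c\<^sup>2 + e\<^sup>2)"
    using assms by (simp only: scale)
  also have "\<dots> \<le> q * bexp q I (\<lambda>T. sqrt ((\<phi> (insert i T))\<^sup>2 + (\<psi> (insert i T))\<^sup>2))
      + (1 - q) * bexp q I (\<lambda>T. sqrt ((\<phi> T)\<^sup>2 + (\<psi> T)\<^sup>2))"
    unfolding a_def b_def c_def e_def
    using assms insert.IH by (intro add_mono mult_left_mono) auto
  finally show ?case
    unfolding bexp_insert[OF insert.hyps] a_def b_def c_def e_def .
qed

section \<open>A Talagrand inequality for biased random subsets\<close>

definition flip :: "'a \<Rightarrow> 'a set \<Rightarrow> 'a set" where
  "flip i T = (if i \<in> T then T - {i} else insert i T)"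

definition sens :: "'a set \<Rightarrow> ('a set \<Rightarrow> bool) \<Rightarrow> 'a set \<Rightarrow> real" where
  "sens I H T = real (card {i \<in> I. H T \<noteq> H (flip i T)})"

text \<open>The induction step of the Talagrand inequality: \<open>p0\<close> and \<open>p1\<close>
  are the means on the two faces of the cube, of weights 7/8 and 1/8, \<open>A0\<close> and
  \<open>A1\<close> their boundary terms, \<open>e0\<close> and \<open>e1\<close> the charges of the
  edges between the faces. Mixing the faces adds \<open>7/64 * D\<^sup>2\<close> to the mean
  variance, and these edges pay for it.\<close>

lemma talagrand_step:
  fixes A0 A1 p0 p1 e0 e1 :: real
  assumes p: "0 \<le> p0" "p0 \<le> 1" "0 \<le> p1" "p1 \<le> 1"
    and A: "p0 * (1 - p0) / 2 \<le> A0" "p1 * (1 - p1) / 2 \<le> A1"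
    and e: "0 \<le> e0" "0 \<le> e1" "\<bar>p0 - p1\<bar> \<le> e0 + e1"
  shows "(p1 / 8 + 7 / 8 * p0) * (1 - (p1 / 8 + 7 / 8 * p0)) / 2
    \<le> sqrt ((A1 / 8 + 7 / 8 * A0)\<^sup>2 + (e1 / 8 + 7 / 8 * e0)\<^sup>2)"
proof -
  define v where "v = p1 * (1 - p1) / 8 + 7 / 8 * (p0 * (1 - p0))"
  define D where "D = \<bar>p0 - p1\<bar>"
  define P where "P = p1 / 8 + 7 / 8 * p0"
  have D2: "D\<^sup>2 = (p0 - p1)\<^sup>2" by (simp add: D_def)
  have v0: "0 \<le> v" unfolding v_def using p by (intro add_nonneg_nonneg mult_nonneg_nonneg divide_nonneg_nonneg) auto
  have P: "P * (1 - P) = v + 7 / 64 * D\<^sup>2"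
    unfolding D2 unfolding P_def v_def by (simp add: power2_eq_square field_simps)
  have "0 \<le> (P - 1 / 2)\<^sup>2" by simp
  then have "v + 7 / 64 * D\<^sup>2 \<le> 1 / 4" unfolding P[symmetric] by (simp add: power2_eq_square algebra_simps)
  \<comment> \<open>After multiplication by \<open>D\<^sup>2\<close> this bounds the last two terms
    in the expansion of \<open>((v + 7/64 * D\<^sup>2) / 2)\<^sup>2\<close> by
    \<open>(D / 8)\<^sup>2\<close>.\<close>
  then have "7 / 32 * v + 49 / 4096 * D\<^sup>2 \<le> 1 / 16" using v0 zero_le_power2[of D] by linarith
  then have "(7 / 32 * v + 49 / 4096 * D\<^sup>2) * D\<^sup>2 \<le> 1 / 16 * D\<^sup>2"
    by (intro mult_right_mono) auto
  then have "((v + 7 / 64 * D\<^sup>2) / 2)\<^sup>2 \<le> (v / 2)\<^sup>2 + (D / 8)\<^sup>2"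
    by (simp add: power2_eq_square field_simps)
  also have "(v / 2)\<^sup>2 \<le> (A1 / 8 + 7 / 8 * A0)\<^sup>2"
    using v0 A unfolding v_def by (intro power_mono) auto
  \<comment> \<open>Both charges have weight at least 1/8, and
    \<open>D \<le> e0 + e1\<close>.\<close>
  also have "(D / 8)\<^sup>2 \<le> (e1 / 8 + 7 / 8 * e0)\<^sup>2"
    using e by (intro power_mono) (auto simp: D_def)
  finally have "((v + 7 / 64 * D\<^sup>2) / 2)\<^sup>2 \<le> (A1 / 8 + 7 / 8 * A0)\<^sup>2 + (e1 / 8 + 7 / 8 * e0)\<^sup>2"
    by simp
  then have "(v + 7 / 64 * D\<^sup>2) / 2 \<le> sqrt ((A1 / 8 + 7 / 8 * A0)\<^sup>2 + (e1 / 8 + 7 / 8 * e0)\<^sup>2)"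
    by (rule real_le_rsqrt)
  then show ?thesis using P by (simp add: P_def)
qed

lemma sens_insert:
  assumes "finite I" "i \<notin> I"
  shows "sens (insert i I) H T = sens I H T + of_bool (H T \<noteq> H (flip i T))"
proof -
  have "{j \<in> insert i I. H T \<noteq> H (flip j T)} =
     (if H T \<noteq> H (flip i T) then {i} else {}) \<union> {j \<in> I. H T \<noteq> H (flip j T)}" by auto
  then show ?thesis using assms by (auto simp: sens_def)
qed

lemma sens_nonneg [simp]: "0 \<le> sens I H T"
  by (simp add: sens_def)

text \<open>A robust form of Talagrand's isoperimetric inequality: every sensitive edge is charged to
  an endpoint in \<open>U\<close>.\<close>

lemma robust_talagrand:
  assumes "finite I"
    and "\<And>T i. T \<subseteq> I \<Longrightarrow> i \<in> I \<Longrightarrow> i \<notin> T \<Longrightarrow> H T \<noteq> H (insert i T) \<Longrightarrow> U T \<or> U (insert i T)"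
  defines "p \<equiv> bexp (1/8) I (\<lambda>T. of_bool (H T))"
  shows "p * (1 - p) / 2 \<le> bexp (1/8) I (\<lambda>T. of_bool (U T) * sqrt (sens I H T))"
  using assms(1,2) unfolding p_def
proof (induction I arbitrary: H U rule: finite_induct)
  case empty
  then show ?case by simp
next
  case (insert i I)
  note hyps = insert.hyps
  let ?E = "bexp (1/8) I"
  define H1 where "H1 T = H (insert i T)" for T
  define U1 where "U1 T = U (insert i T)" for T
  define p0 p1 where "p0 = ?E (\<lambda>T. of_bool (H T))" and "p1 = ?E (\<lambda>T. of_bool (H1 T))"
  define A0 A1 where "A0 = ?E (\<lambda>T. of_bool (U T) * sqrt (sens I H T))"
    and "A1 = ?E (\<lambda>T. of_bool (U1 T) * sqrt (sens I H1 T))"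
  define e0 e1 where "e0 = ?E (\<lambda>T. of_bool (U T \<and> H T \<noteq> H1 T))"
    and "e1 = ?E (\<lambda>T. of_bool (U1 T \<and> H T \<noteq> H1 T))"
  have A0: "p0 * (1 - p0) / 2 \<le> A0"
    unfolding A0_def p0_def using insert.prems by (intro insert.IH) auto
  have A1: "p1 * (1 - p1) / 2 \<le> A1"
    unfolding A1_def p1_def
  proof (intro insert.IH)
    fix T j assume "T \<subseteq> I" "j \<in> I" "j \<notin> T" "H1 T \<noteq> H1 (insert j T)"
    then show "U1 T \<or> U1 (insert j T)"
      using insert.prems[of "insert i T" j] hyps(2) by (auto simp: H1_def U1_def insert_commute)
  qed
  have e: "0 \<le> e0" "0 \<le> e1" unfolding e0_def e1_def by (auto intro!: bexp_nonneg)
  have p: "0 \<le> p0" "p0 \<le> 1" "0 \<le> p1" "p1 \<le> 1"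
    using bexp_mono[of "1/8" I "\<lambda>T. of_bool (H T)" "\<lambda>_. 1"]
      bexp_mono[of "1/8" I "\<lambda>T. of_bool (H1 T)" "\<lambda>_. 1"] bexp_const[OF hyps(1), of "1/8" 1]
    by (auto simp: p0_def p1_def intro!: bexp_nonneg)
  \<comment> \<open>An edge in direction \<open>i\<close> along which the value changes has an
    endpoint in \<open>U\<close>, so the means of the two faces differ by at most
    \<open>e0 + e1\<close>.\<close>
  have cover: "of_bool (H T) \<le> (of_bool (H1 T) :: real) + (of_bool (U T \<and> H T \<noteq> H1 T) + of_bool (U1 T \<and> H T \<noteq> H1 T))"
    "of_bool (H1 T) \<le> (of_bool (H T) :: real) + (of_bool (U T \<and> H T \<noteq> H1 T) + of_bool (U1 T \<and> H T \<noteq> H1 T))"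
    if "T \<subseteq> I" for T
    using insert.prems[of T i] that hyps(2) by (auto simp: H1_def U1_def of_bool_def)
  have "p0 \<le> p1 + (e0 + e1)" "p1 \<le> p0 + (e0 + e1)"
    unfolding p0_def p1_def e0_def e1_def bexp_add[symmetric]
    by (intro bexp_mono cover; simp)+
  then have pe: "\<bar>p0 - p1\<bar> \<le> e0 + e1" by auto
  have fl: "flip i T = insert i T" "flip i (insert i T) = T" if "T \<subseteq> I" for T
    using that hyps(2) by (auto simp: flip_def)
  have s0: "sens (insert i I) H T = sens I H T + of_bool (H T \<noteq> H1 T)" if "T \<subseteq> I" for T
    using sens_insert[OF hyps] fl[OF that] by (simp add: H1_def)
  have s1: "sens (insert i I) H (insert i T) = sens I H1 T + of_bool (H T \<noteq> H1 T)" if "T \<subseteq> I" for T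
  proof -
    have "flip j (insert i T) = insert i (flip j T)" if "j \<in> I" for j
      using that hyps(2) by (auto simp: flip_def)
    then have "sens I H (insert i T) = sens I H1 T"
      unfolding sens_def H1_def by (metis (mono_tags, lifting))
    then show ?thesis using sens_insert[OF hyps] fl[OF that] by (auto simp: H1_def)
  qed
  \<comment> \<open>The root of the sensitivity is the Euclidean norm of two contributions, that of
    the old directions and that of \<open>i\<close>; in this form \<open>bexp_minkowski\<close>
    applies.\<close>
  have root: "of_bool u * sqrt (s + of_bool c) = sqrt ((of_bool u * sqrt s)\<^sup>2 + (of_bool (u \<and> c))\<^sup>2)"
    if "0 \<le> s" for u c and s :: real
    using that by (auto simp: of_bool_def)
  have B0: "sqrt (A0\<^sup>2 + e0\<^sup>2) \<le> ?E (\<lambda>T. of_bool (U T) * sqrt (sens (insert i I) H T))"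
  proof -
    have "sqrt (A0\<^sup>2 + e0\<^sup>2) \<le> ?E (\<lambda>T. sqrt ((of_bool (U T) * sqrt (sens I H T))\<^sup>2 + (of_bool (U T \<and> H T \<noteq> H1 T))\<^sup>2))"
      unfolding A0_def e0_def by (rule bexp_minkowski) (use hyps in auto)
    also have "\<dots> = ?E (\<lambda>T. of_bool (U T) * sqrt (sens (insert i I) H T))"
      by (intro bexp_cong) (simp only: s0 root sens_nonneg)
    finally show ?thesis .
  qed
  have B1: "sqrt (A1\<^sup>2 + e1\<^sup>2) \<le> ?E (\<lambda>T. of_bool (U (insert i T)) * sqrt (sens (insert i I) H (insert i T)))"
  proof -
    have "sqrt (A1\<^sup>2 + e1\<^sup>2) \<le> ?E (\<lambda>T. sqrt ((of_bool (U1 T) * sqrt (sens I H1 T))\<^sup>2 + (of_bool (U1 T \<and> H T \<noteq> H1 T))\<^sup>2))"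
      unfolding A1_def e1_def by (rule bexp_minkowski) (use hyps in auto)
    also have "\<dots> = ?E (\<lambda>T. of_bool (U1 T) * sqrt (sens (insert i I) H (insert i T)))"
      by (intro bexp_cong) (simp only: s1 root sens_nonneg)
    finally show ?thesis by (simp only: U1_def)
  qed
  have scale: "sqrt ((r * x)\<^sup>2 + (r * y)\<^sup>2) = r * sqrt (x\<^sup>2 + y\<^sup>2)" if "r \<ge> 0" for r x y :: real
    using that by (simp add: power_mult_distrib distrib_left[symmetric] real_sqrt_mult)
  have "sqrt ((A1 / 8 + 7 / 8 * A0)\<^sup>2 + (e1 / 8 + 7 / 8 * e0)\<^sup>2) \<le>
      sqrt ((1/8 * A1)\<^sup>2 + (1/8 * e1)\<^sup>2) + sqrt ((7 / 8 * A0)\<^sup>2 + (7 / 8 * e0)\<^sup>2)"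
    using real_sqrt_sum_squares_triangle_ineq[of "1/8 * A1" "7 / 8 * A0" "1/8 * e1" "7 / 8 * e0"] by simp
  also have "\<dots> = 1/8 * sqrt (A1\<^sup>2 + e1\<^sup>2) + 7 / 8 * sqrt (A0\<^sup>2 + e0\<^sup>2)"
    by (simp only: scale)
  also have "\<dots> \<le> bexp (1/8) (insert i I) (\<lambda>T. of_bool (U T) * sqrt (sens (insert i I) H T))"
    unfolding bexp_insert[OF hyps] using B0 B1 by simp
  finally have *: "sqrt ((A1 / 8 + 7 / 8 * A0)\<^sup>2 + (e1 / 8 + 7 / 8 * e0)\<^sup>2)
      \<le> bexp (1/8) (insert i I) (\<lambda>T. of_bool (U T) * sqrt (sens (insert i I) H T))" .
  have "bexp (1/8) (insert i I) (\<lambda>T. of_bool (H T)) = p1 / 8 + 7 / 8 * p0"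
    unfolding bexp_insert[OF hyps] p0_def p1_def H1_def by simp
  then show ?case
    using order_trans[OF talagrand_step[OF p A0 A1 e pe] *] by simp
qed

section \<open>Sorting lines of the grid\<close>

definition shift :: "nat \<Rightarrow> nat \<Rightarrow> point \<Rightarrow> point" where
  "shift i h x = x(i := x i + h)"

lemma shift_inj [simp]: "shift i h x = shift i h y \<longleftrightarrow> x = y"
proof
  assume eq: "shift i h x = shift i h y"
  show "x = y"
  proof
    fix j show "x j = y j"
      using fun_cong[OF eq, of j] by (cases "j = i") (auto simp: shift_def)
  qed
qed simp

text \<open>The inner cardinality is the rank of \<open>x\<close> counted from the top. As the keys
  are distinct, the ranks run bijectively through \<open>{1..card C}\<close>.\<close>

lemma card_rank_le:
  fixes key :: "'a \<Rightarrow> nat"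
  assumes C: "finite C" "inj_on key C" and m: "m \<le> card C"
  shows "card {x \<in> C. card {y \<in> C. key x \<le> key y} \<le> m} = m"
proof -
  define r where "r x = card {y \<in> C. key x \<le> key y}" for x
  have less: "r y < r x" if "x \<in> C" "y \<in> C" "key x < key y" for x y
  proof -
    have "{z \<in> C. key y \<le> key z} \<subseteq> {z \<in> C. key x \<le> key z}" using that by auto
    moreover have "x \<in> {z \<in> C. key x \<le> key z}" "x \<notin> {z \<in> C. key y \<le> key z}"
      using that by auto
    ultimately have "{z \<in> C. key y \<le> key z} \<subset> {z \<in> C. key x \<le> key z}" by blast
    then show ?thesis unfolding r_def using C(1) by (intro psubset_card_mono) auto
  qed
  have inj: "inj_on r C"
    by (intro inj_onI) (metis C(2) inj_onD less nat_neq_iff)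
  have "r ` C \<subseteq> {1..card C}"
  proof safe
    fix x assume "x \<in> C"
    then have "card {x} \<le> r x"
      unfolding r_def using C(1) by (intro card_mono) auto
    moreover have "r x \<le> card C"
      unfolding r_def using C(1) by (intro card_mono) auto
    ultimately show "r x \<in> {1..card C}" by auto
  qed
  then have im: "r ` C = {1..card C}"
    by (intro card_subset_eq) (auto simp: card_image inj)
  have "r ` {x \<in> C. r x \<le> m} = {1..m}"
    using im m by (auto simp: image_iff set_eq_iff) (metis atLeastAtMost_iff imageE le_trans)
  moreover have "inj_on r {x \<in> C. r x \<le> m}"
    using inj by (rule inj_on_subset) auto
  ultimately have "card {x \<in> C. r x \<le> m} = card {1..m}"
    by (metis card_image)
  then show ?thesis by (simp add: r_def)
qed

locale hypergrid =
  fixes n d :: nat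
begin

definition chain :: "nat \<Rightarrow> nat \<Rightarrow> point \<Rightarrow> point set" where
  "chain i h x = {y \<in> grid n d. (\<forall>j. j \<noteq> i \<longrightarrow> y j = x j) \<and> y i mod h = x i mod h}"

text \<open>Rearranges the ones of (the indicator function of) \<open>A\<close> to the top of each residue class
  modulo \<open>h\<close> of each line in direction \<open>i\<close>.\<close>

definition sort_step :: "nat \<Rightarrow> nat \<Rightarrow> point set \<Rightarrow> point set" where
  "sort_step i h A =
     {x \<in> grid n d. card {y \<in> chain i h x. x i \<le> y i} \<le> card (A \<inter> chain i h x)}"

text \<open>For \<open>A = B\<close> this says that \<open>A\<close> is sorted modulo
  \<open>h\<close> in direction \<open>i\<close>. Two sets are allowed so that the same relation
  also links a set to a larger one that contains the upper ends of its violated edges.\<close>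

definition shifts_into :: "nat \<Rightarrow> nat \<Rightarrow> point set \<Rightarrow> point set \<Rightarrow> bool" where
  "shifts_into i h A B \<longleftrightarrow> (\<forall>x\<in>A. shift i h x \<in> grid n d \<longrightarrow> shift i h x \<in> B)"

definition viol_edges :: "nat \<Rightarrow> nat \<Rightarrow> point set \<Rightarrow> point set" where
  "viol_edges i h A = {x \<in> A. shift i h x \<in> grid n d \<and> shift i h x \<notin> A}"

lemma finite_subgrid: "A \<subseteq> grid n d \<Longrightarrow> finite A"
  by (rule finite_subset[OF _ finite_grid])

lemma shift_in_grid:
  assumes "x \<in> grid n d" "i \<in> {1..d}"
  shows "shift i h x \<in> grid n d \<longleftrightarrow> x i + h \<le> n"
proof -
  have x: "\<And>j. j \<in> {1..d} \<Longrightarrow> 1 \<le> x j \<and> x j \<le> n" "\<And>j. j \<notin> {1..d} \<Longrightarrow> x j = undefined"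
    using assms(1) unfolding grid_def by (auto simp: PiE_iff extensional_def)
  show ?thesis
  proof
    assume "shift i h x \<in> grid n d"
    then have "shift i h x i \<in> {1..n}" using assms(2) unfolding grid_def by (rule PiE_mem)
    then show "x i + h \<le> n" by (simp add: shift_def)
  next
    assume "x i + h \<le> n"
    then have "shift i h x j \<in> {1..n}" if "j \<in> {1..d}" for j
      using x(1)[OF that] by (auto simp: shift_def)
    moreover have "shift i h x j = undefined" if "j \<notin> {1..d}" for j
      using x(2)[OF that] assms(2) that by (auto simp: shift_def)
    ultimately show "shift i h x \<in> grid n d"
      unfolding grid_def by (intro PiE_I) auto
  qed
qed

lemma unshift_in_grid:
  assumes "shift i h x \<in> grid n d" "i \<in> {1..d}" "x i \<ge> 1"
  shows "x \<in> grid n d"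
proof -
  have *: "\<And>j. j \<in> {1..d} \<Longrightarrow> shift i h x j \<in> {1..n}"
    "\<And>j. j \<notin> {1..d} \<Longrightarrow> shift i h x j = undefined"
    using assms(1) unfolding grid_def by (auto simp: PiE_iff extensional_def)
  have "x j \<in> {1..n}" if "j \<in> {1..d}" for j
    using *(1)[OF that] assms(3) by (auto simp: shift_def split: if_splits)
  moreover have "x j = undefined" if "j \<notin> {1..d}" for j
    using *(2)[OF that] assms(2) that by (auto simp: shift_def split: if_splits)
  ultimately show ?thesis unfolding grid_def by (auto simp: PiE_iff extensional_def)
qed

lemma finite_chain: "finite (chain i h x)"
  unfolding chain_def using finite_grid by auto

lemma in_chain_self: "x \<in> grid n d \<Longrightarrow> x \<in> chain i h x"
  unfolding chain_def by simp

lemma chain_eq: "y \<in> chain i h x \<Longrightarrow> chain i h y = chain i h x"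
  unfolding chain_def by (intro Collect_cong) simp

lemma inj_on_chain: "inj_on (\<lambda>y. y i) (chain i h x)"
proof (intro inj_onI ext)
  fix y z j assume "y \<in> chain i h x" "z \<in> chain i h x" "y i = z i"
  then show "y j = z j" by (cases "j = i") (auto simp: chain_def)
qed

lemma sort_step_subset: "sort_step i h A \<subseteq> grid n d"
  by (auto simp: sort_step_def)

lemma sort_step_mono: "A \<subseteq> B \<Longrightarrow> sort_step i h A \<subseteq> sort_step i h B"
proof
  fix x assume AB: "A \<subseteq> B" and x: "x \<in> sort_step i h A"
  have "card (A \<inter> chain i h x) \<le> card (B \<inter> chain i h x)"
    using AB finite_chain by (intro card_mono) auto
  then show "x \<in> sort_step i h B" using x by (auto simp: sort_step_def)
qed

lemma card_sort_step_chain: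
  "card (sort_step i h A \<inter> chain i h x) = card (A \<inter> chain i h x)"
proof -
  define C where "C = chain i h x"
  have C: "finite C" "inj_on (\<lambda>y. y i) C" "card (A \<inter> C) \<le> card C"
    using finite_chain[of i h x] inj_on_chain[of i h x] by (auto simp: C_def intro: card_mono)
  have "y \<in> sort_step i h A \<longleftrightarrow> card {z \<in> C. y i \<le> z i} \<le> card (A \<inter> C)" if "y \<in> C" for y
  proof -
    have "chain i h y = C" "y \<in> grid n d" using that chain_eq by (auto simp: C_def chain_def)
    then show ?thesis by (simp add: sort_step_def)
  qed
  then have "sort_step i h A \<inter> C = {y \<in> C. card {z \<in> C. y i \<le> z i} \<le> card (A \<inter> C)}"
    by blast
  then show ?thesis
    using card_rank_le[OF C] by (simp only: C_def[symmetric])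
qed

lemma card_by_chains:
  assumes "A \<subseteq> grid n d"
  shows "card A = (\<Sum>c\<in>chain i h ` grid n d. card (A \<inter> c))"
proof -
  have fin: "finite A" using assms by (rule finite_subgrid)
  have eq: "{x \<in> A. chain i h x = c} = A \<inter> c" if "c \<in> chain i h ` grid n d" for c
    using that assms chain_eq in_chain_self by blast
  have "card A = (\<Sum>x\<in>A. 1)" by simp
  also have "\<dots> = (\<Sum>c\<in>chain i h ` grid n d. \<Sum>x | x \<in> A \<and> chain i h x = c. 1)"
    using fin finite_grid assms by (intro sum.group[symmetric]) auto
  also have "\<dots> = (\<Sum>c\<in>chain i h ` grid n d. card (A \<inter> c))"
    using eq by (intro sum.cong) auto
  finally show ?thesis .
qed

lemma card_sort_step:
  assumes "A \<subseteq> grid n d"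
  shows "card (sort_step i h A) = card A"
proof -
  have "card (sort_step i h A) = (\<Sum>c\<in>chain i h ` grid n d. card (sort_step i h A \<inter> c))"
    by (rule card_by_chains[OF sort_step_subset])
  also have "\<dots> = (\<Sum>c\<in>chain i h ` grid n d. card (A \<inter> c))"
    by (intro sum.cong) (auto simp: card_sort_step_chain)
  also have "\<dots> = card A"
    by (rule card_by_chains[OF assms, symmetric])
  finally show ?thesis .
qed

lemma shift_chain:
  assumes "y \<in> chain i h x" "shift j g y \<in> grid n d"
  shows "shift j g y \<in> chain i h (shift j g x)"
proof -
  have "(y i + g) mod h = (x i + g) mod h"
    using assms(1) by (auto simp: chain_def intro: mod_add_cong)
  then show ?thesis using assms by (auto simp: chain_def shift_def)
qed

lemma unshift_chain:
  assumes j: "j \<in> {1..d}" and x: "x \<in> grid n d" and y: "y \<in> chain i h (shift j g x)"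
    and ge: "shift j g x i \<le> y i"
  shows "\<exists>z \<in> chain i h x. x i \<le> z i \<and> y = shift j g z"
proof
  define z where "z = y(j := y j - g)"
  have xj: "x j \<ge> 1" using x j by (auto simp: grid_def PiE_iff)
  \<comment> \<open>This makes the truncated subtraction in \<open>z\<close> exact.\<close>
  have yj: "x j + g \<le> y j"
    using y ge by (cases "i = j") (auto simp: chain_def shift_def)
  have y_eq: "y = shift j g z" using yj by (auto simp: z_def shift_def fun_eq_iff)
  have zg: "z \<in> grid n d"
    by (rule unshift_in_grid[of j g]) (use y_eq y yj xj j in \<open>auto simp: z_def chain_def\<close>)
  have "z i mod h = x i mod h"
  proof (cases "i = j")
    case True
    then have "(z i + g) mod h = (x i + g) mod h"
      using y y_eq by (auto simp: chain_def shift_def)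
    then show ?thesis
      by (simp add: nat_mod_eq_iff)
  next
    case False
    then show ?thesis using y y_eq by (auto simp: chain_def shift_def)
  qed
  then show "z \<in> chain i h x"
    using zg y yj by (auto simp: chain_def z_def shift_def split: if_splits)
  show "x i \<le> z i \<and> y = shift j g z"
    using y_eq ge by (auto simp: shift_def z_def split: if_splits)
qed

text \<open>Knuth's lemma behind Shellsort: sorting modulo \<open>h\<close> respects every relation between
  values at a fixed distance.\<close>

lemma shifts_into_sort_step:
  assumes j: "j \<in> {1..d}" and AB: "A \<subseteq> grid n d" "B \<subseteq> grid n d" "shifts_into j g A B"
  shows "shifts_into j g (sort_step i h A) (sort_step i h B)"
  unfolding shifts_into_def
proof safe
  fix x assume x: "x \<in> sort_step i h A" and sx: "shift j g x \<in> grid n d"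
  have xg: "x \<in> grid n d" using x by (auto simp: sort_step_def)
  define C where "C = chain i h x"
  define D where "D = chain i h (shift j g x)"
  define C0 where "C0 = {y \<in> C. shift j g y \<in> grid n d}"
  have fin: "finite C" "finite D" "finite C0"
    using finite_chain by (auto simp: C_def D_def C0_def)
  \<comment> \<open>Points of the chain that the shift carries out of the grid lie above
    \<open>x\<close>: for \<open>i = j\<close> they are too high, and for
    \<open>i \<noteq> j\<close> there are none, since the chain is constant in coordinate
    \<open>j\<close>. So all of them count in the rank of \<open>x\<close>, while they account for
    at most as many ones of \<open>A\<close>.\<close>
  have above: "x i \<le> y i" if "y \<in> C" "y \<notin> C0" for y
  proof (rule ccontr)
    assume "\<not> ?thesis"
    moreover have "y \<in> grid n d" "\<not> y j + g \<le> n" "x j + g \<le> n" "\<forall>k. k \<noteq> i \<longrightarrow> y k = x k"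
      using that shift_in_grid[of y j g] shift_in_grid[of x j g] xg sx j
      by (auto simp: C0_def C_def chain_def)
    ultimately show False by (cases "i = j") auto
  qed
  have "card {y \<in> D. shift j g x i \<le> y i} \<le> card (shift j g ` {y \<in> C0. x i \<le> y i})"
  proof (intro card_mono)
    show "{y \<in> D. shift j g x i \<le> y i} \<subseteq> shift j g ` {y \<in> C0. x i \<le> y i}"
    proof
      fix y assume "y \<in> {y \<in> D. shift j g x i \<le> y i}"
      then obtain z where "z \<in> C" "x i \<le> z i" "y = shift j g z" "y \<in> grid n d"
        using unshift_chain[OF j xg, of y i h g] by (auto simp: C_def D_def chain_def)
      then show "y \<in> shift j g ` {y \<in> C0. x i \<le> y i}" by (auto simp: C0_def)
    qed
  qed (use fin in auto)
  also have "\<dots> \<le> card {y \<in> C0. x i \<le> y i}"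
    using fin by (intro card_image_le) auto
  also have "\<dots> = card ({y \<in> C. x i \<le> y i} - (C - C0))"
    by (rule arg_cong[where f = card]) (auto simp: C0_def)
  also have "\<dots> = card {y \<in> C. x i \<le> y i} - card (C - C0)"
    using above fin by (intro card_Diff_subset) auto
  also have "\<dots> \<le> card (A \<inter> C) - card (C - C0)"
    using x by (intro diff_le_mono) (auto simp: sort_step_def C_def)
  also have "\<dots> \<le> card ((A \<inter> C) - (C - C0))"
    using fin by (intro diff_card_le_card_Diff) auto
  also have "\<dots> = card (shift j g ` ((A \<inter> C) - (C - C0)))"
    by (intro card_image[symmetric] inj_onI) auto
  also have "\<dots> \<le> card (B \<inter> D)"
  proof (intro card_mono)
    show "shift j g ` ((A \<inter> C) - (C - C0)) \<subseteq> B \<inter> D"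
      using AB(3) shift_chain[of _ i h x j g]
      by (auto simp: shifts_into_def C0_def C_def D_def)
  qed (use fin in auto)
  finally show "shift j g x \<in> sort_step i h B"
    using sx by (auto simp: sort_step_def D_def)
qed

lemma shifts_into_iterate:
  assumes i: "i \<in> {1..d}" and A: "shifts_into i h A A"
    and x: "x \<in> A" "x \<in> grid n d" and y: "y \<in> chain i h x" "x i \<le> y i"
  shows "y \<in> A"
proof -
  have "h dvd (y i - x i)"
    using y by (auto simp: chain_def mod_eq_dvd_iff_nat)
  then obtain k where k: "y i = x i + k * h" using y(2) by (metis dvdE le_add_diff_inverse mult.commute)
  have "shift i (m * h) x \<in> A" if "m \<le> k" for m
    using that
  proof (induction m)
    case 0
    then show ?case using x by (simp add: shift_def)
  next
    case (Suc m)
    have "y i \<le> n" using y i by (auto simp: chain_def grid_def PiE_iff)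
    moreover have "Suc m * h \<le> k * h" using Suc.prems by (intro mult_right_mono) auto
    ultimately have "shift i (Suc m * h) x \<in> grid n d"
      using k shift_in_grid[OF x(2) i] by auto
    moreover have "shift i (Suc m * h) x = shift i h (shift i (m * h) x)"
      by (auto simp: shift_def)
    ultimately show ?case using Suc A by (auto simp: shifts_into_def)
  qed
  moreover have "shift i (k * h) x = y"
    using y k by (auto simp: shift_def chain_def fun_eq_iff)
  ultimately show ?thesis by auto
qed

lemma sort_step_sorted: "shifts_into i h (sort_step i h A) (sort_step i h A)"
  unfolding shifts_into_def
proof safe
  fix x assume x: "x \<in> sort_step i h A" and sx: "shift i h x \<in> grid n d"
  then have "shift i h x \<in> chain i h x" by (auto simp: chain_def shift_def)
  then have C: "chain i h (shift i h x) = chain i h x" by (rule chain_eq)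
  have "card {y \<in> chain i h x. x i + h \<le> y i} \<le> card {y \<in> chain i h x. x i \<le> y i}"
    using finite_chain by (intro card_mono) auto
  then show "shift i h x \<in> sort_step i h A"
    using x sx C by (auto simp: sort_step_def shift_def)
qed

text \<open>In a sorted set everything above a one in its chain is a one, which gives one inclusion;
  the cardinalities agree.\<close>

lemma sort_step_id:
  assumes i: "i \<in> {1..d}" and A: "A \<subseteq> grid n d" "shifts_into i h A A"
  shows "sort_step i h A = A"
proof (rule sym, rule card_subset_eq)
  show "finite (sort_step i h A)" by (rule finite_subgrid[OF sort_step_subset])
  show "card A = card (sort_step i h A)" using card_sort_step[OF A(1)] by simp
  show "A \<subseteq> sort_step i h A"
  proof
    fix x assume x: "x \<in> A"
    have "card {y \<in> chain i h x. x i \<le> y i} \<le> card (A \<inter> chain i h x)"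
      using finite_chain shifts_into_iterate[OF i A(2) x] x A(1) by (intro card_mono) auto
    then show "x \<in> sort_step i h A" using x A(1) by (auto simp: sort_step_def)
  qed
qed

text \<open>A residue class modulo \<open>h\<close> splits into two modulo \<open>2 * h\<close>, by
  the parity of the number of steps of length \<open>h\<close>.\<close>

lemma chain_double:
  assumes "y \<in> chain i h x"
  shows "y \<in> chain i (2 * h) x \<or>
    y i mod (2 * h) = (x i + h) mod (2 * h)"
proof -
  have "int (y i) mod int h = int (x i) mod int h"
    using assms by (simp add: chain_def zmod_int[symmetric])
  then obtain k where "int (y i) - int (x i) = int h * k"
    by (auto simp: mod_eq_dvd_iff)
  then have k: "int (y i) = int (x i) + int h * k" by simp
  show ?thesis
  proof (cases "even k")
    case True
    then obtain m where "k = 2 * m" by blast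
    then have "int (y i) mod int (2 * h) = int (x i) mod int (2 * h)"
      using k by (simp add: mod_eq_dvd_iff)
    then have "y i mod (2 * h) = x i mod (2 * h)" by (metis of_nat_eq_iff zmod_int)
    then show ?thesis using assms by (auto simp: chain_def)
  next
    case False
    then obtain m where "k = 2 * m + 1" by (blast elim: oddE)
    then have "int (y i) mod int (2 * h) = int (x i + h) mod int (2 * h)"
      using k by (simp add: mod_eq_dvd_iff algebra_simps)
    then have "y i mod (2 * h) = (x i + h) mod (2 * h)" by (metis of_nat_eq_iff zmod_int)
    then show ?thesis by auto
  qed
qed

text \<open>On sequences that are already sorted modulo \<open>2 * h\<close>, sorting modulo \<open>h\<close> moves values
  only across pairs at distance \<open>h\<close>.\<close>

lemma sort_step_lower:
  assumes i: "i \<in> {1..d}" and h: "h > 0" and AB: "A \<subseteq> B" "B \<subseteq> grid n d"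
    and A: "shifts_into i (2 * h) A A" and rel: "shifts_into i h A B"
  shows "sort_step i h A \<subseteq> B"
proof (rule ccontr)
  assume "\<not> ?thesis"
  then obtain x where x: "x \<in> sort_step i h A" "x \<notin> B" by blast
  then have xg: "x \<in> grid n d" by (auto simp: sort_step_def)
  \<comment> \<open>A one \<open>y\<close> of \<open>A\<close> at or below \<open>x\<close> is
    impossible: in the class of \<open>x\<close> modulo \<open>2 * h\<close> it would force
    \<open>x \<in> A\<close>, and in the other class it would force \<open>x\<close> lowered by
    \<open>h\<close> into \<open>A\<close> and then, by \<open>rel\<close>, \<open>x\<close> into
    \<open>B\<close>. So \<open>A\<close> has fewer ones in the chain than the rank of
    \<open>x\<close> requires.\<close>
  have above: "x i < y i" if y: "y \<in> A" "y \<in> chain i h x" for y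
  proof (rule ccontr)
    assume "\<not> ?thesis"
    then have le: "y i \<le> x i" by simp
    have yg: "y \<in> grid n d" using y AB by auto
    show False
    proof (cases "y \<in> chain i (2 * h) x")
      case True
      then have "x \<in> chain i (2 * h) y" using xg by (auto simp: chain_def)
      then have "x \<in> A" using shifts_into_iterate[OF i A y(1) yg] le by auto
      then show False using x AB by auto
    next
      case False
      then have m: "y i mod (2 * h) = (x i + h) mod (2 * h)" using chain_double[OF y(2)] by auto
      have "y i \<noteq> x i" using False y by (auto simp: chain_def)
      moreover have "h dvd x i - y i"
        using y(2) mod_eq_dvd_iff_nat[OF le, of h] by (simp add: chain_def)
      ultimately have "h \<le> x i - y i" using le by (intro dvd_imp_le) auto
      then have yx: "y i + h \<le> x i" using le by simp
      define z where "z = x(i := x i - h)"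
      have xz: "x = shift i h z" using yx by (auto simp: z_def shift_def)
      have "y i \<ge> 1" using yg i by (auto simp: grid_def PiE_iff)
      then have "z i \<ge> 1" using yx by (simp add: z_def)
      moreover have sz: "shift i h z \<in> grid n d" using xg by (subst xz[symmetric])
      ultimately have zg: "z \<in> grid n d" using unshift_in_grid i by blast
      have "x i + h = (x i - h) + 2 * h" using yx by simp
      then have "y i mod (2 * h) = (x i - h) mod (2 * h)" using m by (metis mod_add_self2)
      then have "z \<in> chain i (2 * h) y"
        using zg y(2) by (simp add: chain_def z_def)
      then have "z \<in> A"
        using shifts_into_iterate[OF i A y(1) yg] yx by (auto simp: z_def)
      then have "shift i h z \<in> B" using rel sz unfolding shifts_into_def by blast
      then have "x \<in> B" by (subst xz)
      then show False using x(2) by contradiction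
    qed
  qed
  have "card (A \<inter> chain i h x) \<le> card ({y \<in> chain i h x. x i \<le> y i} - {x})"
    using above finite_chain by (intro card_mono) (auto simp: less_imp_le)
  also have "\<dots> < card {y \<in> chain i h x. x i \<le> y i}"
    using in_chain_self[OF xg] finite_chain by (intro card_Diff1_less) auto
  finally show False using x by (auto simp: sort_step_def)
qed

text \<open>All points above some \<open>x \<in> A\<close> in its chain belong to \<open>B\<close>:
  those in the class of \<open>x\<close> modulo \<open>2 * h\<close> because \<open>A\<close> is
  sorted, the others because \<open>x\<close> raised by \<open>h\<close> is in \<open>B\<close> and
  \<open>B\<close> is sorted. So \<open>B\<close> has enough ones for \<open>x\<close> to be one
  after sorting.\<close>

lemma sort_step_upper:
  assumes i: "i \<in> {1..d}" and h: "h > 0" and AB: "A \<subseteq> B" "B \<subseteq> grid n d"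
    and A: "shifts_into i (2 * h) A A" and B: "shifts_into i (2 * h) B B"
    and rel: "shifts_into i h A B"
  shows "A \<subseteq> sort_step i h B"
proof
  fix x assume x: "x \<in> A"
  then have xg: "x \<in> grid n d" using AB by auto
  have "{y \<in> chain i h x. x i \<le> y i} \<subseteq> B \<inter> chain i h x"
  proof safe
    fix y assume y: "y \<in> chain i h x" "x i \<le> y i"
    show "y \<in> B"
    proof (cases "y \<in> chain i (2 * h) x")
      case True
      then show ?thesis using shifts_into_iterate[OF i A x xg] y AB by auto
    next
      case False
      then have m: "y i mod (2 * h) = (x i + h) mod (2 * h)" using chain_double[OF y(1)] by auto
      have yg: "y \<in> grid n d" using y by (auto simp: chain_def)
      have "y i \<noteq> x i" using False y by (auto simp: chain_def)
      moreover have "h dvd y i - x i"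
        using y(1) mod_eq_dvd_iff_nat[OF y(2), of h] by (simp add: chain_def)
      ultimately have "h \<le> y i - x i" using y(2) by (intro dvd_imp_le) auto
      then have yx: "x i + h \<le> y i" using y(2) by simp
      have "y i \<le> n" using yg i by (auto simp: grid_def PiE_iff)
      then have sg: "shift i h x \<in> grid n d" using yx shift_in_grid[OF xg i] by auto
      then have sB: "shift i h x \<in> B" using rel x by (auto simp: shifts_into_def)
      have "y \<in> chain i (2 * h) (shift i h x)"
        using y m by (auto simp: chain_def shift_def)
      then show ?thesis
        using shifts_into_iterate[OF i B sB sg] yx by (auto simp: shift_def)
    qed
  qed
  then have "card {y \<in> chain i h x. x i \<le> y i} \<le> card (B \<inter> chain i h x)"
    using finite_chain by (intro card_mono) auto
  then show "x \<in> sort_step i h B" using xg by (auto simp: sort_step_def)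
qed

section \<open>Operators that respect sizes, inclusions and shift relations\<close>

definition rearrangement :: "(point set \<Rightarrow> point set) \<Rightarrow> bool" where
  "rearrangement S \<longleftrightarrow>
     (\<forall>A\<subseteq>grid n d. S A \<subseteq> grid n d \<and> card (S A) = card A) \<and>
     (\<forall>A B. A \<subseteq> B \<and> B \<subseteq> grid n d \<longrightarrow> S A \<subseteq> S B) \<and>
     (\<forall>j\<in>{1..d}. \<forall>g A B. A \<subseteq> grid n d \<and> B \<subseteq> grid n d \<and> shifts_into j g A B
        \<longrightarrow> shifts_into j g (S A) (S B))"

lemma rearrangementD:
  assumes "rearrangement S"
  shows "A \<subseteq> grid n d \<Longrightarrow> S A \<subseteq> grid n d"
    and "A \<subseteq> grid n d \<Longrightarrow> card (S A) = card A"
    and "A \<subseteq> B \<Longrightarrow> B \<subseteq> grid n d \<Longrightarrow> S A \<subseteq> S B"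
    and "j \<in> {1..d} \<Longrightarrow> A \<subseteq> grid n d \<Longrightarrow> B \<subseteq> grid n d \<Longrightarrow> shifts_into j g A B
      \<Longrightarrow> shifts_into j g (S A) (S B)"
  using assms unfolding rearrangement_def by simp_all

lemma rearrangement_sort_step: "rearrangement (sort_step i h)"
  unfolding rearrangement_def
  by (intro conjI allI ballI impI sort_step_subset card_sort_step)
    (auto intro: shifts_into_sort_step simp: sort_step_mono)

lemma rearrangement_id: "rearrangement (\<lambda>A. A)"
  by (auto simp: rearrangement_def)

lemma rearrangement_comp:
  assumes "rearrangement S" "rearrangement S'"
  shows "rearrangement (\<lambda>A. S (S' A))"
  unfolding rearrangement_def
  by (intro conjI allI ballI impI)
    (simp_all add: rearrangementD[OF assms(1)] rearrangementD[OF assms(2)])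

definition diff_count :: "point set \<Rightarrow> point set \<Rightarrow> nat" where
  "diff_count A B = card ((A - B) \<union> (B - A))"

lemma diff_count_commute: "diff_count A B = diff_count B A"
  by (simp add: diff_count_def Un_commute)

lemma diff_count_self [simp]: "diff_count A A = 0"
  by (simp add: diff_count_def)

lemma diff_count_triangle:
  assumes "A \<subseteq> grid n d" "B \<subseteq> grid n d" "C \<subseteq> grid n d"
  shows "diff_count A C \<le> diff_count A B + diff_count B C"
proof -
  have fin: "finite A" "finite B" "finite C" using assms finite_subgrid by auto
  have "diff_count A C \<le> card (((A - B) \<union> (B - A)) \<union> ((B - C) \<union> (C - B)))"
    unfolding diff_count_def using fin by (intro card_mono) auto
  also have "\<dots> \<le> diff_count A B + diff_count B C"
    unfolding diff_count_def by (rule card_Un_le)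
  finally show ?thesis .
qed

lemma diff_count_split:
  assumes "A \<subseteq> grid n d" "B \<subseteq> grid n d"
  shows "diff_count A B = card (A - B) + card (B - A)"
  unfolding diff_count_def using assms[THEN finite_subgrid]
  by (intro card_Un_disjoint) auto

text \<open>Compare with \<open>S (A \<inter> B)\<close>, which is contained in both images and has
  as many elements as \<open>A \<inter> B\<close>.\<close>

lemma rearrangement_card_diff:
  assumes S: "rearrangement S" and AB: "A \<subseteq> grid n d" "B \<subseteq> grid n d"
  shows "card (S A - S B) \<le> card (A - B)"
proof -
  have fin: "finite A" "finite (S A)"
    using AB rearrangementD(1)[OF S AB(1)] finite_subgrid by auto
  have "S A - S B \<subseteq> S A - S (A \<inter> B)"
    using rearrangementD(3)[OF S, of "A \<inter> B" B] AB by auto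
  then have "card (S A - S B) \<le> card (S A - S (A \<inter> B))"
    using fin by (intro card_mono) auto
  also have "\<dots> = card (S A) - card (S (A \<inter> B))"
    using fin rearrangementD(3)[OF S, of "A \<inter> B" A] AB
    by (intro card_Diff_subset) (auto intro: finite_subset)
  also have "\<dots> = card A - card (A \<inter> B)"
    using rearrangementD(2)[OF S] AB by (simp add: le_infI1)
  also have "\<dots> = card (A - B)"
    using fin by (simp add: card_Diff_subset_Int)
  finally show ?thesis .
qed

lemma rearrangement_contract:
  assumes S: "rearrangement S" and AB: "A \<subseteq> grid n d" "B \<subseteq> grid n d"
  shows "diff_count (S A) (S B) \<le> diff_count A B"
  using rearrangement_card_diff[OF S AB] rearrangement_card_diff[OF S AB(2,1)]
    diff_count_split[OF AB]
    diff_count_split[OF rearrangementD(1)[OF S AB(1)] rearrangementD(1)[OF S AB(2)]] by simp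

lemma shifts_into_viol_closure:
  "shifts_into i h A (A \<union> shift i h ` viol_edges i h A)"
  by (auto simp: shifts_into_def viol_edges_def)

text \<open>\<open>U\<close> adds to \<open>A\<close> the upper ends of its violated edges. The
  relation from \<open>A\<close> to \<open>U\<close> passes to \<open>S A\<close> and
  \<open>S U\<close>, so the violated edges of \<open>S A\<close> inject into
  \<open>S U - S A\<close>, which is no larger than \<open>U - A\<close>.\<close>

lemma viol_edges_rearrangement:
  assumes S: "rearrangement S" and i: "i \<in> {1..d}" and A: "A \<subseteq> grid n d"
  shows "card (viol_edges i h (S A)) \<le> card (viol_edges i h A)"
proof -
  define U where "U = A \<union> shift i h ` viol_edges i h A"
  have U: "U \<subseteq> grid n d" "A \<subseteq> U" using A by (auto simp: U_def viol_edges_def)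
  have fin: "finite A" "finite U" using A U finite_subgrid by auto
  have rel: "shifts_into i h (S A) (S U)"
    using rearrangementD(4)[OF S i A U(1)] shifts_into_viol_closure by (auto simp: U_def)
  have "card (viol_edges i h (S A)) = card (shift i h ` viol_edges i h (S A))"
    by (intro card_image[symmetric] inj_onI) auto
  also have "\<dots> \<le> card (S U - S A)"
  proof (intro card_mono)
    show "finite (S U - S A)"
      using rearrangementD(1)[OF S U(1)] finite_subgrid by auto
    show "shift i h ` viol_edges i h (S A) \<subseteq> S U - S A"
      using rel by (auto simp: viol_edges_def shifts_into_def)
  qed
  also have "\<dots> \<le> card (U - A)" by (rule rearrangement_card_diff[OF S U(1) A])
  also have "\<dots> \<le> card (shift i h ` viol_edges i h A)"
    using fin by (intro card_mono) (auto simp: U_def viol_edges_def)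
  also have "\<dots> = card (viol_edges i h A)"
    by (intro card_image inj_onI) auto
  finally show ?thesis .
qed

text \<open>The sorted set stays inside a superset of \<open>A\<close> with at most one additional
  point per violated edge. This bounds the ones gained; equally many are lost.\<close>

lemma diff_count_sort_step:
  assumes i: "i \<in> {1..d}" and h: "h > 0" and A: "A \<subseteq> grid n d" "shifts_into i (2 * h) A A"
  shows "diff_count (sort_step i h A) A \<le> 2 * card (viol_edges i h A)"
proof -
  let ?S = "sort_step i (2 * h)"
  define U where "U = A \<union> shift i h ` viol_edges i h A"
  have U: "U \<subseteq> grid n d" "A \<subseteq> U" using A by (auto simp: U_def viol_edges_def)
  have fin: "finite A" "finite U" using A U finite_subgrid by auto
  have SA: "?S A = A" by (rule sort_step_id[OF i A])
  have AU: "A \<subseteq> ?S U" using sort_step_mono[OF U(2), of i "2 * h"] SA by simp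
  have rel: "shifts_into i h A (?S U)"
    using shifts_into_sort_step[OF i A(1) U(1) shifts_into_viol_closure[of i h A, folded U_def], of i "2 * h"]
      SA by simp
  have "sort_step i h A \<subseteq> ?S U"
    by (rule sort_step_lower[OF i h AU sort_step_subset A(2) rel])
  then have "card (sort_step i h A - A) \<le> card (?S U - ?S A)"
    using SA finite_subgrid[OF sort_step_subset[of i "2 * h" U]]
    by (intro card_mono) auto
  also have "\<dots> \<le> card (U - A)"
    by (rule rearrangement_card_diff[OF rearrangement_sort_step U(1) A(1)])
  also have "\<dots> \<le> card (shift i h ` viol_edges i h A)"
    using fin by (intro card_mono) (auto simp: U_def viol_edges_def)
  also have "\<dots> = card (viol_edges i h A)"
    by (intro card_image inj_onI) auto
  finally have 1: "card (sort_step i h A - A) \<le> card (viol_edges i h A)" .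
  have "card (sort_step i h A - A) = card (A - sort_step i h A)"
    using fin finite_subgrid[OF sort_step_subset] card_sort_step[OF A(1), of i h]
    by (simp add: card_Diff_subset_Int Int_commute)
  with 1 show ?thesis by (simp add: diff_count_split[OF sort_step_subset A(1)])
qed

section \<open>A directed Margulis inequality\<close>

primrec sorts :: "nat \<Rightarrow> nat \<Rightarrow> nat set \<Rightarrow> point set \<Rightarrow> point set" where
  "sorts 0 h T A = A"
| "sorts (Suc m) h T A =
     (if Suc m \<in> T then sort_step (Suc m) h (sorts m h T A) else sorts m h T A)"

lemma rearrangement_sorts: "rearrangement (sorts m h T)"
proof (induction m)
  case 0
  then show ?case using rearrangement_id by (simp add: fun_eq_iff cong: rev_conj_cong)
next
  case (Suc m)
  then show ?case
    using rearrangement_comp[OF rearrangement_sort_step[of "Suc m" h] Suc] Suc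
    by (cases "Suc m \<in> T") simp_all
qed

lemmas sorts_subset = rearrangementD(1)[OF rearrangement_sorts]
  and card_sorts = rearrangementD(2)[OF rearrangement_sorts]
  and sorts_mono = rearrangementD(3)[OF rearrangement_sorts]
  and sorts_shifts_into = rearrangementD(4)[OF rearrangement_sorts]

text \<open>By \<open>shifts_into_sort_step\<close> with both sets equal, later passes keep a sorted
  direction sorted.\<close>

lemma sorts_sorted:
  assumes "i \<in> T" "i \<in> {1..m}" "m \<le> d" "A \<subseteq> grid n d"
  shows "shifts_into i h (sorts m h T A) (sorts m h T A)"
  using assms
proof (induction m)
  case 0
  then show ?case by simp
next
  case (Suc m)
  show ?case
  proof (cases "i = Suc m")
    case True
    then show ?thesis using Suc.prems sort_step_sorted by simp
  next
    case False
    then have IH: "shifts_into i h (sorts m h T A) (sorts m h T A)" using Suc by auto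
    have "i \<in> {1..d}" using Suc.prems by auto
    then show ?thesis
      using IH shifts_into_sort_step sorts_subset[OF Suc.prems(4)] by simp
  qed
qed

lemma sorts_id:
  assumes "m \<le> d" "A \<subseteq> grid n d" "\<And>i. i \<in> T \<Longrightarrow> i \<in> {1..m} \<Longrightarrow> shifts_into i h A A"
  shows "sorts m h T A = A"
  using assms
proof (induction m)
  case 0
  then show ?case by simp
next
  case (Suc m)
  then have IH: "sorts m h T A = A" by simp
  show ?case
    using IH Suc.prems sort_step_id[of "Suc m" A h] by simp
qed

lemma sorts_insert_above: "m < i \<Longrightarrow> sorts m h (insert i T) A = sorts m h T A"
  by (induction m) auto

text \<open>Locates the effect of an extra direction: for a set between \<open>L\<close> and
  \<open>U\<close>, a point where sorting with and without \<open>i\<close> disagrees lies in the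
  sorted \<open>U\<close> but not in the sorted \<open>L\<close>, for one of the two sets of
  directions. \<open>sort_step_lower\<close> and \<open>sort_step_upper\<close> treat the pass in
  direction \<open>i\<close>, monotonicity the later ones.\<close>

lemma sorts_insert_cover:
  assumes i: "i \<in> {1..m}" "i \<notin> T" and md: "m \<le> d" and h: "h > 0"
    and LU: "L \<subseteq> U" "U \<subseteq> grid n d"
    and L: "shifts_into i (2 * h) L L" and U: "shifts_into i (2 * h) U U"
    and rel: "shifts_into i h L U"
  shows "sorts m h (insert i T) L \<subseteq> sorts m h T U"
    and "sorts m h T L \<subseteq> sorts m h (insert i T) U"
proof -
  have "sorts m h (insert i T) L \<subseteq> sorts m h T U \<and> sorts m h T L \<subseteq> sorts m h (insert i T) U"
    using i(1) md
  proof (induction m)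
    case 0
    then show ?case by simp
  next
    case (Suc m)
    have id: "i \<in> {1..d}" using Suc.prems by auto
    have Lg: "L \<subseteq> grid n d" using LU by auto
    show ?case
    proof (cases "i = Suc m")
      case True
      let ?L = "sorts m h T L" and ?U = "sorts m h T U"
      have ins: "sorts m h (insert i T) A = sorts m h T A" for A
        using True by (simp add: sorts_insert_above)
      have sub: "?L \<subseteq> ?U" "?U \<subseteq> grid n d" using sorts_mono[OF LU] sorts_subset[OF LU(2)] by auto
      have rels: "shifts_into i (2 * h) ?L ?L" "shifts_into i (2 * h) ?U ?U" "shifts_into i h ?L ?U"
        using sorts_shifts_into[OF id] Lg LU(2) L U rel by blast+
      show ?thesis
        using sort_step_lower[OF id h sub rels(1,3)] sort_step_upper[OF id h sub rels]
          True i(2) ins by simp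
    next
      case False
      then have IH: "sorts m h (insert i T) L \<subseteq> sorts m h T U"
        "sorts m h T L \<subseteq> sorts m h (insert i T) U"
        using Suc by auto
      then show ?thesis using False sort_step_mono by auto
    qed
  qed
  then show "sorts m h (insert i T) L \<subseteq> sorts m h T U"
    "sorts m h T L \<subseteq> sorts m h (insert i T) U" by auto
qed

text \<open>Only the pass in direction \<open>i\<close> creates a difference, and the later passes
  do not enlarge it.\<close>

lemma sorts_insert_diff:
  assumes i: "i \<in> {1..m}" "i \<notin> T" and md: "m \<le> d" and h: "h > 0"
    and F: "F \<subseteq> grid n d" "shifts_into i (2 * h) F F"
  shows "diff_count (sorts m h (insert i T) F) (sorts m h T F) \<le> 2 * card (viol_edges i h F)"
  using i(1) md
proof (induction m)
  case 0
  then show ?case by simp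
next
  case (Suc m)
  have id: "i \<in> {1..d}" using Suc.prems by auto
  show ?case
  proof (cases "i = Suc m")
    case True
    let ?F = "sorts m h T F"
    have "diff_count (sort_step i h ?F) ?F \<le> 2 * card (viol_edges i h ?F)"
      using F sorts_shifts_into[OF id F(1) F(1)] sorts_subset[OF F(1)]
      by (intro diff_count_sort_step id h) auto
    also have "\<dots> \<le> 2 * card (viol_edges i h F)"
      using viol_edges_rearrangement[OF rearrangement_sorts id F(1)] by simp
    finally show ?thesis
      using True i(2) by (simp add: sorts_insert_above)
  next
    case False
    then have IH: "diff_count (sorts m h (insert i T) F) (sorts m h T F) \<le> 2 * card (viol_edges i h F)"
      using Suc by auto
    have "diff_count (sort_step (Suc m) h (sorts m h (insert i T) F)) (sort_step (Suc m) h (sorts m h T F))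
      \<le> diff_count (sorts m h (insert i T) F) (sorts m h T F)"
      by (intro rearrangement_contract rearrangement_sort_step sorts_subset F)
    then show ?thesis using False IH by auto
  qed
qed

lemma diff_count_sum:
  assumes "A \<subseteq> grid n d" "B \<subseteq> grid n d"
  shows "real (diff_count A B) = (\<Sum>x\<in>grid n d. of_bool ((x \<in> A) \<noteq> (x \<in> B)))"
proof -
  have "(\<Sum>x\<in>grid n d. of_bool ((x \<in> A) \<noteq> (x \<in> B))) = real (card {x \<in> grid n d. (x \<in> A) \<noteq> (x \<in> B)})"
    using finite_grid by (simp add: Int_def)
  also have "{x \<in> grid n d. (x \<in> A) \<noteq> (x \<in> B)} = (A - B) \<union> (B - A)" using assms by auto
  finally show ?thesis by (simp add: diff_count_def)
qed

section \<open>Sorting all directions at one scale\<close>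

definition vcount_on :: "nat set \<Rightarrow> nat \<Rightarrow> point set \<Rightarrow> real" where
  "vcount_on B h A = (\<Sum>i\<in>B. real (card (viol_edges i h A)))"

definition card_gap :: "point set \<Rightarrow> point set \<Rightarrow> real" where
  "card_gap L U = real (card U) - real (card L)"

text \<open>\<open>F\<close> is the current stage of Shellsort. In the application \<open>L\<close>
  and \<open>U\<close> come from removing and adding a vertex cover of the violated edges, so
  \<open>card_gap L U\<close> is the size of the cover, and \<open>rel\<close> makes every violated
  edge of \<open>F\<close> have an endpoint in \<open>U - L\<close>.\<close>

context
  fixes h :: nat and F L U :: "point set"
  assumes h: "h > 0"
    and LFU: "L \<subseteq> F" "F \<subseteq> U" "U \<subseteq> grid n d"
    and sorted2: "\<And>i. i \<in> {1..d} \<Longrightarrow> shifts_into i (2 * h) L L"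
      "\<And>i. i \<in> {1..d} \<Longrightarrow> shifts_into i (2 * h) F F"
      "\<And>i. i \<in> {1..d} \<Longrightarrow> shifts_into i (2 * h) U U"
    and rel: "\<And>i. i \<in> {1..d} \<Longrightarrow> shifts_into i h L U"
begin

abbreviation "dims \<equiv> {1..d}"
abbreviation "srt T \<equiv> sorts d h T F"
abbreviation "vsum B \<equiv> vcount_on B h F"
abbreviation "gap \<equiv> card_gap L U"

lemma F_grid: "F \<subseteq> grid n d" and L_grid: "L \<subseteq> grid n d"
  using LFU by auto

lemma srt_grid: "srt T \<subseteq> grid n d"
  using sorts_subset[OF F_grid] .

lemma gap_sorts: "real (card (sorts d h T U - sorts d h T L)) = gap"
proof -
  have "sorts d h T L \<subseteq> sorts d h T U" using sorts_mono[of L U] LFU by auto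
  moreover have "finite (sorts d h T L)" using sorts_subset[OF L_grid] finite_subgrid by auto
  ultimately have "card (sorts d h T U - sorts d h T L) = card U - card L"
    using card_sorts[OF L_grid] card_sorts[OF LFU(3)] by (simp add: card_Diff_subset)
  moreover have "card L \<le> card U" using LFU finite_subgrid by (intro card_mono) auto
  ultimately show ?thesis by (simp add: card_gap_def)
qed

lemma gap_nonneg: "0 \<le> gap"
  using gap_sorts[of "{}"] by linarith

lemma vsum_nonneg: "0 \<le> vsum B"
  by (simp add: vcount_on_def sum_nonneg)

lemma flip_diff:
  assumes B: "B \<subseteq> dims" and i: "i \<in> dims" and T: "T \<subseteq> dims"
  shows "real (diff_count (srt (T \<inter> B)) (srt (flip i T \<inter> B))) \<le>
    (if i \<in> B then 2 * real (card (viol_edges i h F)) else 0)"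
proof (cases "i \<in> B")
  case False
  then have "flip i T \<inter> B = T \<inter> B" by (auto simp: flip_def)
  then show ?thesis using False by simp
next
  case True
  have *: "diff_count (srt (insert i (T' \<inter> B))) (srt (T' \<inter> B)) \<le> 2 * card (viol_edges i h F)"
    if "i \<notin> T'" for T'
    using that i F_grid sorted2(2)[OF i] h by (intro sorts_insert_diff) auto
  show ?thesis
  proof (cases "i \<in> T")
    case iT: True
    have "T \<inter> B = insert i ((T - {i}) \<inter> B)" using True iT by auto
    then show ?thesis using *[of "T - {i}"] True iT by (simp add: flip_def)
  next
    case iT: False
    have "flip i T \<inter> B = insert i (T \<inter> B)" using True iT by (auto simp: flip_def)
    then show ?thesis using *[OF iT] True by (simp add: diff_count_commute)
  qed
qed

text \<open>Cauchy-Schwarz over the grid. The indicators sum to \<open>gap\<close> by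
  \<open>gap_sorts\<close>; the sensitivities sum to the distances caused by flipping single
  directions, which \<open>flip_diff\<close> bounds.\<close>

lemma pointwise_cauchy:
  assumes B: "B \<subseteq> dims" and T: "T \<subseteq> dims"
  shows "(\<Sum>x\<in>grid n d. of_bool (x \<in> sorts d h (T \<inter> B) U - sorts d h (T \<inter> B) L) *
      sqrt (sens dims (\<lambda>T. x \<in> srt (T \<inter> B)) T)) \<le> sqrt (2 * vsum B * gap)"
proof -
  let ?u = "\<lambda>x. of_bool (x \<in> sorts d h (T \<inter> B) U - sorts d h (T \<inter> B) L) :: real"
  let ?s = "\<lambda>x. sens dims (\<lambda>T. x \<in> srt (T \<inter> B)) T"
  have "(\<Sum>x\<in>grid n d. ?u x * sqrt (?s x))\<^sup>2 \<le>
      (\<Sum>x\<in>grid n d. (?u x)\<^sup>2) * (\<Sum>x\<in>grid n d. (sqrt (?s x))\<^sup>2)"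
    by (rule Cauchy_Schwarz_ineq_sum)
  also have "(\<Sum>x\<in>grid n d. (sqrt (?s x))\<^sup>2) = (\<Sum>x\<in>grid n d. ?s x)"
    by simp
  also have "(\<Sum>x\<in>grid n d. (?u x)\<^sup>2) = gap"
  proof -
    have "(\<Sum>x\<in>grid n d. (?u x)\<^sup>2) = (\<Sum>x\<in>grid n d. ?u x)"
      by (intro sum.cong) (auto simp: of_bool_def)
    also have "\<dots> = real (card (grid n d \<inter> {x. x \<in> sorts d h (T \<inter> B) U - sorts d h (T \<inter> B) L}))"
      using finite_grid by simp
    also have "grid n d \<inter> {x. x \<in> sorts d h (T \<inter> B) U - sorts d h (T \<inter> B) L}
        = sorts d h (T \<inter> B) U - sorts d h (T \<inter> B) L"
      using sorts_subset[OF LFU(3)] by auto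
    finally show ?thesis using gap_sorts by simp
  qed
  also have "gap * (\<Sum>x\<in>grid n d. ?s x) \<le> gap * (2 * vsum B)"
  proof (intro mult_left_mono gap_nonneg)
    have "(\<Sum>x\<in>grid n d. ?s x) =
        (\<Sum>x\<in>grid n d. \<Sum>i\<in>dims. of_bool ((x \<in> srt (T \<inter> B)) \<noteq> (x \<in> srt (flip i T \<inter> B))))"
      by (intro sum.cong) (auto simp: sens_def Int_def)
    also have "\<dots> = (\<Sum>i\<in>dims. real (diff_count (srt (T \<inter> B)) (srt (flip i T \<inter> B))))"
      by (subst sum.swap) (simp only: diff_count_sum[OF srt_grid srt_grid])
    also have "\<dots> \<le> (\<Sum>i\<in>dims. if i \<in> B then 2 * real (card (viol_edges i h F)) else 0)"
      by (intro sum_mono flip_diff B T)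
    also have "\<dots> = 2 * vsum B"
    proof -
      have "dims \<inter> B = B" using B by auto
      then show ?thesis by (simp add: vcount_on_def sum_distrib_left sum.If_cases)
    qed
    finally show "(\<Sum>x\<in>grid n d. ?s x) \<le> 2 * vsum B" .
  qed
  finally have "(\<Sum>x\<in>grid n d. ?u x * sqrt (?s x))\<^sup>2 \<le> 2 * vsum B * gap"
    by (simp add: mult.commute)
  then show ?thesis by (rule real_le_rsqrt)
qed

text \<open>\<open>robust_talagrand\<close> for each \<open>x\<close>, with the difference of the
  sorted \<open>U\<close> and the sorted \<open>L\<close> as charging set;
  \<open>sorts_insert_cover\<close> verifies its hypothesis.\<close>

lemma variance_bound:
  assumes B: "B \<subseteq> dims"
  defines "p x \<equiv> bexp (1/8) dims (\<lambda>T. of_bool (x \<in> srt (T \<inter> B)))"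
  shows "(\<Sum>x\<in>grid n d. p x * (1 - p x) / 2) \<le> sqrt (2 * vsum B * gap)"
proof -
  let ?u = "\<lambda>x T. x \<in> sorts d h (T \<inter> B) U - sorts d h (T \<inter> B) L"
  let ?s = "\<lambda>x T. sens dims (\<lambda>T. x \<in> srt (T \<inter> B)) T"
  have "(\<Sum>x\<in>grid n d. p x * (1 - p x) / 2) \<le>
      (\<Sum>x\<in>grid n d. bexp (1/8) dims (\<lambda>T. of_bool (?u x T) * sqrt (?s x T)))"
    unfolding p_def
  proof (intro sum_mono robust_talagrand)
    fix x T i
    assume T: "T \<subseteq> dims" "i \<in> dims" "i \<notin> T"
      and ne: "(x \<in> srt (T \<inter> B)) \<noteq> (x \<in> srt (insert i T \<inter> B))"
    have iB: "i \<in> B" using ne by (cases "i \<in> B") auto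
    then have ins: "insert i T \<inter> B = insert i (T \<inter> B)" by auto
    have cover: "sorts d h (insert i (T \<inter> B)) L \<subseteq> sorts d h (T \<inter> B) U"
      "sorts d h (T \<inter> B) L \<subseteq> sorts d h (insert i (T \<inter> B)) U"
      using T LFU sorted2 rel h by (intro sorts_insert_cover; auto)+
    have sub: "sorts d h T' L \<subseteq> srt T'" "srt T' \<subseteq> sorts d h T' U" for T'
      using sorts_mono LFU F_grid by auto
    show "?u x T \<or> ?u x (insert i T)"
      using ne cover sub[of "T \<inter> B"] sub[of "insert i (T \<inter> B)"] unfolding ins by blast
  qed simp
  also have "\<dots> = bexp (1/8) dims (\<lambda>T. \<Sum>x\<in>grid n d. of_bool (?u x T) * sqrt (?s x T))"
    by (rule bexp_sum[symmetric])
  also have "\<dots> \<le> bexp (1/8) dims (\<lambda>_. sqrt (2 * vsum B * gap))"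
    using pointwise_cauchy[OF B] by (intro bexp_mono) auto
  also have "\<dots> = sqrt (2 * vsum B * gap)" by (simp add: bexp_const)
  finally show ?thesis .
qed

abbreviation "colourings \<equiv> PiE dims (\<lambda>_. {..<8::nat})"
abbreviation "cls B c a \<equiv> {i \<in> dims. c i = a} \<inter> B"

text \<open>Each class is a random set of density 1/8, so \<open>x\<close> lies in each sorted set
  with probability \<open>p x\<close>. If the values differ, one is true and one is false; two union
  bounds give \<open>2 * min (p x) (1 - p x)\<close>, which is at most
  \<open>4 * (p x * (1 - p x))\<close>.\<close>

lemma two_classes:
  assumes B: "B \<subseteq> dims" and a: "a < 8"
  shows "avg colourings (\<lambda>c. real (diff_count (srt (cls B c 0)) (srt (cls B c a))))
    \<le> 8 * sqrt (2 * vsum B * gap)"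
proof -
  define p where "p x = bexp (1/8) dims (\<lambda>T. of_bool (x \<in> srt (T \<inter> B)))" for x
  have marg: "avg colourings (\<lambda>c. of_bool (x \<in> srt (cls B c b))) = p x" if "b < 8" for b x
    using avg_random_class[of dims "{..<8::nat}" "{b}" "\<lambda>T. of_bool (x \<in> srt (T \<inter> B))"] that
    by (simp add: p_def lessThan_empty_iff)
  have fin: "finite colourings" "colourings \<noteq> {}"
    by (auto intro!: finite_PiE simp: PiE_eq_empty_iff lessThan_empty_iff)
  have point: "avg colourings (\<lambda>c. of_bool ((x \<in> srt (cls B c 0)) \<noteq> (x \<in> srt (cls B c a))))
      \<le> 4 * (p x * (1 - p x))" for x
  proof -
    let ?q = "avg colourings (\<lambda>c. of_bool ((x \<in> srt (cls B c 0)) \<noteq> (x \<in> srt (cls B c a))))"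
    have "?q \<le> avg colourings (\<lambda>c. of_bool (x \<in> srt (cls B c 0)) + of_bool (x \<in> srt (cls B c a)))"
      by (intro avg_mono) auto
    then have 1: "?q \<le> 2 * p x" using marg a by (simp add: avg_add)
    have "?q \<le> avg colourings (\<lambda>c. 2 - (of_bool (x \<in> srt (cls B c 0)) + of_bool (x \<in> srt (cls B c a))))"
      by (intro avg_mono) auto
    then have 2: "?q \<le> 2 - 2 * p x" using marg a fin by (simp add: avg_add avg_diff avg_const)
    have 0: "0 \<le> ?q" by (intro avg_nonneg) auto
    show ?thesis
    proof (cases "p x \<le> 1 / 2")
      case True
      have "p x \<ge> 0" using 0 1 by simp
      then have "p x * (1 / 2) \<le> p x * (1 - p x)" using True by (intro mult_left_mono) auto
      then show ?thesis using 1 by linarith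
    next
      case False
      have "1 - p x \<ge> 0" using 0 2 by simp
      moreover define r where "r = p x * (1 - p x)"
      ultimately have "1 / 2 * (1 - p x) \<le> r"
        using False unfolding r_def by (intro mult_right_mono) auto
      then have "2 - 2 * p x \<le> 4 * r" by simp
      then show ?thesis using order_trans[OF 2] by (simp only: r_def)
    qed
  qed
  have "avg colourings (\<lambda>c. real (diff_count (srt (cls B c 0)) (srt (cls B c a)))) =
      (\<Sum>x\<in>grid n d. avg colourings (\<lambda>c. of_bool ((x \<in> srt (cls B c 0)) \<noteq> (x \<in> srt (cls B c a)))))"
    unfolding diff_count_sum[OF srt_grid srt_grid] by (rule avg_sum)
  also have "\<dots> \<le> (\<Sum>x\<in>grid n d. 8 * (p x * (1 - p x) / 2))"
    using point by (intro sum_mono) auto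
  also have "\<dots> \<le> 8 * sqrt (2 * vsum B * gap)"
    using variance_bound[OF B] unfolding sum_distrib_left[symmetric] p_def by simp
  finally show ?thesis .
qed


abbreviation "chg B \<equiv> diff_count (srt B) F"

text \<open>Sorting fixes \<open>G\<close> and does not increase distances, so the image of
  \<open>F\<close> is as close to \<open>G\<close> as \<open>F\<close> was.\<close>

lemma chg_le_sorted:
  assumes "B \<subseteq> dims" "G \<subseteq> grid n d" "\<And>i. i \<in> B \<Longrightarrow> shifts_into i h G G"
  shows "chg B \<le> 2 * diff_count F G"
proof -
  have G: "sorts d h B G = G" using assms by (intro sorts_id) auto
  have "chg B \<le> diff_count (srt B) (sorts d h B G) + diff_count G F"
    using diff_count_triangle[OF srt_grid assms(2) F_grid] G by simp
  also have "diff_count (srt B) (sorts d h B G) \<le> diff_count F G"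
    by (rule rearrangement_contract[OF rearrangement_sorts F_grid assms(2)])
  finally show ?thesis by (simp add: diff_count_commute)
qed

text \<open>Sort the set \<open>?F 0\<close> successively in the classes 1 to 7. As
  \<open>?S a\<close> fixes \<open>?F a\<close>, round \<open>a\<close> increases the distance to
  \<open>?F 0\<close> by at most \<open>2 * diff_count (?F 0) (?F a)\<close>. Earlier classes stay
  sorted, so \<open>chg_le_sorted\<close> applies to \<open>G 7\<close>.\<close>

lemma chg_colouring:
  assumes B: "B \<subseteq> dims" and c: "c \<in> colourings"
  shows "chg B \<le> 2 * chg (cls B c 0) + 4 * (\<Sum>a\<in>{1..7}. diff_count (srt (cls B c 0)) (srt (cls B c a)))"
proof -
  let ?S = "\<lambda>a. sorts d h (cls B c a)"
  let ?F = "\<lambda>a. srt (cls B c a)"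
  define G where "G = rec_nat (?F 0) (\<lambda>k. ?S (Suc k))"
  have G0: "G 0 = ?F 0" and GS: "\<And>k. G (Suc k) = ?S (Suc k) (G k)" by (simp_all add: G_def)
  have Gg: "G k \<subseteq> grid n d" for k
    by (induction k) (use srt_grid sorts_subset in \<open>auto simp: G0 GS\<close>)
  have near: "diff_count (G k) (?F 0) \<le> 2 * (\<Sum>a\<in>{1..k}. diff_count (?F 0) (?F a))" for k
  proof (induction k)
    case 0
    then show ?case by (simp add: G0)
  next
    case (Suc k)
    have id: "?S (Suc k) (?F (Suc k)) = ?F (Suc k)"
      using F_grid by (intro sorts_id srt_grid sorts_sorted) auto
    have "diff_count (G (Suc k)) (?F 0) \<le>
        diff_count (?S (Suc k) (G k)) (?S (Suc k) (?F (Suc k))) + diff_count (?F (Suc k)) (?F 0)"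
      unfolding id GS by (intro diff_count_triangle sorts_subset Gg srt_grid)
    also have "diff_count (?S (Suc k) (G k)) (?S (Suc k) (?F (Suc k))) \<le> diff_count (G k) (?F (Suc k))"
      by (intro rearrangement_contract rearrangement_sorts Gg srt_grid)
    also have "\<dots> \<le> diff_count (G k) (?F 0) + diff_count (?F 0) (?F (Suc k))"
      by (intro diff_count_triangle Gg srt_grid)
    finally show ?case using Suc by (simp add: diff_count_commute)
  qed
  have sorted: "shifts_into i h (G k) (G k)" if "i \<in> dims" "i \<in> B" "c i \<le> k" for i k
    using that(3)
  proof (induction k)
    case 0
    then show ?case unfolding G0 using that F_grid by (intro sorts_sorted) auto
  next
    case (Suc k)
    show ?case
    proof (cases "c i = Suc k")
      case True
      then show ?thesis unfolding GS using that Gg by (intro sorts_sorted) auto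
    next
      case False
      then show ?thesis unfolding GS using Suc that(1) Gg by (intro sorts_shifts_into) auto
    qed
  qed
  have "shifts_into i h (G 7) (G 7)" if "i \<in> B" for i
  proof -
    have "i \<in> dims" using that B by auto
    moreover have "c i < 8" using PiE_mem[OF c \<open>i \<in> dims\<close>] by simp
    ultimately show ?thesis using sorted that by auto
  qed
  then have "chg B \<le> 2 * diff_count F (G 7)"
    by (intro chg_le_sorted B Gg)
  also have "diff_count F (G 7) \<le> diff_count F (?F 0) + diff_count (?F 0) (G 7)"
    by (intro diff_count_triangle F_grid Gg srt_grid)
  finally show ?thesis using near[of 7] by (simp add: diff_count_commute)
qed

lemma chg_recursion:
  assumes B: "B \<subseteq> dims"
  shows "real (chg B) \<le> 2 * bexp (1/8) dims (\<lambda>T. real (chg (T \<inter> B))) + 224 * sqrt (2 * vsum B * gap)"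
proof -
  have fin: "finite colourings" "colourings \<noteq> {}"
    by (auto intro!: finite_PiE simp: PiE_eq_empty_iff lessThan_empty_iff)
  have "real (chg B) = avg colourings (\<lambda>_. real (chg B))" using fin by (simp add: avg_const)
  also have "\<dots> \<le> avg colourings (\<lambda>c. 2 * real (chg (cls B c 0)) +
      4 * (\<Sum>a\<in>{1..7}. real (diff_count (srt (cls B c 0)) (srt (cls B c a)))))"
  proof (intro avg_mono)
    fix c assume "c \<in> colourings"
    then have "real (chg B) \<le> real (2 * chg (cls B c 0) +
        4 * (\<Sum>a\<in>{1..7}. diff_count (srt (cls B c 0)) (srt (cls B c a))))"
      using chg_colouring[OF B] by (intro of_nat_mono) auto
    then show "real (chg B) \<le> 2 * real (chg (cls B c 0)) +
        4 * (\<Sum>a\<in>{1..7}. real (diff_count (srt (cls B c 0)) (srt (cls B c a))))"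
      by simp
  qed
  also have "\<dots> = 2 * avg colourings (\<lambda>c. real (chg (cls B c 0))) +
      4 * (\<Sum>a\<in>{1..7}. avg colourings (\<lambda>c. real (diff_count (srt (cls B c 0)) (srt (cls B c a)))))"
    unfolding avg_add avg_cmult avg_sum ..
  \<comment> \<open>The constant 224 is the product of the weight 4, the seven classes and the 8
    from \<open>two_classes\<close>.\<close>
  also have "\<dots> \<le> 2 * avg colourings (\<lambda>c. real (chg (cls B c 0))) +
      4 * (\<Sum>a\<in>{1..7::nat}. 8 * sqrt (2 * vsum B * gap))"
    using two_classes[OF B] by (intro add_left_mono mult_left_mono sum_mono) auto
  also have "avg colourings (\<lambda>c. real (chg (cls B c 0))) = bexp (1/8) dims (\<lambda>T. real (chg (T \<inter> B)))"
    using avg_random_class[of dims "{..<8::nat}" "{0}" "\<lambda>T. real (chg (T \<inter> B))"]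
    by (simp add: lessThan_empty_iff)
  finally show ?thesis by simp
qed

text \<open>Jensen's inequality for the square root; each direction survives in \<open>T\<close>
  with probability 1/8.\<close>

lemma bexp_sqrt_vsum:
  assumes B: "B \<subseteq> dims"
  shows "bexp (1/8) dims (\<lambda>T. sqrt (vsum (T \<inter> B) * gap)) \<le> sqrt (vsum B * gap / 8)"
proof -
  let ?E = "bexp (1/8) dims"
  let ?s = "\<lambda>T. sqrt (vsum (T \<inter> B) * gap)"
  define m where "m = ?E ?s"
  have vexp: "?E (\<lambda>T. vsum (T \<inter> B)) = vsum B / 8"
  proof -
    have "vsum (T \<inter> B) = (\<Sum>i\<in>B. real (card (viol_edges i h F)) * of_bool (i \<in> T))" for T
      using B finite_subset[OF B] by (simp add: vcount_on_def sum.inter_restrict Int_commute)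
    then have "?E (\<lambda>T. vsum (T \<inter> B)) =
        (\<Sum>i\<in>B. real (card (viol_edges i h F)) * ?E (\<lambda>T. of_bool (i \<in> T)))"
      by (simp add: bexp_sum bexp_cmult)
    also have "\<dots> = (\<Sum>i\<in>B. real (card (viol_edges i h F)) * (1 / 8))"
    proof (intro sum.cong refl)
      fix i assume "i \<in> B"
      then have "?E (\<lambda>T. of_bool (i \<in> T)) = 1 / 8"
        using bexp_member[of dims i "1/8" "\<lambda>_. 1"] B by (auto simp: bexp_const)
      then show "real (card (viol_edges i h F)) * ?E (\<lambda>T. of_bool (i \<in> T)) =
        real (card (viol_edges i h F)) * (1 / 8)" by simp
    qed
    finally show ?thesis by (simp add: vcount_on_def sum_divide_distrib)
  qed
  have "0 \<le> ?E (\<lambda>T. (?s T - m)\<^sup>2)" by (intro bexp_nonneg) auto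
  also have "\<dots> = ?E (\<lambda>T. (?s T)\<^sup>2 + ((-2 * m) * ?s T + m\<^sup>2))"
    by (intro bexp_cong) (simp add: power2_diff algebra_simps)
  also have "\<dots> = ?E (\<lambda>T. (?s T)\<^sup>2) + ((-2 * m) * m + m\<^sup>2)"
    unfolding bexp_add bexp_cmult m_def[symmetric] by (simp add: bexp_const)
  also have "?E (\<lambda>T. (?s T)\<^sup>2) = ?E (\<lambda>T. gap * vsum (T \<inter> B))"
    using gap_nonneg vsum_nonneg by (intro bexp_cong) simp
  also have "\<dots> = vsum B * gap / 8"
    unfolding bexp_cmult vexp by simp
  finally have "m\<^sup>2 \<le> vsum B * gap / 8" by (simp add: power2_eq_square)
  then show ?thesis unfolding m_def by (rule real_le_rsqrt)
qed

text \<open>Settles the case of a zero denominator in \<open>chg_bound\<close>. If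
  \<open>gap = 0\<close> then \<open>L = F = U\<close> and \<open>rel\<close> says that
  \<open>F\<close> is sorted; otherwise no edge with direction in \<open>B\<close> is
  violated.\<close>

lemma chg_zero:
  assumes B: "B \<subseteq> dims" and z: "vsum B * gap = 0"
  shows "chg B = 0"
proof -
  have "shifts_into i h F F" if i: "i \<in> B" for i
  proof (cases "gap = 0")
    case True
    then have "L = U"
      using LFU finite_subgrid unfolding card_gap_def by (intro card_subset_eq) auto
    then show ?thesis using rel[of i] i B LFU by auto
  next
    case False
    then have "card (viol_edges i h F) = 0"
      using z i finite_subset[OF B] unfolding vcount_on_def by (auto simp: sum_nonneg_eq_0_iff)
    moreover have "finite (viol_edges i h F)"
      using F_grid by (intro finite_subgrid) (auto simp: viol_edges_def)
    ultimately show ?thesis by (auto simp: viol_edges_def shifts_into_def)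
  qed
  then have "srt B = F" using B F_grid by (intro sorts_id) auto
  then show ?thesis by simp
qed

text \<open>The best constant \<open>K\<close> satisfies \<open>K \<le> 2 / sqrt 8 * K + 224 * sqrt 2\<close>: passing to a random class
  divides \<open>vsum\<close> by 8, which beats the factor 2 lost in the recursion.\<close>

lemma chg_bound: "real (chg dims) \<le> 1100 * sqrt (vsum dims * gap)"
proof -
  define s where "s B = sqrt (vsum B * gap)" for B
  \<comment> \<open>Sets with \<open>s B = 0\<close> contribute 0, the value of a division by zero;
    for them \<open>le\<close> rests on \<open>chg_zero\<close>.\<close>
  define K where "K = Max ((\<lambda>B. real (chg B) / s B) ` Pow dims)"
  have le: "real (chg B) \<le> K * s B" if "B \<subseteq> dims" for B
  proof (cases "s B = 0")
    case True
    then have "vsum B * gap = 0" unfolding s_def by (simp only: real_sqrt_eq_0_iff)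
    then show ?thesis using chg_zero[OF that] True by simp
  next
    case False
    then have pos: "s B > 0" using gap_nonneg vsum_nonneg[of B] by (simp add: s_def order_less_le)
    have "real (chg B) / s B \<le> K" unfolding K_def using that by (intro Max_ge) auto
    then show ?thesis using pos by (simp add: field_simps)
  qed
  have "K \<in> (\<lambda>B. real (chg B) / s B) ` Pow dims" unfolding K_def by (intro Max_in) auto
  then obtain B where B: "B \<subseteq> dims" "K = real (chg B) / s B" by auto
  have s0: "0 \<le> s B'" for B' using gap_nonneg vsum_nonneg by (simp add: s_def)
  have K0: "0 \<le> K" using B s0 by simp
  \<comment> \<open>With this bound the inequality for \<open>K\<close> gives about 1082, which is
    rounded up to 1100.\<close>
  have sqrt2: "sqrt 2 \<le> 14143 / 10000"
    by (rule real_le_lsqrt) (auto simp: power2_eq_square)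
  have "K \<le> 1100"
  proof (cases "s B = 0")
    case True
    then show ?thesis using B by simp
  next
    case False
    then have pos: "s B > 0" using s0[of B] by simp
    have "K * s B = real (chg B)" using B False by simp
    also have "\<dots> \<le> 2 * bexp (1/8) dims (\<lambda>T. real (chg (T \<inter> B))) + 224 * sqrt (2 * vsum B * gap)"
      by (rule chg_recursion[OF B(1)])
    also have "bexp (1/8) dims (\<lambda>T. real (chg (T \<inter> B))) \<le> bexp (1/8) dims (\<lambda>T. K * s (T \<inter> B))"
      by (intro bexp_mono le) (use B in auto)
    also have "\<dots> = K * bexp (1/8) dims (\<lambda>T. s (T \<inter> B))" by (rule bexp_cmult)
    also have "\<dots> \<le> K * sqrt (vsum B * gap / 8)"
      using bexp_sqrt_vsum[OF B(1)] K0 by (intro mult_left_mono) (auto simp: s_def)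
    also have "sqrt (vsum B * gap / 8) = s B / sqrt 8" by (simp add: s_def real_sqrt_divide)
    also have "sqrt (2 * vsum B * gap) = sqrt 2 * s B" by (simp add: s_def real_sqrt_mult)
    finally have "K * s B \<le> (2 * K / sqrt 8 + 224 * sqrt 2) * s B" by (simp add: algebra_simps)
    then have "K \<le> 2 * K / sqrt 8 + 224 * sqrt 2" using pos by simp
    also have "2 * K / sqrt 8 = K / 2 * sqrt 2"
    proof -
      have "sqrt 8 = 2 * sqrt 2" using real_sqrt_mult[of 4 2] by simp
      then show ?thesis by (simp add: field_simps)
    qed
    also have "\<dots> \<le> K / 2 * (14143 / 10000)"
      using K0 sqrt2 by (intro mult_left_mono) auto
    also have "224 * sqrt 2 \<le> 224 * (14143 / 10000)"
      using sqrt2 by simp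
    finally show ?thesis by simp
  qed
  then have "K * s dims \<le> 1100 * s dims" using s0 by (intro mult_right_mono) auto
  then show ?thesis using le[of dims] by (simp add: s_def)
qed

end

section \<open>Shellsort through all scales\<close>

definition ones :: "(point \<Rightarrow> bool) \<Rightarrow> point set" where
  "ones f = {x \<in> grid n d. f x}"

lemma ones_grid: "ones f \<subseteq> grid n d"
  by (auto simp: ones_def)

text \<open>Round \<open>j\<close> leaves the set sorted modulo \<open>2 ^ (l - j)\<close>. The
  start needs no sorting when \<open>n \<le> 2 ^ l\<close>, because no edge of length
  \<open>2 ^ l\<close> fits into the grid.\<close>

primrec shell :: "nat \<Rightarrow> nat \<Rightarrow> point set \<Rightarrow> point set" where
  "shell l 0 A = A"
| "shell l (Suc j) A = sorts d (2 ^ (l - Suc j)) {1..d} (shell l j A)"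

lemma rearrangement_shell: "rearrangement (shell l j)"
proof (induction j)
  case 0
  then show ?case using rearrangement_id by (simp add: fun_eq_iff cong: rev_conj_cong)
next
  case (Suc j)
  then show ?case
    using rearrangement_comp[OF rearrangement_sorts[of d "2 ^ (l - Suc j)" "{1..d}"] Suc] by simp
qed

lemma shell_sorted:
  assumes n: "n \<le> 2 ^ l" and i: "i \<in> {1..d}" and A: "A \<subseteq> grid n d"
  shows "shifts_into i (2 ^ (l - j)) (shell l j A) (shell l j A)"
proof (cases j)
  case 0
  have "shift i (2 ^ l) x \<notin> grid n d" if "x \<in> A" for x
  proof -
    have "x \<in> grid n d" "1 \<le> x i" using that A i by (auto simp: grid_def PiE_iff)
    then show ?thesis using shift_in_grid[of x i "2 ^ l"] i n by auto
  qed
  then show ?thesis using 0 by (auto simp: shifts_into_def)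
next
  case (Suc j')
  then show ?thesis
    using i rearrangementD(1)[OF rearrangement_shell A] by (auto intro!: sorts_sorted)
qed

abbreviation "vcount \<equiv> vcount_on {1..d}"

definition covers :: "nat \<Rightarrow> point set \<Rightarrow> point set \<Rightarrow> bool" where
  "covers h A W \<longleftrightarrow> W \<subseteq> grid n d \<and>
     (\<forall>i\<in>{1..d}. \<forall>x\<in>viol_edges i h A. x \<in> W \<or> shift i h x \<in> W)"

text \<open>The cover \<open>W\<close> belongs to the original set \<open>A\<close>: it makes
  \<open>A - W\<close> shift into \<open>A \<union> W\<close>. The earlier rounds form a
  rearrangement, so they keep this relation and the size of the gap, which is \<open>card W\<close>,
  and do not increase the number of violated edges.\<close>

lemma shell_step:
  assumes n: "n \<le> 2 ^ l" and A: "A \<subseteq> grid n d" and j: "j < l"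
    and W: "covers (2 ^ (l - Suc j)) A W"
  shows "real (diff_count (shell l (Suc j) A) (shell l j A)) \<le>
    1100 * sqrt (vcount (2 ^ (l - Suc j)) A * real (card W))"
proof -
  define h :: nat where "h = 2 ^ (l - Suc j)"
  have h2: "2 * h = 2 ^ (l - j)" using j unfolding h_def
    by (metis Suc_diff_Suc power_Suc)
  define L0 U0 where "L0 = A - W" and "U0 = A \<union> W"
  define S where "S = shell l j"
  have S: "rearrangement S" unfolding S_def by (rule rearrangement_shell)
  have sub: "L0 \<subseteq> A" "A \<subseteq> U0" "U0 \<subseteq> grid n d" "L0 \<subseteq> grid n d"
    using A W by (auto simp: L0_def U0_def covers_def)
  have incl: "S L0 \<subseteq> S A" "S A \<subseteq> S U0" "S U0 \<subseteq> grid n d"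
    using rearrangementD(3)[OF S] rearrangementD(1)[OF S] sub A by auto
  have srt: "shifts_into i (2 * h) (S B) (S B)" if "i \<in> {1..d}" "B \<subseteq> grid n d" for i B
    unfolding h2 S_def using shell_sorted[OF n that] .
  have rel: "shifts_into i h (S L0) (S U0)" if i: "i \<in> {1..d}" for i
  proof -
    have "shifts_into i h L0 U0"
      using W i unfolding shifts_into_def covers_def viol_edges_def L0_def U0_def h_def by blast
    then show ?thesis using rearrangementD(4)[OF S i] sub by auto
  qed
  have "real (diff_count (sorts d h {1..d} (S A)) (S A)) \<le>
      1100 * sqrt (vcount h (S A) * card_gap (S L0) (S U0))"
    using chg_bound[OF _ incl srt[OF _ sub(4)] srt[OF _ A] srt[OF _ sub(3)] rel] by (simp add: h_def)
  also have "card_gap (S L0) (S U0) = real (card W)"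
  proof -
    have fin: "finite A" "finite W" using A W finite_subgrid by (auto simp: covers_def)
    have "card (A \<union> W) = card (A - W) + card W"
      using fin card_Un_disjoint[of "A - W" W] by (simp add: Un_Diff_cancel2 Diff_Int_distrib2)
    then show ?thesis using sub rearrangementD(2)[OF S]
      by (simp add: card_gap_def L0_def U0_def)
  qed
  also have "1100 * sqrt (vcount h (S A) * real (card W)) \<le> 1100 * sqrt (vcount h A * real (card W))"
  proof -
    have "vcount h (S A) \<le> vcount h A"
      unfolding vcount_on_def
      using viol_edges_rearrangement[OF S _ A] by (intro sum_mono) simp
    then show ?thesis by (intro mult_left_mono real_sqrt_le_mono mult_right_mono) auto
  qed
  finally show ?thesis by (simp add: h_def S_def)
qed

lemma shell_total:
  assumes n: "n \<le> 2 ^ l" and A: "A \<subseteq> grid n d"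
    and W: "\<And>k. k < l \<Longrightarrow> covers (2 ^ k) A (W k)"
  shows "real (diff_count A (shell l l A)) \<le> (\<Sum>k<l. 1100 * sqrt (vcount (2 ^ k) A * real (card (W k))))"
proof -
  have sub: "shell l j A \<subseteq> grid n d" for j by (rule rearrangementD(1)[OF rearrangement_shell A])
  have "real (diff_count A (shell l j A)) \<le>
      (\<Sum>m<j. 1100 * sqrt (vcount (2 ^ (l - Suc m)) A * real (card (W (l - Suc m)))))" if "j \<le> l" for j
    using that
  proof (induction j)
    case 0
    then show ?case by simp
  next
    case (Suc j)
    have "diff_count A (shell l (Suc j) A) \<le> diff_count A (shell l j A) + diff_count (shell l j A) (shell l (Suc j) A)"
      by (intro diff_count_triangle A sub)
    then have "real (diff_count A (shell l (Suc j) A)) \<le>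
        real (diff_count A (shell l j A)) + real (diff_count (shell l (Suc j) A) (shell l j A))"
      using diff_count_commute[of "shell l j A"] by (metis of_nat_add of_nat_mono)
    also have "\<dots> \<le> (\<Sum>m<j. 1100 * sqrt (vcount (2 ^ (l - Suc m)) A * real (card (W (l - Suc m))))) +
        1100 * sqrt (vcount (2 ^ (l - Suc j)) A * real (card (W (l - Suc j))))"
      using Suc by (intro add_mono shell_step[OF n A] W) auto
    finally show ?case by simp
  qed
  from this[of l] show ?thesis
    using sum.nat_diff_reindex[of "\<lambda>k. 1100 * sqrt (vcount (2 ^ k) A * real (card (W k)))" l] by simp
qed

section \<open>Distance to monotonicity, matchings and vertex covers\<close>

lemma sorted_imp_grid_mono:
  assumes G: "\<And>i. i \<in> {1..d} \<Longrightarrow> shifts_into i 1 G G" "G \<subseteq> grid n d"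
  shows "grid_mono n d (\<lambda>x. x \<in> G)"
  unfolding grid_mono_def
proof (rule monotone_onI)
  fix x y assume x: "x \<in> grid n d" and y: "y \<in> grid n d" and le: "coord_le d x y"
  \<comment> \<open>Coordinates are raised from \<open>x\<close> to \<open>y\<close> one at a time,
    so that consecutive points lie on a common chain with step 1.\<close>
  define z where "z m = (\<lambda>j. if j \<le> m then y j else x j)" for m :: nat
  have zg: "z m \<in> grid n d" for m
    using x y by (auto simp: grid_def PiE_iff extensional_def z_def)
  have "z m \<in> G" if "x \<in> G" "m \<le> d" for m
    using that(2)
  proof (induction m)
    case 0
    have "y 0 = x 0" using x y by (auto simp: grid_def PiE_iff extensional_def)
    then have "z 0 = x" by (auto simp: z_def)
    then show ?case using that by simp
  next
    case (Suc m)
    have "z (Suc m) \<in> chain (Suc m) 1 (z m)"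
      using zg[of "Suc m"] by (auto simp: chain_def z_def)
    moreover have "z m (Suc m) \<le> z (Suc m) (Suc m)"
      using le Suc.prems by (auto simp: z_def coord_le_def)
    moreover have "Suc m \<in> {1..d}" "z m \<in> G" using Suc by auto
    ultimately show ?case
      using shifts_into_iterate[OF _ G(1)] zg by blast
  qed
  moreover have "z d = y"
    using x y by (auto simp: z_def grid_def PiE_iff extensional_def fun_eq_iff)
  ultimately show "(x \<in> G) \<le> (y \<in> G)" by auto
qed

lemma far_le_diff_count:
  assumes far: "far_from_mono n d \<epsilon> f" and n: "n \<ge> 1"
    and G: "\<And>i. i \<in> {1..d} \<Longrightarrow> shifts_into i 1 G G" "G \<subseteq> grid n d"
  shows "\<epsilon> * real (card (grid n d)) \<le> real (diff_count (ones f) G)"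
proof -
  have pos: "card (grid n d) > 0"
    using n finite_grid by (auto simp: card_gt_0_iff grid_def PiE_eq_empty_iff)
  have "\<epsilon> \<le> mono_dist n d f" using far by (simp add: far_from_mono_def)
  also have "\<dots> \<le> rel_dist n d f (\<lambda>x. x \<in> G)"
    unfolding mono_dist_def using sorted_imp_grid_mono[OF G] finite_mono_dists
    by (intro Min_le) auto
  also have "{x \<in> grid n d. f x \<noteq> (x \<in> G)} = (ones f - G) \<union> (G - ones f)"
    using G(2) by (auto simp: ones_def)
  then have "rel_dist n d f (\<lambda>x. x \<in> G) = real (diff_count (ones f) G) / real (card (grid n d))"
    by (simp add: rel_dist_def diff_count_def)
  finally show ?thesis using pos by (simp add: field_simps)
qed

text \<open>A pair \<open>(x, i)\<close> stands for the edge from \<open>x\<close> to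
  \<open>shift i h x\<close>. Lower ends lie in \<open>A\<close> and upper ends outside, so
  injectivity on each side makes the edges vertex-disjoint.\<close>

definition matching :: "nat \<Rightarrow> point set \<Rightarrow> (point \<times> nat) set \<Rightarrow> bool" where
  "matching h A M \<longleftrightarrow> (\<forall>(x, i)\<in>M. i \<in> {1..d} \<and> x \<in> viol_edges i h A) \<and>
     inj_on fst M \<and> inj_on (\<lambda>(x, i). shift i h x) M"

lemma matching_subset_Sigma:
  "matching h A M \<Longrightarrow> M \<subseteq> prod.swap ` Sigma {1..d} (\<lambda>i. viol_edges i h A)"
  by (force simp: matching_def)

lemma finite_viol_edges: "A \<subseteq> grid n d \<Longrightarrow> finite (viol_edges i h A)"
  by (rule finite_subset[of _ A]) (auto simp: viol_edges_def finite_subgrid)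

lemma finite_matching:
  assumes "A \<subseteq> grid n d" "matching h A M"
  shows "finite M"
  using finite_subset[OF matching_subset_Sigma[OF assms(2)]] finite_viol_edges[OF assms(1)] by auto

lemma card_matching_le:
  assumes "A \<subseteq> grid n d" "matching h A M"
  shows "real (card M) \<le> vcount h A"
proof -
  have "card M \<le> card (prod.swap ` Sigma {1..d} (\<lambda>i. viol_edges i h A))"
    using matching_subset_Sigma[OF assms(2)] finite_viol_edges[OF assms(1)] by (intro card_mono) auto
  also have "\<dots> \<le> card (Sigma {1..d} (\<lambda>i. viol_edges i h A))"
    using finite_viol_edges[OF assms(1)] by (intro card_image_le) auto
  also have "\<dots> = (\<Sum>i\<in>{1..d}. card (viol_edges i h A))"
    using finite_viol_edges[OF assms(1)] by (intro card_SigmaI) auto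
  finally have "real (card M) \<le> real (\<Sum>i\<in>{1..d}. card (viol_edges i h A))" by (rule of_nat_mono)
  then show ?thesis by (simp add: vcount_on_def)
qed

text \<open>The ends of a largest matching form a cover, since an uncovered edge could be added to
  it.\<close>

lemma ex_matching_cover:
  assumes A: "A \<subseteq> grid n d"
  shows "\<exists>M W. matching h A M \<and> covers h A W \<and> card W \<le> 2 * card M"
proof -
  have "card M < Suc (nat \<lceil>vcount h A\<rceil>)" if "matching h A M" for M
    using card_matching_le[OF A that] by linarith
  moreover have "matching h A {}" by (simp add: matching_def)
  ultimately obtain M where M: "matching h A M" "\<And>M'. matching h A M' \<Longrightarrow> card M' \<le> card M"
    using ex_has_greatest_nat[of "matching h A" "{}" card "Suc (nat \<lceil>vcount h A\<rceil>)"] by blast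
  have fin: "finite M" by (rule finite_matching[OF A M(1)])
  define W where "W = fst ` M \<union> (\<lambda>(x, i). shift i h x) ` M"
  have "covers h A W"
    unfolding covers_def
  proof (intro conjI ballI)
    show "W \<subseteq> grid n d"
      using M(1) A by (auto simp: W_def matching_def viol_edges_def)
    fix i x assume i: "i \<in> {1..d}" and x: "x \<in> viol_edges i h A"
    show "x \<in> W \<or> shift i h x \<in> W"
    proof (rule ccontr)
      assume no: "\<not> ?thesis"
      then have new: "(x, i) \<notin> M" by (force simp: W_def)
      have "x \<notin> fst ` M" "shift i h x \<notin> (\<lambda>(x, i). shift i h x) ` M" using no by (auto simp: W_def)
      then have "matching h A (insert (x, i) M)"
        using M(1) i x new unfolding matching_def by (auto simp: inj_on_insert)
      from M(2)[OF this] show False using fin new by simp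
    qed
  qed
  moreover have "card W \<le> 2 * card M"
    unfolding W_def using fin card_Un_le[of "fst ` M" "(\<lambda>(x, i). shift i h x) ` M"]
      card_image_le[OF fin, of fst] card_image_le[OF fin, of "\<lambda>(x, i). shift i h x"] by linarith
  ultimately show ?thesis using M(1) by blast
qed

text \<open>The last stage of Shellsort is sorted modulo 1, hence monotone, and so far from
  \<open>f\<close>. The ends of maximal matchings serve as covers in \<open>shell_total\<close>,
  which costs the factor 2.\<close>

lemma directed_margulis:
  assumes far: "far_from_mono n d \<epsilon> f" and n: "n \<ge> 1" "n \<le> 2 ^ l"
  shows "\<exists>M. (\<forall>k. matching (2 ^ k) (ones f) (M k)) \<and>
    \<epsilon> * real (card (grid n d)) \<le>
      (\<Sum>k<l. 1100 * sqrt (2 * vcount (2 ^ k) (ones f) * real (card (M k))))"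
proof -
  have "\<forall>k. \<exists>M W. matching (2 ^ k) (ones f) M \<and> covers (2 ^ k) (ones f) W \<and> card W \<le> 2 * card M"
    using ex_matching_cover[OF ones_grid] by blast
  then obtain M W where MW: "\<And>k. matching (2 ^ k) (ones f) (M k)" "\<And>k. covers (2 ^ k) (ones f) (W k)"
    "\<And>k. card (W k) \<le> 2 * card (M k)"
    unfolding choice_iff by blast
  have "\<epsilon> * real (card (grid n d)) \<le> real (diff_count (ones f) (shell l l (ones f)))"
    using shell_sorted[OF n(2) _ ones_grid, of _ l f] rearrangementD(1)[OF rearrangement_shell ones_grid]
    by (intro far_le_diff_count far n(1)) auto
  also have "\<dots> \<le> (\<Sum>k<l. 1100 * sqrt (vcount (2 ^ k) (ones f) * real (card (W k))))"
    by (intro shell_total n ones_grid MW)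
  also have "\<dots> \<le> (\<Sum>k<l. 1100 * sqrt (2 * vcount (2 ^ k) (ones f) * real (card (M k))))"
  proof (intro sum_mono mult_left_mono real_sqrt_le_mono)
    fix k
    have "real (card (W k)) \<le> 2 * real (card (M k))" using of_nat_mono[OF MW(3)[of k], where ?'a = real] by simp
    then have "vcount (2 ^ k) (ones f) * real (card (W k)) \<le> vcount (2 ^ k) (ones f) * (2 * real (card (M k)))"
      by (intro mult_left_mono) (auto simp: vcount_on_def sum_nonneg)
    then show "vcount (2 ^ k) (ones f) * real (card (W k)) \<le> 2 * vcount (2 ^ k) (ones f) * real (card (M k))"
      by (simp add: mult_ac)
  qed simp
  finally show ?thesis using MW(1) by blast
qed

end

section \<open>The directed random walk\<close>

definition move :: "(nat \<Rightarrow> nat) \<Rightarrow> nat set \<Rightarrow> point \<Rightarrow> point" where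
  "move t R x = (\<lambda>i. if i \<in> R then t (x i) else x i)"

text \<open>Coordinates are independent. In each one a value with \<open>m\<close> preimages under
  \<open>t\<close> is kept with weight \<open>1 - p\<close> and hit \<open>m\<close> times with
  weight \<open>p\<close>, so its density relative to the uniform one is
  \<open>1 + p * (m - 1)\<close>.\<close>

lemma move_density:
  assumes I: "finite I" and t: "finite B" "t ` B \<subseteq> B"
  shows "avg (PiE I (\<lambda>_. B)) (\<lambda>x. bexp p I (\<lambda>R. \<phi> (move t R x))) =
    avg (PiE I (\<lambda>_. B)) (\<lambda>x. \<phi> x * (\<Prod>i\<in>I. 1 + p * (real (card {v \<in> B. t v = x i}) - 1)))"
  using I
proof (induction I arbitrary: \<phi> rule: finite_induct)
  case empty
  then show ?case by (simp add: avg_def move_def)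
next
  case (insert i I)
  note hyps = insert.hyps
  let ?P = "PiE I (\<lambda>_. B)"
  define \<rho> where "\<rho> c = 1 + p * (real (card {v \<in> B. t v = c}) - 1)" for c
  define \<psi> where "\<psi> c = avg ?P (\<lambda>x. \<phi> (x(i := c)) * (\<Prod>j\<in>I. \<rho> (x j)))" for c
  have IH: "avg ?P (\<lambda>x. bexp p I (\<lambda>R. \<phi> ((move t R x)(i := c)))) = \<psi> c" for c
    using insert.IH[of "\<lambda>y. \<phi> (y(i := c))"] by (simp add: \<psi>_def \<rho>_def)
  have mv: "move t (insert i R) (x(i := b)) = (move t R x)(i := t b)"
    "R \<subseteq> I \<Longrightarrow> move t R (x(i := b)) = (move t R x)(i := b)" for R x b
    using hyps by (auto simp: move_def fun_eq_iff)
  have "avg (PiE (insert i I) (\<lambda>_. B)) (\<lambda>x. bexp p (insert i I) (\<lambda>R. \<phi> (move t R x))) =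
      avg B (\<lambda>b. avg ?P (\<lambda>x. p * bexp p I (\<lambda>R. \<phi> ((move t R x)(i := t b))) +
        (1 - p) * bexp p I (\<lambda>R. \<phi> ((move t R x)(i := b)))))"
    unfolding avg_PiE_insert[OF hyps] bexp_insert[OF hyps] mv(1)
    by (intro avg_cong arg_cong2[where f = "(+)"] arg_cong2[where f = "(*)"] refl bexp_cong)
      (simp add: mv(2))
  also have "\<dots> = p * avg B (\<lambda>b. \<psi> (t b)) + (1 - p) * avg B \<psi>"
    unfolding avg_add avg_cmult IH ..
  also have "avg B (\<lambda>b. \<psi> (t b)) = avg B (\<lambda>c. real (card {v \<in> B. t v = c}) * \<psi> c)"
    unfolding avg_def using sum_fun_comp[of B B t \<psi>] t by simp
  also have "p * \<dots> + (1 - p) * avg B \<psi> = avg B (\<lambda>c. p * (real (card {v \<in> B. t v = c}) * \<psi> c) + (1 - p) * \<psi> c)"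
    unfolding avg_add avg_cmult ..
  also have "\<dots> = avg B (\<lambda>c. \<rho> c * \<psi> c)"
    by (intro avg_cong) (simp add: \<rho>_def algebra_simps)
  also have "\<dots> = avg B (\<lambda>c. avg ?P (\<lambda>x. \<phi> (x(i := c)) * (\<Prod>j\<in>insert i I. \<rho> ((x(i := c)) j))))"
  proof (intro avg_cong)
    fix c
    have "(\<Prod>j\<in>I. \<rho> ((x(i := c)) j)) = (\<Prod>j\<in>I. \<rho> (x j))" for x
      using hyps by (intro prod.cong) auto
    then have "(\<lambda>x. \<phi> (x(i := c)) * (\<Prod>j\<in>insert i I. \<rho> ((x(i := c)) j))) =
        (\<lambda>x. \<rho> c * (\<phi> (x(i := c)) * (\<Prod>j\<in>I. \<rho> (x j))))"
      using hyps by (simp add: fun_eq_iff mult_ac)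
    then show "\<rho> c * \<psi> c = avg ?P (\<lambda>x. \<phi> (x(i := c)) * (\<Prod>j\<in>insert i I. \<rho> ((x(i := c)) j)))"
      by (simp only: \<psi>_def avg_cmult)
  qed
  finally show ?case unfolding avg_PiE_insert[OF hyps] by (simp only: \<rho>_def)
qed

text \<open>The second moment of the density of \<^term>\<open>move t R x\<close> is at most \<open>(1 + p\<^sup>2) ^ card I\<close>.\<close>

lemma move_total_variation:
  assumes I: "finite I" and B: "finite B" "B \<noteq> {}" "t ` B \<subseteq> B"
    and two: "\<And>c. c \<in> B \<Longrightarrow> card {v \<in> B. t v = c} \<le> 2"
    and p: "0 \<le> p" "p\<^sup>2 * real (card I) \<le> 1" and f: "\<And>x. \<bar>f x\<bar> \<le> 1"
  shows "\<bar>avg (PiE I (\<lambda>_. B)) f - avg (PiE I (\<lambda>_. B)) (\<lambda>x. bexp p I (\<lambda>R. f (move t R x)))\<bar>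
    \<le> sqrt 2 * p * sqrt (real (card I))"
proof -
  let ?P = "PiE I (\<lambda>_. B)"
  define m where "m c = real (card {v \<in> B. t v = c})" for c
  define \<rho> where "\<rho> c = 1 + p * (m c - 1)" for c
  define D where "D x = (\<Prod>i\<in>I. \<rho> (x i))" for x :: point
  have P: "finite ?P" "?P \<noteq> {}" using I B by (auto intro!: finite_PiE simp: PiE_eq_empty_iff)
  have "sum m B = real (card B)"
    using sum_fun_comp[of B B t "\<lambda>_. 1 :: real"] B by (simp add: m_def)
  then have m_avg: "avg B m = 1" using B by (simp add: avg_def)
  have \<rho>1: "avg B \<rho> = 1"
    unfolding \<rho>_def avg_add avg_cmult avg_diff m_avg using B by (simp add: avg_const)
  \<comment> \<open>\<open>\<rho>\<close> has mean 1, and its variance is at most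
    \<open>p\<^sup>2\<close> because \<open>m c\<close> is 0, 1 or 2.\<close>
  have "avg B (\<lambda>c. (\<rho> c)\<^sup>2) \<le> avg B (\<lambda>c. 2 * \<rho> c + (p\<^sup>2 - 1))"
  proof (intro avg_mono)
    fix c assume "c \<in> B"
    then have "\<bar>m c - 1\<bar> \<le> 1" using two[of c] by (auto simp: m_def)
    then have "(m c - 1)\<^sup>2 \<le> 1" by (simp add: abs_square_le_1)
    then have "p\<^sup>2 * (m c - 1)\<^sup>2 \<le> p\<^sup>2 * 1" by (intro mult_left_mono) auto
    then show "(\<rho> c)\<^sup>2 \<le> 2 * \<rho> c + (p\<^sup>2 - 1)"
      by (simp add: \<rho>_def power2_eq_square algebra_simps)
  qed
  also have "\<dots> = 1 + p\<^sup>2" unfolding avg_add avg_cmult \<rho>1 using B by (simp add: avg_const)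
  finally have \<rho>2: "avg B (\<lambda>c. (\<rho> c)\<^sup>2) \<le> 1 + p\<^sup>2" .
  have D1: "avg ?P D = 1" unfolding D_def avg_prod[OF I] \<rho>1 by simp
  \<comment> \<open>The second moment is a product over the coordinates;
    \<open>p\<^sup>2 * card I \<le> 1\<close> makes the exponential bound on it linear.\<close>
  have "avg ?P (\<lambda>x. (D x)\<^sup>2) = avg B (\<lambda>c. (\<rho> c)\<^sup>2) ^ card I"
    unfolding D_def prod_power_distrib using avg_prod[OF I, of B "\<lambda>c. (\<rho> c)\<^sup>2"] by simp
  also have "\<dots> \<le> (1 + p\<^sup>2) ^ card I" using \<rho>2 by (intro power_mono avg_nonneg) auto
  also have "\<dots> \<le> exp (p\<^sup>2) ^ card I" by (intro power_mono) (auto simp: exp_ge_add_one_self)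
  also have "\<dots> = exp (p\<^sup>2 * real (card I))" by (simp add: exp_of_nat_mult[symmetric] mult.commute)
  also have "\<dots> \<le> 1 + p\<^sup>2 * real (card I) + (p\<^sup>2 * real (card I))\<^sup>2"
    using p by (intro exp_bound) auto
  also have "(p\<^sup>2 * real (card I))\<^sup>2 \<le> p\<^sup>2 * real (card I)"
    using p mult_left_mono[OF p(2), of "p\<^sup>2 * real (card I)"] by (simp add: power2_eq_square)
  finally have D2: "avg ?P (\<lambda>x. (D x)\<^sup>2) \<le> 1 + 2 * (p\<^sup>2 * real (card I))" by (simp add: algebra_simps)
  have "avg ?P (\<lambda>x. (1 - D x)\<^sup>2) = avg ?P (\<lambda>x. 1 + ((-2) * D x + (D x)\<^sup>2))"
    by (intro avg_cong) (simp add: power2_diff algebra_simps)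
  also have "\<dots> \<le> 2 * (p\<^sup>2 * real (card I))"
    unfolding avg_add avg_cmult D1 using P D2 by (simp add: avg_const)
  finally have var: "avg ?P (\<lambda>x. (1 - D x)\<^sup>2) \<le> 2 * (p\<^sup>2 * real (card I))" .
  have "avg ?P f - avg ?P (\<lambda>x. bexp p I (\<lambda>R. f (move t R x))) = avg ?P (\<lambda>x. f x * (1 - D x))"
    unfolding move_density[OF I B(1,3)] avg_diff[symmetric] D_def \<rho>_def m_def
    by (intro avg_cong) (simp add: algebra_simps)
  also have "\<bar>\<dots>\<bar> \<le> avg ?P (\<lambda>x. \<bar>1 - D x\<bar>)"
  proof -
    have fx: "\<bar>f x * (1 - D x)\<bar> \<le> \<bar>1 - D x\<bar>" for x
      using mult_right_mono[OF f[of x], of "\<bar>1 - D x\<bar>"] by (simp add: abs_mult)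
    then have "f x * (1 - D x) \<le> \<bar>1 - D x\<bar>" "-1 * (f x * (1 - D x)) \<le> \<bar>1 - D x\<bar>" for x
      by (meson abs_ge_self order_trans) (metis abs_ge_minus_self fx order_trans mult_minus1)
    then have "avg ?P (\<lambda>x. f x * (1 - D x)) \<le> avg ?P (\<lambda>x. \<bar>1 - D x\<bar>)"
      "avg ?P (\<lambda>x. -1 * (f x * (1 - D x))) \<le> avg ?P (\<lambda>x. \<bar>1 - D x\<bar>)"
      by (intro avg_mono; blast)+
    then show ?thesis unfolding avg_cmult by linarith
  qed
  also have "\<dots> \<le> sqrt (2 * (p\<^sup>2 * real (card I)))"
    using avg_jensen_abs[OF P, of "\<lambda>x. 1 - D x"] var by (meson order_trans real_sqrt_le_mono)
  also have "\<dots> = sqrt 2 * p * sqrt (real (card I))"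
    using p by (simp add: real_sqrt_mult)
  finally show ?thesis .
qed

section \<open>Pairs of values at distance \<open>h\<close> and the walks down and up\<close>

context hypergrid
begin

text \<open>At scale \<open>h\<close> and parity \<open>b\<close> the values \<open>v\<close> and \<open>v + h\<close> are paired iff \<open>is_low h b v\<close>.\<close>

definition is_low :: "nat \<Rightarrow> nat \<Rightarrow> nat \<Rightarrow> bool" where
  "is_low h b v \<longleftrightarrow> even (v div h + b) \<and> v + h \<le> n"

definition up :: "nat \<Rightarrow> nat \<Rightarrow> nat \<Rightarrow> nat" where
  "up h b v = (if is_low h b v then v + h else v)"

text \<open>For \<open>h > 0\<close> and \<open>v \<le> n\<close> the condition says that
  \<open>v - h\<close> is positive and the low value of a pair, so \<open>dn\<close> takes the upper
  value of a pair to the lower one.\<close>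

definition dn :: "nat \<Rightarrow> nat \<Rightarrow> nat \<Rightarrow> nat" where
  "dn h b v = (if odd (v div h + b) \<and> h < v then v - h else v)"

lemma up_range: "up h b ` {1..n} \<subseteq> {1..n}" and dn_range: "dn h b ` {1..n} \<subseteq> {1..n}"
  by (auto simp: up_def dn_def is_low_def)

lemma up_ge: "v \<le> up h b v" and dn_le: "dn h b v \<le> v"
  by (auto simp: up_def dn_def)

lemma up_preimage: "card {v \<in> {1..n}. up h b v = c} \<le> 2"
proof -
  have "card {v \<in> {1..n}. up h b v = c} \<le> card {c, c - h}"
    by (intro card_mono) (auto simp: up_def split: if_splits)
  also have "\<dots> \<le> 2" by (simp add: card_insert_if)
  finally show ?thesis .
qed

lemma dn_preimage: "card {v \<in> {1..n}. dn h b v = c} \<le> 2"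
proof -
  have "card {v \<in> {1..n}. dn h b v = c} \<le> card {c, c + h}"
    by (intro card_mono) (auto simp: dn_def split: if_splits)
  also have "\<dots> \<le> 2" by (simp add: card_insert_if)
  finally show ?thesis .
qed

lemma low_pair:
  assumes "is_low h b v" "h > 0" "v \<ge> 1"
  shows "dn h b v = v" "up h b v = v + h" "dn h b (v + h) = v" "up h b (v + h) = v + h"
  using assms by (auto simp: is_low_def dn_def up_def)

lemma move_grid:
  assumes "x \<in> grid n d" "R \<subseteq> {1..d}" "t ` {1..n} \<subseteq> {1..n}"
  shows "move t R x \<in> grid n d"
  unfolding grid_def
proof (rule PiE_I)
  fix i assume "i \<in> {1..d}"
  then have "x i \<in> {1..n}" using assms(1) unfolding grid_def by (rule PiE_mem[rotated])
  moreover from this have "t (x i) \<in> {1..n}" using assms(3) by blast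
  ultimately show "move t R x i \<in> {1..n}" by (simp add: move_def)
next
  fix i assume "i \<notin> {1..d}"
  then have "i \<notin> R" "x i = undefined" using assms(1,2) by (auto simp: grid_def PiE_iff extensional_def)
  then show "move t R x i = undefined" by (simp add: move_def)
qed

text \<open>\<open>up\<close> and \<open>dn\<close> each identify the two values of a pair, while
  \<open>dn\<close> fixes the lower value and \<open>up\<close> the upper one. The last two
  equations make the event studied in \<open>matching_pass\<close> independent of whether
  \<open>i\<close> is moved.\<close>

lemma move_pair:
  assumes u: "is_low h b (u i)" "h > 0" "u i \<ge> 1"
  shows "i \<in> R \<Longrightarrow> move (up h b) R u = move (up h b) R (shift i h u)"
    and "i \<in> R \<Longrightarrow> move (dn h b) R (shift i h u) = move (dn h b) R u"
    and "move (dn h b) R u = move (dn h b) (R - {i}) u"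
    and "move (up h b) R (shift i h u) = move (up h b) (R - {i}) (shift i h u)"
  using low_pair[OF u] by (auto simp: move_def shift_def fun_eq_iff)

context
  fixes A :: "point set" and M :: "(point \<times> nat) set" and h b :: nat and p :: real
  assumes A: "A \<subseteq> grid n d" and M: "matching h A M" and h: "h > 0"
    and p: "0 \<le> p" "p \<le> 1" and n: "n \<ge> 1"
begin

abbreviation "down R x \<equiv> move (dn h b) R x"
abbreviation "upw R x \<equiv> move (up h b) R x"
abbreviation "Mb \<equiv> {(x, i) \<in> M. is_low h b (x i)}"
abbreviation "wsum g \<equiv> (\<Sum>x\<in>grid n d. bexp p {1..d} (\<lambda>R. of_bool (g x R)))"

text \<open>For an edge of \<open>Mb\<close>, suppose that the walk down from its lower end stays in
  \<open>A\<close> and the walk up from its upper end stays outside. This event does not depend on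
  whether the direction of the edge is in \<open>R\<close>, so demanding that too costs a factor
  \<open>p\<close>; the walks started at either end then exhibit a violation. Both ends count and
  all ends are distinct, hence the factor 2.\<close>

lemma matching_pass:
  "2 * p * (real (card Mb) - wsum (\<lambda>x R. x \<in> A \<and> down R x \<notin> A) - wsum (\<lambda>x R. x \<notin> A \<and> upw R x \<in> A))
    \<le> wsum (\<lambda>x R. down R x \<in> A \<and> upw R x \<notin> A)"
proof -
  let ?E = "bexp p {1..d}"
  let ?s = "\<lambda>(x, i). shift i h x"
  let ?g = "\<lambda>x. ?E (\<lambda>R. of_bool (down R x \<in> A \<and> upw R x \<notin> A)) :: real"
  have finM: "finite Mb" using finite_matching[OF A M] by (rule rev_finite_subset) auto
  have Mf: "inj_on fst Mb" "inj_on ?s Mb"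
    using M by (auto simp: matching_def intro: inj_on_subset)
  have Me: "i \<in> {1..d}" "u \<in> A" "u \<in> grid n d" "shift i h u \<in> grid n d" "shift i h u \<notin> A"
    "is_low h b (u i)" "u i \<ge> 1" if "(u, i) \<in> Mb" for u i
  proof -
    show "i \<in> {1..d}" "u \<in> A" "shift i h u \<in> grid n d" "shift i h u \<notin> A" "is_low h b (u i)"
      using that M by (auto simp: matching_def viol_edges_def)
    then show "u \<in> grid n d" "u i \<ge> 1" using A by (auto simp: grid_def PiE_iff)
  qed
  have sum_fst: "(\<Sum>(u, i)\<in>Mb. G u) = (\<Sum>x\<in>fst ` Mb. G x)" for G :: "point \<Rightarrow> real"
    using sum.reindex[OF Mf(1), of G] by (simp add: case_prod_unfold)
  have sum_snd: "(\<Sum>(u, i)\<in>Mb. G (shift i h u)) = (\<Sum>x\<in>?s ` Mb. G x)" for G :: "point \<Rightarrow> real"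
    using sum.reindex[OF Mf(2), of G] by (simp add: case_prod_unfold)
  have "fst e \<in> A \<and> ?s e \<in> grid n d - A" if e: "e \<in> Mb" for e
  proof -
    obtain u i where ui: "e = (u, i)" by (cases e)
    note Me' = Me[OF e[unfolded ui]]
    show ?thesis using Me'(2,4,5) by (simp add: ui)
  qed
  then have sub: "fst ` Mb \<subseteq> A" "?s ` Mb \<subseteq> grid n d - A"
    by (simp_all only: image_subset_iff) blast+
  have gnn: "0 \<le> bexp p {1..d} (\<lambda>R. of_bool (g R))" for g
    using p by (intro bexp_nonneg) auto
  have edge: "p * (1 - ?E (\<lambda>R. of_bool (down R u \<notin> A)) - ?E (\<lambda>R. of_bool (upw R (shift i h u) \<in> A)))
      \<le> ?g u \<and>
    p * (1 - ?E (\<lambda>R. of_bool (down R u \<notin> A)) - ?E (\<lambda>R. of_bool (upw R (shift i h u) \<in> A)))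
      \<le> ?g (shift i h u)" if ui: "(u, i) \<in> Mb" for u i
  proof -
    let ?v = "shift i h u"
    note mp = move_pair[where u = u and i = i, OF Me(6)[OF ui] h Me(7)[OF ui]]
    let ?\<phi> = "\<lambda>R. of_bool (down R u \<in> A \<and> upw R ?v \<notin> A) :: real"
    have "1 - ?E (\<lambda>R. of_bool (down R u \<notin> A)) - ?E (\<lambda>R. of_bool (upw R ?v \<in> A)) =
        ?E (\<lambda>R. 1 + ((-1) * of_bool (down R u \<notin> A) + (-1) * of_bool (upw R ?v \<in> A)))"
      unfolding bexp_add bexp_cmult by (simp add: bexp_const)
    also have "\<dots> \<le> ?E ?\<phi>" using p by (intro bexp_mono) auto
    also have "?E ?\<phi> = ?E (\<lambda>R. ?\<phi> (R - {i}))"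
      using mp(3,4) by (intro bexp_cong) auto
    finally have "p * (1 - ?E (\<lambda>R. of_bool (down R u \<notin> A)) - ?E (\<lambda>R. of_bool (upw R ?v \<in> A)))
        \<le> p * ?E (\<lambda>R. ?\<phi> (R - {i}))" using p by (intro mult_left_mono)
    also have "\<dots> = ?E (\<lambda>R. of_bool (i \<in> R) * ?\<phi> (R - {i}))"
      by (rule bexp_member[symmetric]) (use Me(1)[OF ui] in auto)
    finally have *: "p * (1 - ?E (\<lambda>R. of_bool (down R u \<notin> A)) - ?E (\<lambda>R. of_bool (upw R ?v \<in> A)))
        \<le> ?E (\<lambda>R. of_bool (i \<in> R) * ?\<phi> (R - {i}))" .
    have "?E (\<lambda>R. of_bool (i \<in> R) * ?\<phi> (R - {i})) \<le> ?g u"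
      using p mp by (intro bexp_mono) auto
    moreover have "?E (\<lambda>R. of_bool (i \<in> R) * ?\<phi> (R - {i})) \<le> ?g ?v"
      using p mp by (intro bexp_mono) auto
    ultimately show ?thesis using * by linarith
  qed
  have "2 * p * (real (card Mb) - wsum (\<lambda>x R. x \<in> A \<and> down R x \<notin> A) - wsum (\<lambda>x R. x \<notin> A \<and> upw R x \<in> A))
      \<le> 2 * p * (real (card Mb) - (\<Sum>x\<in>fst ` Mb. ?E (\<lambda>R. of_bool (down R x \<notin> A)))
        - (\<Sum>x\<in>?s ` Mb. ?E (\<lambda>R. of_bool (upw R x \<in> A))))"
  proof -
    have "(\<Sum>x\<in>fst ` Mb. ?E (\<lambda>R. of_bool (down R x \<notin> A))) =
        (\<Sum>x\<in>fst ` Mb. ?E (\<lambda>R. of_bool (x \<in> A \<and> down R x \<notin> A)))"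
    proof (intro sum.cong refl)
      fix x assume "x \<in> fst ` Mb"
      then have "x \<in> A" using sub(1) by blast
      then show "?E (\<lambda>R. of_bool (down R x \<notin> A)) = ?E (\<lambda>R. of_bool (x \<in> A \<and> down R x \<notin> A))"
        by simp
    qed
    also have "\<dots> \<le> wsum (\<lambda>x R. x \<in> A \<and> down R x \<notin> A)"
      using order_trans[OF sub(1) A] by (intro sum_mono2 finite_grid gnn) blast+
    finally have 1: "(\<Sum>x\<in>fst ` Mb. ?E (\<lambda>R. of_bool (down R x \<notin> A))) \<le> wsum (\<lambda>x R. x \<in> A \<and> down R x \<notin> A)" .
    have "(\<Sum>x\<in>?s ` Mb. ?E (\<lambda>R. of_bool (upw R x \<in> A))) =
        (\<Sum>x\<in>?s ` Mb. ?E (\<lambda>R. of_bool (x \<notin> A \<and> upw R x \<in> A)))"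
    proof (intro sum.cong refl)
      fix x assume "x \<in> ?s ` Mb"
      then have "x \<notin> A" using sub(2) by blast
      then show "?E (\<lambda>R. of_bool (upw R x \<in> A)) = ?E (\<lambda>R. of_bool (x \<notin> A \<and> upw R x \<in> A))"
        by simp
    qed
    also have "\<dots> \<le> wsum (\<lambda>x R. x \<notin> A \<and> upw R x \<in> A)"
      using sub(2) by (intro sum_mono2 finite_grid gnn) blast+
    finally have 2: "(\<Sum>x\<in>?s ` Mb. ?E (\<lambda>R. of_bool (upw R x \<in> A))) \<le> wsum (\<lambda>x R. x \<notin> A \<and> upw R x \<in> A)" .
    show ?thesis using 1 2 p by (intro mult_left_mono) auto
  qed
  also have "\<dots> = (\<Sum>(u, i)\<in>Mb. 2 * (p * (1 - ?E (\<lambda>R. of_bool (down R u \<notin> A)) - ?E (\<lambda>R. of_bool (upw R (shift i h u) \<in> A)))))"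
    unfolding sum_fst[symmetric] sum_snd[symmetric]
    by (simp add: case_prod_unfold sum_subtractf sum.distrib sum_distrib_left[symmetric] algebra_simps)
  also have "\<dots> \<le> (\<Sum>(u, i)\<in>Mb. ?g u + ?g (shift i h u))"
    using edge by (intro sum_mono) force
  also have "\<dots> = (\<Sum>x\<in>fst ` Mb. ?g x) + (\<Sum>x\<in>?s ` Mb. ?g x)"
    unfolding sum_fst[symmetric] sum_snd[symmetric] by (simp add: case_prod_unfold sum.distrib)
  also have "\<dots> = (\<Sum>x\<in>fst ` Mb \<union> ?s ` Mb. ?g x)"
    using sub by (intro sum.union_disjoint[symmetric] finite_imageI finM) blast
  also have "\<dots> \<le> wsum (\<lambda>x R. down R x \<in> A \<and> upw R x \<notin> A)"
    using sub A by (intro sum_mono2 finite_grid gnn) blast+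
  finally show ?thesis .
qed

text \<open>Moves that do not change membership in \<open>A\<close> cancel, so the difference
  compares the measure of \<open>A\<close> under the uniform and the moved distribution;
  \<open>move_total_variation\<close> bounds it.\<close>

lemma persistence:
  assumes t: "t ` {1..n} \<subseteq> {1..n}" "\<And>c. card {v \<in> {1..n}. t v = c} \<le> 2"
    and pd: "p\<^sup>2 * real d \<le> 1"
  shows "\<bar>wsum (\<lambda>x R. x \<in> A \<and> move t R x \<notin> A) - wsum (\<lambda>x R. x \<notin> A \<and> move t R x \<in> A)\<bar>
    \<le> real (card (grid n d)) * (sqrt 2 * p * sqrt (real d))"
proof -
  let ?N = "real (card (grid n d))"
  let ?E = "bexp p {1..d}"
  have N: "?N > 0" using n finite_grid by (auto simp: card_gt_0_iff grid_def PiE_eq_empty_iff)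
  have "wsum (\<lambda>x R. x \<in> A \<and> move t R x \<notin> A) - wsum (\<lambda>x R. x \<notin> A \<and> move t R x \<in> A) =
      (\<Sum>x\<in>grid n d. ?E (\<lambda>R. of_bool (x \<in> A \<and> move t R x \<notin> A) + (-1) * of_bool (x \<notin> A \<and> move t R x \<in> A)))"
    unfolding bexp_add bexp_cmult by (simp add: sum_subtractf)
  also have "\<dots> = (\<Sum>x\<in>grid n d. ?E (\<lambda>R. of_bool (x \<in> A) + (-1) * of_bool (move t R x \<in> A)))"
    by (intro sum.cong bexp_cong) auto
  also have "\<dots> = (\<Sum>x\<in>grid n d. of_bool (x \<in> A)) - (\<Sum>x\<in>grid n d. ?E (\<lambda>R. of_bool (move t R x \<in> A)))"
    unfolding bexp_add bexp_cmult by (simp add: bexp_const sum_subtractf)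
  also have "\<dots> = ?N * (avg (grid n d) (\<lambda>x. of_bool (x \<in> A)) -
      avg (grid n d) (\<lambda>x. ?E (\<lambda>R. of_bool (move t R x \<in> A))))"
    using N by (simp add: avg_def field_simps)
  also have "\<bar>\<dots>\<bar> \<le> ?N * (sqrt 2 * p * sqrt (real d))"
    using move_total_variation[of "{1..d}" "{1..n}" t p "\<lambda>x. of_bool (x \<in> A)"] t n p pd
    unfolding abs_mult grid_def[symmetric] by (intro mult_mono) auto
  finally show ?thesis .
qed

text \<open>Either \<open>?S\<close> exceeds \<open>card Mb / 8\<close>, or violating moves are
  rare. In the second case \<open>persistence\<close> makes the opposite changes of value rare as
  well, so at least half of \<open>Mb\<close> remains in \<open>matching_pass\<close>.\<close>

lemma walk_detects:
  assumes pd: "sqrt 2 * p * sqrt (real d) * real (card (grid n d)) \<le> real (card Mb) / 8"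
    and pd': "p\<^sup>2 * real d \<le> 1"
  shows "p * real (card Mb) / 8 \<le>
    wsum (\<lambda>x R. (down R x \<in> A \<and> upw R x \<notin> A) \<or> (down R x \<in> A \<and> x \<notin> A) \<or> (x \<in> A \<and> upw R x \<notin> A))"
    (is "_ \<le> ?S")
proof -
  let ?s = "real (card Mb)"
  have mono: "wsum g \<le> wsum g'" if "\<And>x R. g x R \<Longrightarrow> g' x R" for g g'
    using that p by (intro sum_mono bexp_mono) auto
  have S: "wsum (\<lambda>x R. down R x \<in> A \<and> upw R x \<notin> A) \<le> ?S" "wsum (\<lambda>x R. x \<notin> A \<and> down R x \<in> A) \<le> ?S"
    "wsum (\<lambda>x R. x \<in> A \<and> upw R x \<notin> A) \<le> ?S"
    by (intro mono; blast)+
  have P: "wsum (\<lambda>x R. x \<in> A \<and> down R x \<notin> A) \<le> wsum (\<lambda>x R. x \<notin> A \<and> down R x \<in> A) + ?s / 8"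
    "wsum (\<lambda>x R. x \<notin> A \<and> upw R x \<in> A) \<le> wsum (\<lambda>x R. x \<in> A \<and> upw R x \<notin> A) + ?s / 8"
    using persistence[OF dn_range dn_preimage pd', of h b] persistence[OF up_range up_preimage pd', of h b] pd
    by (auto simp: mult.commute)
  show ?thesis
  proof (cases "?S \<le> ?s / 8")
    case True
    have "p * ?s / 8 \<le> 2 * p * (?s / 2)" using p by simp
    also have "\<dots> \<le> 2 * p * (?s - wsum (\<lambda>x R. x \<in> A \<and> down R x \<notin> A) - wsum (\<lambda>x R. x \<notin> A \<and> upw R x \<in> A))"
    proof (intro mult_left_mono)
      show "?s / 2 \<le> ?s - wsum (\<lambda>x R. x \<in> A \<and> down R x \<notin> A) - wsum (\<lambda>x R. x \<notin> A \<and> upw R x \<in> A)"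
        using order_trans[OF S(2) True] order_trans[OF S(3) True] P by linarith
    qed (use p in simp)
    also have "\<dots> \<le> ?S" using matching_pass S(1) by linarith
    finally show ?thesis .
  next
    case False
    have "p * ?s \<le> 1 * ?s" using p by (intro mult_right_mono) auto
    then show ?thesis using False by simp
  qed
qed

end

text \<open>Every edge is a pair for one of the two parities, so one parity keeps half of the
  matching.\<close>

lemma card_matching_parity:
  assumes "A \<subseteq> grid n d" "matching h A M" "h > 0"
  shows "\<exists>b<2. real (card M) / 2 \<le> real (card {(x, i) \<in> M. is_low h b (x i)})"
proof -
  let ?M = "\<lambda>b. {(x, i) \<in> M. is_low h b (x i)}"
  have fin: "finite M" by (rule finite_matching[OF assms(1,2)])
  have "M \<subseteq> ?M 0 \<union> ?M 1"
  proof
    fix e assume e: "e \<in> M"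
    obtain x i where xi: "e = (x, i)" by (cases e)
    have "i \<in> {1..d}" "x \<in> grid n d" "shift i h x \<in> grid n d"
      using e assms(1,2) by (auto simp: xi matching_def viol_edges_def)
    then have "x i + h \<le> n" using shift_in_grid by auto
    then show "e \<in> ?M 0 \<union> ?M 1" using e by (auto simp: xi is_low_def)
  qed
  then have "card M \<le> card (?M 0 \<union> ?M 1)"
    using fin by (intro card_mono) (auto intro: rev_finite_subset)
  also have "\<dots> \<le> card (?M 0) + card (?M 1)" by (rule card_Un_le)
  finally have "real (card M) / 2 \<le> real (card (?M 0)) \<or> real (card M) / 2 \<le> real (card (?M 1))" by linarith
  then show ?thesis
  proof
    assume "real (card M) / 2 \<le> real (card (?M 0))"
    then show ?thesis by (intro exI[of _ 0] conjI) simp_all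
  next
    assume "real (card M) / 2 \<le> real (card (?M 1))"
    then show ?thesis by (intro exI[of _ 1] conjI) simp_all
  qed
qed

section \<open>The tester\<close>

text \<open>The components are scale, parity, rate exponent, start, direction and a colouring.
  Colours below \<open>2 ^ J\<close> realise all rates \<open>2 ^ - j\<close> with
  \<open>j \<le> J\<close> in one finite uniform space.\<close>

definition trials :: "nat \<Rightarrow> nat \<Rightarrow> (nat \<times> nat \<times> nat \<times> point \<times> nat \<times> (nat \<Rightarrow> nat)) set" where
  "trials l J = {..<l} \<times> {..<2} \<times> {..J} \<times> grid n d \<times> {1..d} \<times> PiE {1..d} (\<lambda>_. {..<2 ^ J})"

text \<open>The directions moved by the walk; each is chosen with probability \<open>2 ^ - j\<close>.\<close>

definition walk_dirs :: "nat \<Rightarrow> nat \<Rightarrow> (nat \<Rightarrow> nat) \<Rightarrow> nat set" where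
  "walk_dirs J j c = {i \<in> {1..d}. c i \<in> {..<2 ^ (J - j)}}"

text \<open>An upper end outside the grid is replaced by \<open>x\<close>, which keeps four queries
  per trial and cannot lead to rejection.\<close>

fun trial_queries :: "nat \<Rightarrow> nat \<times> nat \<times> nat \<times> point \<times> nat \<times> (nat \<Rightarrow> nat) \<Rightarrow> point list" where
  "trial_queries J (k, b, j, x, i, c) =
     [move (dn (2 ^ k) b) (walk_dirs J j c) x, x, move (up (2 ^ k) b) (walk_dirs J j c) x,
      if shift i (2 ^ k) x \<in> grid n d then shift i (2 ^ k) x else x]"

fun rejects :: "bool list \<Rightarrow> bool" where
  "rejects (z # x # w # y # vs) \<longleftrightarrow> z \<and> \<not> x \<or> x \<and> \<not> w \<or> z \<and> \<not> w \<or> x \<and> \<not> y \<or> rejects vs"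
| "rejects _ \<longleftrightarrow> False"

lemma rejects_append:
  "length us = 4 \<Longrightarrow> rejects (us @ vs) \<longleftrightarrow> rejects us \<or> rejects vs"
  by (auto simp: length_Suc_conv eval_nat_numeral)

lemma length_trial_queries: "length (trial_queries J t) = 4"
  by (cases t) simp

definition detects :: "(point \<Rightarrow> bool) \<Rightarrow> nat \<Rightarrow> nat \<times> nat \<times> nat \<times> point \<times> nat \<times> (nat \<Rightarrow> nat) \<Rightarrow> bool" where
  "detects f J t = rejects (map f (trial_queries J t))"

lemma rejects_trials:
  "rejects (map f (concat (map (trial_queries J) ts))) \<longleftrightarrow> (\<exists>t\<in>set ts. detects f J t)"
  by (induction ts) (auto simp: rejects_append length_trial_queries detects_def)

text \<open>A uniform list of length \<open>K\<close> amounts to \<open>K\<close> independent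
  uniform trials.\<close>

definition tester :: "nat \<Rightarrow> nat \<Rightarrow> nat \<Rightarrow> randomized_nonadaptive" where
  "tester l J K = map_pmf
     (\<lambda>ts. Nonadaptive (concat (map (trial_queries J) ts)) (\<lambda>vs. if rejects vs then NO else YES))
     (pmf_of_set {ts. set ts \<subseteq> trials l J \<and> length ts = K})"

lemma trial_queries_grid:
  assumes "t \<in> trials l J"
  shows "set (trial_queries J t) \<subseteq> grid n d"
proof -
  obtain k b j x i c where t: "t = (k, b, j, x, i, c)" by (cases t)
  then have x: "x \<in> grid n d" using assms by (auto simp: trials_def)
  have "walk_dirs J j c \<subseteq> {1..d}" by (auto simp: walk_dirs_def)
  then show ?thesis using x move_grid[OF x _ dn_range] move_grid[OF x _ up_range] by (auto simp: t)
qed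

lemma detects_imp_not_mono:
  assumes t: "t \<in> trials l J" and f: "grid_mono n d f"
  shows "\<not> detects f J t"
proof -
  obtain k b j x i c where t_eq: "t = (k, b, j, x, i, c)" by (cases t)
  define z where "z = move (dn (2 ^ k) b) (walk_dirs J j c) x"
  define w where "w = move (up (2 ^ k) b) (walk_dirs J j c) x"
  define y where "y = (if shift i (2 ^ k) x \<in> grid n d then shift i (2 ^ k) x else x)"
  have grid: "z \<in> grid n d" "x \<in> grid n d" "w \<in> grid n d" "y \<in> grid n d"
    using trial_queries_grid[OF t] by (auto simp: t_eq z_def w_def y_def)
  have "coord_le d z x" "coord_le d x w" "coord_le d z w" "coord_le d x y"
    using dn_le up_ge order_trans[OF dn_le up_ge]
    by (auto simp: coord_le_def z_def w_def y_def move_def shift_def)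
  then have "f z \<le> f x" "f x \<le> f w" "f z \<le> f w" "f x \<le> f y"
    using f grid unfolding grid_mono_def by (auto dest: monotone_onD)
  then show ?thesis by (auto simp: detects_def t_eq z_def w_def y_def)
qed

lemma finite_trials: "finite (trials l J)"
  unfolding trials_def by (intro finite_cartesian_product finite_grid finite_PiE) auto

lemma trials_nonempty: "n \<ge> 1 \<Longrightarrow> d \<ge> 1 \<Longrightarrow> l \<ge> 1 \<Longrightarrow> trials l J \<noteq> {}"
  by (auto simp: trials_def grid_def PiE_eq_empty_iff lessThan_empty_iff)

lemma
  assumes "n \<ge> 1" "d \<ge> 1" "l \<ge> 1"
  shows set_pmf_tester: "A \<in> set_pmf (tester l J K) \<longleftrightarrow>
      (\<exists>ts. set ts \<subseteq> trials l J \<and> length ts = K \<and>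
        A = Nonadaptive (concat (map (trial_queries J) ts)) (\<lambda>vs. if rejects vs then NO else YES))"
    and prob_tester: "prob_returns (tester l J K) f YES =
      (1 - avg (trials l J) (\<lambda>t. of_bool (detects f J t))) ^ K"
    and prob_tester_NO: "prob_returns (tester l J K) f NO = 1 - prob_returns (tester l J K) f YES"
proof -
  let ?T = "trials l J"
  let ?L = "{ts. set ts \<subseteq> ?T \<and> length ts = K}"
  let ?alg = "\<lambda>ts. Nonadaptive (concat (map (trial_queries J) ts)) (\<lambda>vs. if rejects vs then NO else YES)"
  have T: "finite ?T" "?T \<noteq> {}" using finite_trials trials_nonempty[OF assms] by auto
  then obtain t where "t \<in> ?T" by auto
  then have L: "finite ?L" "?L \<noteq> {}"
    using finite_lists_length_eq[OF T(1)] by (auto intro!: exI[of _ "replicate K t"])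
  show "A \<in> set_pmf (tester l J K) \<longleftrightarrow> (\<exists>ts. set ts \<subseteq> ?T \<and> length ts = K \<and> A = ?alg ts)"
    unfolding tester_def using L by auto
  have run: "run (?alg ts) f = YES \<longleftrightarrow> (\<forall>t\<in>set ts. \<not> detects f J t)" for ts
    using rejects_trials[of f J ts] by (simp add: run_def)
  have "prob_returns (tester l J K) f YES = measure_pmf.prob (pmf_of_set ?L) {ts. \<forall>t\<in>set ts. \<not> detects f J t}"
    unfolding prob_returns_def tester_def measure_map_pmf vimage_def mem_Collect_eq run ..
  also have "\<dots> = real (card (?L \<inter> {ts. \<forall>t\<in>set ts. \<not> detects f J t})) / real (card ?L)"
    using L by (subst measure_pmf_of_set) auto
  also have "?L \<inter> {ts. \<forall>t\<in>set ts. \<not> detects f J t} =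
      {ts. set ts \<subseteq> {t \<in> ?T. \<not> detects f J t} \<and> length ts = K}" by auto
  also have "real (card \<dots>) / real (card ?L) =
      (real (card {t \<in> ?T. \<not> detects f J t}) / real (card ?T)) ^ K"
    using T by (subst (1 2) card_lists_length_eq) (auto simp: power_divide)
  also have "real (card {t \<in> ?T. \<not> detects f J t}) / real (card ?T) =
      1 - avg ?T (\<lambda>t. of_bool (detects f J t))"
  proof -
    have "real (card {t \<in> ?T. \<not> detects f J t}) = (\<Sum>t\<in>?T. 1 - of_bool (detects f J t))"
    proof -
      have "(\<Sum>t\<in>?T. 1 - of_bool (detects f J t)) = (\<Sum>t\<in>?T. of_bool (\<not> detects f J t) :: real)"
        by (intro sum.cong) auto
      then show ?thesis using T(1) by (simp add: Int_def)
    qed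
    also have "\<dots> / real (card ?T) = avg ?T (\<lambda>t. 1 - of_bool (detects f J t))" by (simp add: avg_def)
    also have "\<dots> = 1 - avg ?T (\<lambda>t. of_bool (detects f J t))"
      using T by (simp add: avg_diff avg_const)
    finally show ?thesis .
  qed
  finally show "prob_returns (tester l J K) f YES = (1 - avg ?T (\<lambda>t. of_bool (detects f J t))) ^ K" .
  have "run A f = NO \<longleftrightarrow> run A f \<noteq> YES" for A by (cases "run A f") auto
  then have "{A. run A f = NO} = UNIV - {A. run A f = YES}" by blast
  then show "prob_returns (tester l J K) f NO = 1 - prob_returns (tester l J K) f YES"
    unfolding prob_returns_def using measure_pmf.prob_compl[of "{A. run A f = YES}" "tester l J K"] by simp
qed

section \<open>Success probability of one trial\<close>

definition scale_prob :: "(point \<Rightarrow> bool) \<Rightarrow> nat \<Rightarrow> nat \<Rightarrow> real" where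
  "scale_prob f J k = avg {..<2::nat} (\<lambda>b. avg {..J} (\<lambda>j. avg (grid n d) (\<lambda>x. avg {1..d} (\<lambda>i.
     avg (PiE {1..d} (\<lambda>_. {..<2 ^ J})) (\<lambda>c. of_bool (detects f J (k, b, j, x, i, c)))))))"

lemma avg_trials:
  "avg (trials l J) (\<lambda>t. of_bool (detects f J t)) = avg {..<l} (scale_prob f J)"
  unfolding trials_def scale_prob_def
  by (simp only: avg_times finite_cartesian_product finite_grid finite_PiE finite_lessThan
      finite_atMost finite_atLeastAtMost)

lemma scale_prob_nonneg: "0 \<le> scale_prob f J k"
  unfolding scale_prob_def by (intro avg_nonneg) auto

text \<open>The comparison of \<open>x\<close> with its shift rejects on every violated edge,
  whatever the parity, rate and colouring.\<close>

lemma scale_prob_edge: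
  assumes "n \<ge> 1" "d \<ge> 1"
  shows "vcount (2 ^ k) (ones f) / (real (card (grid n d)) * real d) \<le> scale_prob f J k"
proof -
  let ?c = "PiE {1..d} (\<lambda>_. {..<2 ^ J :: nat})"
  have fin: "finite ?c" "?c \<noteq> {}" "finite (grid n d)" "grid n d \<noteq> {}"
    using assms by (auto intro!: finite_PiE simp: finite_grid PiE_eq_empty_iff lessThan_empty_iff grid_def)
  have "vcount (2 ^ k) (ones f) = (\<Sum>x\<in>grid n d. \<Sum>i\<in>{1..d}. of_bool (x \<in> viol_edges i (2 ^ k) (ones f)))"
  proof -
    have "real (card (viol_edges i (2 ^ k) (ones f))) = (\<Sum>x\<in>grid n d. of_bool (x \<in> viol_edges i (2 ^ k) (ones f)))" for i
    proof -
      have "grid n d \<inter> {x. x \<in> viol_edges i (2 ^ k) (ones f)} = viol_edges i (2 ^ k) (ones f)"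
        by (auto simp: viol_edges_def ones_def)
      then show ?thesis using finite_grid by simp
    qed
    then show ?thesis unfolding vcount_on_def by (subst sum.swap) (simp only:)
  qed
  then have "vcount (2 ^ k) (ones f) / (real (card (grid n d)) * real d) =
      avg (grid n d) (\<lambda>x. avg {1..d} (\<lambda>i. of_bool (x \<in> viol_edges i (2 ^ k) (ones f))))"
    by (simp add: avg_def sum_divide_distrib[symmetric] mult.commute)
  also have "\<dots> = avg {..<2::nat} (\<lambda>b. avg {..J} (\<lambda>j. avg (grid n d) (\<lambda>x. avg {1..d} (\<lambda>i.
     avg ?c (\<lambda>c. of_bool (x \<in> viol_edges i (2 ^ k) (ones f)))))))"
    using fin by (simp add: avg_const lessThan_empty_iff)
  also have "\<dots> \<le> scale_prob f J k"
    unfolding scale_prob_def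
    by (intro avg_mono) (auto simp: viol_edges_def ones_def detects_def)
  finally show ?thesis .
qed

text \<open>Restricting to one parity and one rate costs the factor \<open>2 * (J + 1)\<close>; the
  average over colourings then becomes a random set of density \<open>p\<close> and
  \<open>walk_detects\<close> applies.\<close>

lemma scale_prob_walk:
  fixes k b :: nat
  assumes nd: "n \<ge> 1" "d \<ge> 1" and b: "b < 2" and j: "j \<le> J" and M: "matching (2 ^ k) (ones f) M"
  defines "p \<equiv> 1 / 2 ^ j" and "m \<equiv> real (card {(x, i) \<in> M. is_low (2 ^ k) b (x i)})"
  assumes p: "sqrt 2 * p * sqrt (real d) * real (card (grid n d)) \<le> m / 8" "p\<^sup>2 * real d \<le> 1"
  shows "p * m / 8 / real (card (grid n d)) / (2 * (real J + 1)) \<le> scale_prob f J k"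
proof -
  let ?c = "PiE {1..d} (\<lambda>_. {..<2 ^ J :: nat})"
  let ?A = "ones f"
  let ?z = "\<lambda>R x. move (dn (2 ^ k) b) R x" and ?w = "\<lambda>R x. move (up (2 ^ k) b) R x"
  let ?bad = "\<lambda>x R. (?z R x \<in> ?A \<and> ?w R x \<notin> ?A) \<or> (?z R x \<in> ?A \<and> x \<notin> ?A) \<or> (x \<in> ?A \<and> ?w R x \<notin> ?A)"
  have p01: "0 \<le> p" "p \<le> 1" by (auto simp: p_def)
  have frac: "real (card {..<2 ^ (J - j) :: nat}) / real (card {..<2 ^ J :: nat}) = p"
    using j by (simp add: p_def power_diff[where ?'a = real])
  have sub: "{..<2 ^ (J - j) :: nat} \<subseteq> {..<2 ^ J}" by (auto intro: less_le_trans power_increasing)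
  have cls: "avg ?c (\<lambda>c. of_bool (?bad x (walk_dirs J j c))) = bexp p {1..d} (\<lambda>R. of_bool (?bad x R))" for x
    unfolding walk_dirs_def frac[symmetric]
    by (rule avg_random_class[OF _ _ _ sub]) (auto simp: lessThan_empty_iff)
  have "p * m / 8 \<le> (\<Sum>x\<in>grid n d. bexp p {1..d} (\<lambda>R. of_bool (?bad x R)))"
    unfolding m_def using p unfolding m_def
    by (intro walk_detects ones_grid M p01 nd) auto
  then have "p * m / 8 / real (card (grid n d)) \<le> avg (grid n d) (\<lambda>x. bexp p {1..d} (\<lambda>R. of_bool (?bad x R)))"
    unfolding avg_def by (intro divide_right_mono) auto
  also have "\<dots> = avg (grid n d) (\<lambda>x. avg {1..d} (\<lambda>i. avg ?c (\<lambda>c. of_bool (?bad x (walk_dirs J j c)))))"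
    unfolding cls using nd by (subst avg_const) auto
  also have "\<dots> \<le> avg (grid n d) (\<lambda>x. avg {1..d} (\<lambda>i. avg ?c (\<lambda>c. of_bool (detects f J (k, b, j, x, i, c)))))"
  proof (intro avg_mono)
    fix x i c assume x: "x \<in> grid n d"
    have R: "walk_dirs J j c \<subseteq> {1..d}" by (auto simp: walk_dirs_def)
    show "of_bool (?bad x (walk_dirs J j c)) \<le> (of_bool (detects f J (k, b, j, x, i, c)) :: real)"
      using x move_grid[OF x R dn_range] move_grid[OF x R up_range]
      by (auto simp: detects_def ones_def)
  qed
  finally have "p * m / 8 / real (card (grid n d)) / real (card {..J}) / real (card {..<2::nat}) \<le>
      avg (grid n d) (\<lambda>x. avg {1..d} (\<lambda>i. avg ?c (\<lambda>c. of_bool (detects f J (k, b, j, x, i, c)))))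
        / real (card {..J}) / real (card {..<2::nat})"
    by (intro divide_right_mono) auto
  also have "\<dots> \<le> avg {..J} (\<lambda>j. avg (grid n d) (\<lambda>x. avg {1..d} (\<lambda>i. avg ?c (\<lambda>c. of_bool (detects f J (k, b, j, x, i, c))))))
        / real (card {..<2::nat})"
    using j by (intro divide_right_mono avg_ge_single[of "{..J}" j] avg_nonneg) auto
  also have "\<dots> \<le> scale_prob f J k"
    unfolding scale_prob_def using b
    by (intro avg_ge_single[of "{..<2}" b] avg_nonneg) auto
  finally show ?thesis by (simp add: field_simps)
qed

end

text \<open>Two lower bounds on \<open>a\<close> are multiplied: the square of
  \<open>V / (N * d)\<close> from the edge test, and the walk bound of order
  \<open>(m / N)\<^sup>2 / (sqrt d * (J + 1))\<close>. If every available rate is too large for the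
  walk, \<open>m\<close> is so small that the edge test alone suffices.\<close>

lemma scale_tradeoff:
  fixes a V m mb N d :: real and J :: nat
  assumes N: "N > 0" and d: "d \<ge> 1" "d \<le> 2 ^ J" and m: "0 \<le> m" "m \<le> V" "m / 2 \<le> mb" "mb \<le> N"
    and edge: "V / (N * d) \<le> a"
    and walk: "\<And>j. j \<le> J \<Longrightarrow> sqrt 2 * (1 / 2 ^ j) * sqrt d * N \<le> mb / 8 \<Longrightarrow>
      (1 / 2 ^ j)\<^sup>2 * d \<le> 1 \<Longrightarrow> (1 / 2 ^ j) * mb / 8 / N / (2 * (real J + 1)) \<le> a"
  shows "(1100 * sqrt (2 * V * m) / N) ^ 4 \<le> 10 ^ 16 * (real J + 1) * (d\<^sup>2 * sqrt d) * a ^ 3"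
proof -
  have V0: "0 \<le> V" using m by simp
  have a0: "0 \<le> a" using edge V0 N d by (meson divide_nonneg_pos mult_pos_pos order_trans less_le_trans zero_less_one)
  have lhs: "(1100 * sqrt (2 * V * m) / N) ^ 4 = 5856400000000 * (V\<^sup>2 * m\<^sup>2) / N ^ 4"
  proof -
    have "sqrt (2 * V * m) ^ 4 = ((sqrt (2 * V * m))\<^sup>2)\<^sup>2"
      by (subst power_mult[symmetric]) simp
    also have "\<dots> = (2 * V * m)\<^sup>2" using V0 m by (subst real_sqrt_pow2) auto
    finally have "sqrt (2 * V * m) ^ 4 = (2 * V * m)\<^sup>2" .
    then show ?thesis by (simp add: power_divide power_mult_distrib)
  qed
  show ?thesis
  proof (cases "m = 0")
    case True
    then show ?thesis using lhs a0 d by simp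
  next
    case False
    then have m0: "m > 0" and mb0: "mb > 0" and Vp: "V > 0" using m by auto
    have sd: "sqrt d \<ge> 1" using d by simp
    have s2: "1 \<le> sqrt 2" "sqrt 2 \<le> 3 / 2" "sqrt 2 \<le> 1415 / 1000"
      by (simp, (rule real_le_lsqrt; simp add: power2_eq_square)+)
    \<comment> \<open>The largest rate that meets the first condition of \<open>walk\<close>; the
      second then follows from \<open>mb \<le> N\<close>.\<close>
    define t where "t = mb / N / (8 * sqrt 2 * sqrt d)"
    have t0: "t > 0" using mb0 N d by (simp add: t_def)
    have cond1: "sqrt 2 * p * sqrt d * N \<le> mb / 8" if "p \<le> t" for p
      using mult_left_mono[OF that, of "sqrt 2 * sqrt d * N"] N d by (simp add: t_def field_simps)
    have t1: "t * sqrt d \<le> 1 / 8"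
    proof -
      have "t * sqrt d = mb / N / (8 * sqrt 2)" using sd by (simp add: t_def)
      also have "\<dots> \<le> 1 / (8 * sqrt 2)" using m N by (intro divide_right_mono) auto
      also have "\<dots> \<le> 1 / 8" using s2 by (simp add: field_simps)
      finally show ?thesis .
    qed
    have cond2: "p\<^sup>2 * d \<le> 1" if "0 \<le> p" "p \<le> t" for p
    proof -
      have "p * sqrt d \<le> t * sqrt d" using that sd by (intro mult_right_mono) auto
      then have "p * sqrt d \<le> 1" using t1 by simp
      then have "(p * sqrt d)\<^sup>2 \<le> 1" using that sd by (simp add: power_le_one)
      then show ?thesis using d by (simp add: power_mult_distrib)
    qed
    show ?thesis
    proof (cases "1 / 2 ^ J \<le> t")
      case True
      \<comment> \<open>The least such exponent gives a rate within a factor 2 of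
        \<open>t\<close>.\<close>
      define j where "j = (LEAST j. 1 / 2 ^ j \<le> t)"
      have j: "1 / 2 ^ j \<le> t" unfolding j_def using True by (rule LeastI)
      have jJ: "j \<le> J" unfolding j_def using True by (rule Least_le)
      have "t * 1 \<le> t * sqrt d" using sd t0 by (intro mult_left_mono) auto
      then have "t < 1" using t1 by linarith
      then have "j \<noteq> 0" using j by (intro notI) simp
      then obtain j' where j': "j = Suc j'" by (cases j) auto
      have "\<not> 1 / 2 ^ j' \<le> t" using not_less_Least[of j' "\<lambda>j. 1 / 2 ^ j \<le> t"] j' by (simp add: j_def)
      then have half: "t / 2 \<le> 1 / 2 ^ j" by (simp add: j')
      have "(t / 2) * mb / 8 / N / (2 * (real J + 1)) \<le> (1 / 2 ^ j) * mb / 8 / N / (2 * (real J + 1))"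
        using half mb0 N by (intro divide_right_mono mult_right_mono) auto
      also have "\<dots> \<le> a" using j by (intro walk jJ cond1 cond2) auto
      also have "(t / 2) * mb / 8 / N / (2 * (real J + 1)) =
          mb\<^sup>2 / N\<^sup>2 / (256 * sqrt 2 * sqrt d * (real J + 1))"
      proof -
        have "(mb / N / (8 * r * s) / 2) * mb / 8 / N / (2 * j) = mb\<^sup>2 / N\<^sup>2 / (256 * r * s * j)"
          for r s j :: real by (simp add: power2_eq_square mult_ac)
        from this[of "sqrt 2" "sqrt d" "real J + 1"] show ?thesis by (simp only: t_def)
      qed
      finally have "mb\<^sup>2 / N\<^sup>2 / (256 * sqrt 2 * sqrt d * (real J + 1)) \<le> a" .
      moreover have "(m / 2)\<^sup>2 / N\<^sup>2 / (256 * sqrt 2 * sqrt d * (real J + 1)) \<le>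
          mb\<^sup>2 / N\<^sup>2 / (256 * sqrt 2 * sqrt d * (real J + 1))"
        using m m0 d by (intro divide_right_mono power_mono) auto
      ultimately have 1: "(m / 2)\<^sup>2 / N\<^sup>2 / (256 * sqrt 2 * sqrt d * (real J + 1)) \<le> a" by simp
      have 2: "(V / (N * d))\<^sup>2 \<le> a\<^sup>2" using edge Vp N d by (intro power_mono) auto
      have "(m / 2)\<^sup>2 / N\<^sup>2 / (256 * sqrt 2 * sqrt d * (real J + 1)) * (V / (N * d))\<^sup>2 \<le> a * a\<^sup>2"
        using 1 2 a0 by (intro mult_mono) auto
      then have 3: "10 ^ 16 * (real J + 1) * (d\<^sup>2 * sqrt d) *
          ((m / 2)\<^sup>2 / N\<^sup>2 / (256 * sqrt 2 * sqrt d * (real J + 1)) * (V / (N * d))\<^sup>2)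
          \<le> 10 ^ 16 * (real J + 1) * (d\<^sup>2 * sqrt d) * a ^ 3"
        using d by (intro mult_left_mono) (auto simp: power3_eq_cube power2_eq_square)
      have "10 ^ 16 * (real J + 1) * (d\<^sup>2 * sqrt d) *
          ((m / 2)\<^sup>2 / N\<^sup>2 / (256 * sqrt 2 * sqrt d * (real J + 1)) * (V / (N * d))\<^sup>2) =
          10 ^ 16 / (1024 * sqrt 2) * (V\<^sup>2 * m\<^sup>2 / N ^ 4)"
      proof -
        have nz: "real J + 1 \<noteq> 0" "sqrt d \<noteq> 0" "d \<noteq> 0" "N \<noteq> 0" using sd d N by auto
        have "c * j * (D\<^sup>2 * s) * ((m / 2)\<^sup>2 / N\<^sup>2 / (256 * r * s * j) * (V / (N * D))\<^sup>2) =
            c / (1024 * r) * (V\<^sup>2 * m\<^sup>2 / N ^ 4)"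
          if "j \<noteq> 0" "s \<noteq> 0" "D \<noteq> 0" "r \<noteq> 0" for c j D s r :: real
          using that N by (simp add: field_simps power2_eq_square eval_nat_numeral)
        from this[OF nz(1,2,3), of "sqrt 2" "10 ^ 16"] show ?thesis by simp
      qed
      moreover have "5856400000000 * (V\<^sup>2 * m\<^sup>2 / N ^ 4) \<le> 10 ^ 16 / (1024 * sqrt 2) * (V\<^sup>2 * m\<^sup>2 / N ^ 4)"
      proof (intro mult_right_mono)
        \<comment> \<open>The left side is \<open>4 * 1100 ^ 4\<close>; multiplied by
          \<open>1024 * sqrt 2\<close> it is about \<open>8.5 * 10 ^ 15\<close>.\<close>
        show "5856400000000 \<le> 10 ^ 16 / (1024 * sqrt 2)"
          using s2 by (simp add: field_simps)
      qed (use N in auto)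
      ultimately show ?thesis using 3 lhs by simp
    next
      case False
      \<comment> \<open>Here even the rate \<open>2 ^ - J\<close> is too large, which forces
        \<open>m * sqrt d \<le> 24 * N\<close>; one factor \<open>m\<close> is then traded for
        \<open>V\<close>.\<close>
      have "t < 1 / d"
      proof -
        have "1 / 2 ^ J \<le> 1 / d" using d by (intro divide_left_mono) auto
        then show ?thesis using False by simp
      qed
      then have "mb / N / (8 * sqrt 2 * sqrt d) * d < 1" using d by (simp add: t_def field_simps)
      moreover have "mb / N / (8 * sqrt 2 * sqrt d) * d = mb * sqrt d / (N * (8 * sqrt 2))"
      proof -
        have "mb / N / (8 * r * s) * (s * s) = mb * s / (N * (8 * r))" if "s \<noteq> 0" for r s :: real
          using that by (simp add: mult_ac)
        from this[of "sqrt d" "sqrt 2"] show ?thesis using d by simp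
      qed
      ultimately have "mb * sqrt d / (N * (8 * sqrt 2)) < 1" by (simp only:)
      then have "mb * sqrt d < N * (8 * sqrt 2)" using N pos_divide_less_eq[of "N * (8 * sqrt 2)" "mb * sqrt d" 1] by simp
      moreover have "N * (8 * sqrt 2) \<le> N * 12" using s2(2) N by (intro mult_left_mono) auto
      ultimately have "mb * sqrt d \<le> N * 12" by linarith
      moreover have "m / 2 * sqrt d \<le> mb * sqrt d" using m(3) sd by (intro mult_right_mono) auto
      ultimately have "m * sqrt d \<le> 24 * N" by simp
      then have "m * (m * sqrt d) \<le> V * (24 * N)" using m m0 N sd by - (rule mult_mono, auto)
      then have key: "V\<^sup>2 * (m\<^sup>2 * sqrt d) \<le> V\<^sup>2 * (24 * V * N)"
        by (intro mult_left_mono) (auto simp: power2_eq_square mult_ac)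
      have "V\<^sup>2 * m\<^sup>2 / N ^ 4 \<le> 24 * (V ^ 3 / (N ^ 3 * sqrt d))"
      proof -
        have "V\<^sup>2 * m\<^sup>2 / N ^ 4 = V\<^sup>2 * (m\<^sup>2 * sqrt d) / (N ^ 4 * sqrt d)" using sd by simp
        also have "\<dots> \<le> V\<^sup>2 * (24 * V * N) / (N ^ 4 * sqrt d)"
          using key N sd by (intro divide_right_mono) auto
        also have "\<dots> = 24 * (V ^ 3 / (N ^ 3 * sqrt d))"
          using N sd by (simp add: field_simps eval_nat_numeral)
        finally show ?thesis .
      qed
      also have "V ^ 3 / (N ^ 3 * sqrt d) = d\<^sup>2 * sqrt d * (V / (N * d)) ^ 3"
      proof -
        have "V ^ 3 / (N ^ 3 * s) = (s * s)\<^sup>2 * s * (V / (N * (s * s))) ^ 3" if "s \<noteq> 0" for s :: real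
          using that N by (simp add: field_simps eval_nat_numeral)
        from this[of "sqrt d"] show ?thesis using sd d by simp
      qed
      also have "\<dots> \<le> d\<^sup>2 * sqrt d * a ^ 3"
        using edge Vp N d by (intro mult_left_mono power_mono) auto
      finally have 4: "V\<^sup>2 * m\<^sup>2 / N ^ 4 \<le> 24 * (d\<^sup>2 * sqrt d * a ^ 3)" by simp
      have D0: "0 \<le> d\<^sup>2 * sqrt d * a ^ 3" using a0 d by simp
      have "5856400000000 * (V\<^sup>2 * m\<^sup>2) / N ^ 4 \<le> 10 ^ 16 * 1 * (d\<^sup>2 * sqrt d * a ^ 3)"
        using 4 D0 by simp
      also have "\<dots> \<le> 10 ^ 16 * (real J + 1) * (d\<^sup>2 * sqrt d * a ^ 3)"
        using D0 by (intro mult_right_mono) auto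
      finally show ?thesis using lhs by (simp add: mult_ac)
    qed
  qed
qed

text \<open>By convexity the worst case is that all scales contribute equally; the indices with
  \<open>e k\<close> below half of the average \<open>E\<close> are discarded.\<close>

lemma avg_four_thirds:
  fixes e a :: "nat \<Rightarrow> real"
  assumes l: "l \<ge> 1" and E: "E > 0" "E \<le> avg {..<l} e" and L: "L \<ge> 0"
    and a: "\<And>k. k < l \<Longrightarrow> 0 \<le> a k" "\<And>k. k < l \<Longrightarrow> 0 < e k \<Longrightarrow> L * e k powr (4/3) \<le> a k"
  shows "L * (E / 2) powr (4/3) \<le> avg {..<l} a"
proof -
  have fin: "finite {..<l}" "{..<l} \<noteq> {}" using l by (auto simp: lessThan_empty_iff)
  let ?c = "L * (E / 2) powr (1/3)"
  have c0: "0 \<le> ?c" using L by simp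
  have pw: "x powr (4/3) = x * x powr (1/3)" if "x > 0" for x :: real
    using that powr_add[of x 1 "1/3"] by simp
  have "L * (E / 2) powr (4/3) = ?c * (E / 2)" using E by (simp add: pw)
  also have "\<dots> \<le> ?c * (avg {..<l} e - E / 2)" using E c0 by (intro mult_left_mono) auto
  also have "\<dots> = avg {..<l} (\<lambda>k. ?c * (e k - E / 2))"
    unfolding avg_cmult avg_diff using fin by (simp add: avg_const)
  also have "\<dots> \<le> avg {..<l} a"
  proof (intro avg_mono)
    fix k assume k: "k \<in> {..<l}"
    show "?c * (e k - E / 2) \<le> a k"
    proof (cases "e k \<le> E / 2")
      case True
      then have "?c * (e k - E / 2) \<le> 0" using c0 by (intro mult_nonneg_nonpos) auto
      then show ?thesis using a(1)[of k] k by simp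
    next
      case False
      then have ek: "e k > 0" using E by simp
      have "?c * (e k - E / 2) \<le> ?c * e k" using c0 E by (intro mult_left_mono) auto
      also have "\<dots> \<le> L * e k powr (1/3) * e k"
        using False E L ek by (intro mult_right_mono mult_left_mono powr_mono2) auto
      also have "\<dots> = L * e k powr (4/3)" using ek by (simp add: pw mult_ac)
      also have "\<dots> \<le> a k" using a(2) k ek by simp
      finally show ?thesis .
    qed
  qed
  finally show ?thesis .
qed

definition num_scales :: "nat \<Rightarrow> nat" where
  "num_scales n = Suc (nat \<lceil>log 2 (real n)\<rceil>)"

definition rate_exp :: "nat \<Rightarrow> nat" where
  "rate_exp d = nat \<lceil>log 2 (real d)\<rceil>"

lemma le_two_power_ceiling:
  assumes "m \<ge> 1"
  shows "real m \<le> 2 ^ nat \<lceil>log 2 (real m)\<rceil>"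
proof -
  have "real m = 2 powr log 2 (real m)" using assms by simp
  also have "\<dots> \<le> 2 powr real (nat \<lceil>log 2 (real m)\<rceil>)"
    by (intro powr_mono real_nat_ceiling_ge) auto
  also have "\<dots> = 2 ^ nat \<lceil>log 2 (real m)\<rceil>" by (simp add: powr_realpow)
  finally show ?thesis .
qed

lemma nat_ceiling_log_le:
  assumes "m \<ge> 1"
  shows "real (nat \<lceil>log 2 (real m)\<rceil>) \<le> ln (real m) / ln 2 + 1"
proof -
  have "0 \<le> log 2 (real m)" using assms by simp
  then show ?thesis by (simp add: log_def)
qed

text \<open>The first factor is the constant \<open>L\<close> for which
  \<open>scale_tradeoff\<close> yields \<open>L * e k powr (4/3) \<le> a k\<close>; the second is
  what \<open>avg_four_thirds\<close> gives for the average
  \<open>\<epsilon> / num_scales n\<close>.\<close>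

definition detect_rate :: "nat \<Rightarrow> nat \<Rightarrow> real \<Rightarrow> real" where
  "detect_rate n d \<epsilon> = (1 / (10 ^ 16 * (real (rate_exp d) + 1) * (real d)\<^sup>2 * sqrt (real d))) powr (1/3)
     * (\<epsilon> / (2 * real (num_scales n))) powr (4/3)"

lemma detect_rate_pos: "d \<ge> 1 \<Longrightarrow> \<epsilon> > 0 \<Longrightarrow> detect_rate n d \<epsilon> > 0"
  by (simp add: detect_rate_def num_scales_def)

lemma trial_detects:
  assumes n: "n \<ge> 1" and d: "d \<ge> 1" and eps: "0 < \<epsilon>" and far: "far_from_mono n d \<epsilon> f"
  shows "detect_rate n d \<epsilon> \<le> avg (hypergrid.trials n d (num_scales n) (rate_exp d))
    (\<lambda>t. of_bool (hypergrid.detects n d f (rate_exp d) t))"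
proof -
  interpret hypergrid n d .
  define l J where "l = num_scales n" and "J = rate_exp d"
  define N where "N = real (card (grid n d))"
  have N: "N > 0" unfolding N_def using n finite_grid
    by (auto simp: card_gt_0_iff grid_def PiE_eq_empty_iff)
  have l1: "l \<ge> 1" by (simp add: l_def num_scales_def)
  have "real n \<le> 2 ^ nat \<lceil>log 2 (real n)\<rceil>" by (rule le_two_power_ceiling[OF n])
  also have "\<dots> \<le> 2 ^ l" unfolding l_def num_scales_def
    by (rule power_increasing[OF le_SucI[OF order_refl]]) simp
  finally have "real n \<le> 2 ^ l" .
  then have nl: "n \<le> 2 ^ l" by (metis of_nat_le_iff of_nat_numeral of_nat_power)
  have dJ: "real d \<le> 2 ^ J" unfolding J_def rate_exp_def by (rule le_two_power_ceiling[OF d])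
  obtain M where M: "\<And>k. matching (2 ^ k) (ones f) (M k)"
    and Msum: "\<epsilon> * N \<le> (\<Sum>k<l. 1100 * sqrt (2 * vcount (2 ^ k) (ones f) * real (card (M k))))"
    using directed_margulis[OF far n nl] unfolding N_def by blast
  define e where "e k = 1100 * sqrt (2 * vcount (2 ^ k) (ones f) * real (card (M k))) / N" for k
  define L where "L = (1 / (10 ^ 16 * (real J + 1) * (real d)\<^sup>2 * sqrt (real d))) powr (1/3)"
  have scale: "(e k) ^ 4 \<le> 10 ^ 16 * (real J + 1) * ((real d)\<^sup>2 * sqrt (real d)) * scale_prob f J k ^ 3" for k
  proof -
    obtain b where b: "b < 2"
      and half: "real (card (M k)) / 2 \<le> real (card {(x, i) \<in> M k. is_low (2 ^ k) b (x i)})"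
      using card_matching_parity[OF ones_grid M[of k]] by auto
    have "card {(x, i) \<in> M k. is_low (2 ^ k) b (x i)} \<le> card (M k)"
      using finite_matching[OF ones_grid M[of k]] by (intro card_mono) auto
    also have "\<dots> = card (fst ` M k)"
      using M[of k] by (intro card_image[symmetric]) (simp add: matching_def)
    also have "\<dots> \<le> card (grid n d)"
      using M[of k] by (intro card_mono finite_grid) (auto simp: matching_def viol_edges_def ones_def)
    finally have mbN: "real (card {(x, i) \<in> M k. is_low (2 ^ k) b (x i)}) \<le> N" by (simp add: N_def)
    show ?thesis
      unfolding e_def
    proof (rule scale_tradeoff[OF N _ dJ _ _ half mbN])
      show "vcount (2 ^ k) (ones f) / (N * real d) \<le> scale_prob f J k"
        unfolding N_def by (rule scale_prob_edge[OF n d])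
    next
      fix j assume j: "j \<le> J"
        "sqrt 2 * (1 / 2 ^ j) * sqrt (real d) * N \<le> real (card {(x, i) \<in> M k. is_low (2 ^ k) b (x i)}) / 8"
        "(1 / 2 ^ j)\<^sup>2 * real d \<le> 1"
      show "1 / 2 ^ j * real (card {(x, i) \<in> M k. is_low (2 ^ k) b (x i)}) / 8 / N / (2 * (real J + 1))
          \<le> scale_prob f J k"
        using j unfolding N_def by (intro scale_prob_walk[OF n d b j(1) M]) auto
    qed (use d card_matching_le[OF ones_grid M[of k]] in auto)
  qed
  have "L * (\<epsilon> / real l / 2) powr (4/3) \<le> avg {..<l} (scale_prob f J)"
  proof (rule avg_four_thirds[OF l1, where e = e])
    show "0 < \<epsilon> / real l" using eps l1 by simp
    have "\<epsilon> \<le> (\<Sum>k<l. e k)"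
      using Msum N by (simp add: e_def sum_divide_distrib[symmetric] field_simps)
    then show "\<epsilon> / real l \<le> avg {..<l} e"
      unfolding avg_def by (simp add: divide_right_mono)
    show "0 \<le> L" by (simp add: L_def)
    fix k
    show "0 \<le> scale_prob f J k" by (rule scale_prob_nonneg)
    assume ek: "0 < e k"
    let ?D = "10 ^ 16 * (real J + 1) * (real d)\<^sup>2 * sqrt (real d)"
    have D: "?D > 0" using d by simp
    have "(L * e k powr (4/3)) ^ 3 = (1 / ?D) * e k ^ 4"
    proof -
      have cube: "(x powr (1/3)) ^ 3 = x" if "x > 0" for x :: real
        using that by (simp add: powr_realpow[symmetric] powr_powr)
      have "L ^ 3 = 1 / ?D" unfolding L_def by (rule cube) (rule divide_pos_pos[OF zero_less_one D])
      moreover have "(e k powr (4/3)) ^ 3 = e k ^ 4"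
        using ek powr_power[of "e k" "4/3" 3] powr_realpow[of "e k" 4] by simp
      ultimately show ?thesis by (simp add: power_mult_distrib)
    qed
    also have "\<dots> \<le> scale_prob f J k ^ 3"
      using scale[of k] D by (simp add: field_simps)
    finally have cubes: "(L * e k powr (4/3)) ^ 3 \<le> scale_prob f J k ^ 3" .
    show "L * e k powr (4/3) \<le> scale_prob f J k"
    proof (rule ccontr)
      assume "\<not> ?thesis"
      then have "scale_prob f J k ^ 3 < (L * e k powr (4/3)) ^ 3"
        by (intro power_strict_mono scale_prob_nonneg) auto
      then show False using cubes by linarith
    qed
  qed
  also have "L * (\<epsilon> / real l / 2) powr (4/3) = detect_rate n d \<epsilon>"
    by (simp add: detect_rate_def L_def l_def J_def mult.commute)
  finally show ?thesis unfolding avg_trials l_def J_def .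
qed

section \<open>The query bound\<close>

lemma detect_rate_le_one:
  assumes "d \<ge> 1" "0 < \<epsilon>" "\<epsilon> < 1"
  shows "detect_rate n d \<epsilon> \<le> 1"
proof -
  have "1 * 1 * 1 * 1 \<le> 10 ^ 16 * (real (rate_exp d) + 1) * (real d)\<^sup>2 * sqrt (real d)"
    using assms by (intro mult_mono one_le_power) auto
  then have "(1 / (10 ^ 16 * (real (rate_exp d) + 1) * (real d)\<^sup>2 * sqrt (real d))) powr (1/3) \<le> 1"
    by (intro powr_le1) auto
  moreover have "(\<epsilon> / (2 * real (num_scales n))) powr (4/3) \<le> 1"
    using assms by (intro powr_le1) (auto simp: num_scales_def field_simps)
  ultimately show ?thesis unfolding detect_rate_def by (intro mult_le_one) auto
qed

text \<open>\<open>J'\<close> is of order \<open>ln d\<close>, and its cube root is estimated by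
  \<open>ln d powr (3/2)\<close> at the cost of \<open>ln 2 powr (- 7/6)\<close>, as
  \<open>ln d \<ge> ln 2\<close>. For the same reason the additive constants in \<open>J'\<close>
  and \<open>l\<close> are absorbed into \<open>ln d\<close>.\<close>

lemma inverse_detect_rate_le:
  fixes n d :: nat
  assumes n: "n \<ge> 1" and d: "d \<ge> 2" and eps: "0 < \<epsilon>"
  defines "C \<equiv> (10 ^ 16) powr (1/3) * (3 / ln 2) powr (1/3) * ln 2 powr (- 7/6) * (4 / ln 2) powr (4/3)"
  shows "1 / detect_rate n d \<epsilon> \<le> C * (real d powr (5/6) * ln (real d) powr (3/2)
    * (ln (real n) + ln (real d)) powr (4/3) * \<epsilon> powr (- 4/3))"
proof -
  define J' where "J' = real (rate_exp d) + 1"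
  define l where "l = real (num_scales n)"
  have ln2: "(0::real) < ln 2" by simp
  have lnd: "ln 2 \<le> ln (real d)" using d by simp
  have lnn: "0 \<le> ln (real n)" using n by simp
  have J0: "J' > 0" and l0: "l > 0" by (auto simp: J'_def l_def num_scales_def)
  have one: "1 \<le> ln (real d) / ln 2" using lnd by simp
  have "J' \<le> ln (real d) / ln 2 + 2"
    using nat_ceiling_log_le[of d] d by (simp add: J'_def rate_exp_def)
  also have "\<dots> \<le> 3 * (ln (real d) / ln 2)" using one by linarith
  finally have J': "J' \<le> 3 / ln 2 * ln (real d)" by simp
  have "l \<le> ln (real n) / ln 2 + 2"
    using nat_ceiling_log_le[OF n] by (simp add: l_def num_scales_def)
  also have "\<dots> \<le> 2 * (ln (real n) / ln 2) + 2 * (ln (real d) / ln 2)"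
    using one divide_nonneg_pos[OF lnn ln2] by linarith
  finally have "2 * l \<le> 2 * (2 * (ln (real n) / ln 2) + 2 * (ln (real d) / ln 2))" by simp
  also have "\<dots> = 4 / ln 2 * (ln (real n) + ln (real d))" by (simp add: field_simps)
  finally have l: "2 * l \<le> 4 / ln 2 * (ln (real n) + ln (real d))" .
  have "1 / detect_rate n d \<epsilon> =
      (10 ^ 16 * J' * (real d)\<^sup>2 * sqrt (real d)) powr (1/3) * (2 * l / \<epsilon>) powr (4/3)"
    using d eps J0 l0
    by (simp add: detect_rate_def J'_def[symmetric] l_def[symmetric] powr_divide)
  also have "(10 ^ 16 * J' * (real d)\<^sup>2 * sqrt (real d)) powr (1/3) =
      (10 ^ 16) powr (1/3) * J' powr (1/3) * real d powr (5/6)"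
  proof -
    have "(real d)\<^sup>2 * sqrt (real d) = real d powr (5/2)"
      using d powr_add[of "real d" 2 "1/2"] by (simp add: powr_half_sqrt)
    then have "((real d)\<^sup>2 * sqrt (real d)) powr (1/3) = real d powr (5/6)" by (simp add: powr_powr)
    moreover have "(10 ^ 16 * J' * ((real d)\<^sup>2 * sqrt (real d))) powr (1/3) =
        (10 ^ 16) powr (1/3) * J' powr (1/3) * ((real d)\<^sup>2 * sqrt (real d)) powr (1/3)"
      using J0 by (simp only: powr_mult)
    ultimately show ?thesis by (simp only: mult.assoc)
  qed
  also have "(2 * l / \<epsilon>) powr (4/3) = (2 * l) powr (4/3) * \<epsilon> powr (- 4/3)"
    using eps l0 by (simp add: powr_divide powr_minus_divide)
  also have "(10 ^ 16) powr (1/3) * J' powr (1/3) * real d powr (5/6) * ((2 * l) powr (4/3) * \<epsilon> powr (- 4/3))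
    \<le> (10 ^ 16) powr (1/3) * ((3 / ln 2) powr (1/3) * ln 2 powr (- 7/6) * ln (real d) powr (3/2)) * real d powr (5/6)
      * (((4 / ln 2) powr (4/3) * (ln (real n) + ln (real d)) powr (4/3)) * \<epsilon> powr (- 4/3))"
  proof (intro mult_mono mult_nonneg_nonneg order_refl)
    have "(2 * l) powr (4/3) \<le> (4 / ln 2 * (ln (real n) + ln (real d))) powr (4/3)"
      using l l0 by (intro powr_mono2) auto
    also have "\<dots> = (4 / ln 2) powr (4/3) * (ln (real n) + ln (real d)) powr (4/3)"
      by (rule powr_mult)
    finally show "(2 * l) powr (4/3) \<le> (4 / ln 2) powr (4/3) * (ln (real n) + ln (real d)) powr (4/3)" .
    have "J' powr (1/3) \<le> (3 / ln 2 * ln (real d)) powr (1/3)"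
      using J' J0 by (intro powr_mono2) auto
    also have "\<dots> = (3 / ln 2) powr (1/3) * ln (real d) powr (1/3)" by (rule powr_mult)
    also have "ln (real d) powr (1/3) \<le> ln 2 powr (- 7/6) * ln (real d) powr (3/2)"
    proof -
      have "ln 2 powr (7/6) * ln (real d) powr (1/3) \<le> ln (real d) powr (7/6) * ln (real d) powr (1/3)"
        using lnd by (intro mult_right_mono powr_mono2) auto
      also have "\<dots> = ln (real d) powr (3/2)" by (simp add: powr_add[symmetric])
      finally show ?thesis using ln2 by (simp add: powr_minus field_simps)
    qed
    finally show "J' powr (1/3) \<le> (3 / ln 2) powr (1/3) * ln 2 powr (- 7/6) * ln (real d) powr (3/2)"
      by (simp add: mult_left_mono mult.assoc)
  qed auto
  finally show ?thesis by (simp only: C_def mult_ac)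
qed

theorem theorem1p1:
  "\<exists>T :: nat \<Rightarrow> nat \<Rightarrow> real \<Rightarrow> randomized_nonadaptive.
     (\<forall>n\<ge>1. \<forall>d\<ge>1. \<forall>\<epsilon>. 0 < \<epsilon> \<and> \<epsilon> < 1 \<longrightarrow>
        queries_within (T n d \<epsilon>) (grid n d) \<and>
        (\<forall>f. grid_mono n d f \<longrightarrow> prob_returns (T n d \<epsilon>) f YES = 1) \<and>
        (\<forall>f. far_from_mono n d \<epsilon> f \<longrightarrow> prob_returns (T n d \<epsilon>) f NO > 2 / 3)) \<and>
     (\<exists>C>0. \<forall>n\<ge>1. \<forall>d\<ge>2. \<forall>\<epsilon>. 0 < \<epsilon> \<and> \<epsilon> < 1 \<longrightarrow>
        makes_at_most (T n d \<epsilon>)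
          (C * (real d powr (5/6) * ln (real d) powr (3/2)
                * (ln (real n) + ln (real d)) powr (4/3) * \<epsilon> powr (- 4/3))))"
proof -
  \<comment> \<open>Two detections are expected for a far \<open>f\<close>, so all trials miss with
    probability at most \<open>exp (- 2) < 1 / 3\<close>.\<close>
  define reps where "reps n d \<epsilon> = nat \<lceil>2 / detect_rate n d \<epsilon>\<rceil>" for n d \<epsilon>
  define T where "T n d \<epsilon> = hypergrid.tester n d (num_scales n) (rate_exp d) (reps n d \<epsilon>)" for n d \<epsilon>
  have l1: "num_scales n \<ge> 1" for n by (simp add: num_scales_def)
  have correct: "queries_within (T n d \<epsilon>) (grid n d)"
    "grid_mono n d f \<Longrightarrow> prob_returns (T n d \<epsilon>) f YES = 1"
    "far_from_mono n d \<epsilon> f \<Longrightarrow> prob_returns (T n d \<epsilon>) f NO > 2 / 3"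
    if n: "n \<ge> 1" and d: "d \<ge> 1" and eps: "0 < \<epsilon>" "\<epsilon> < 1" for n d \<epsilon> f
  proof -
    interpret hypergrid n d .
    let ?s = "avg (trials (num_scales n) (rate_exp d)) (\<lambda>t. of_bool (detects f (rate_exp d) t))"
    show "queries_within (T n d \<epsilon>) (grid n d)"
      unfolding queries_within_def T_def
    proof (intro ballI)
      fix A assume "A \<in> set_pmf (tester (num_scales n) (rate_exp d) (reps n d \<epsilon>))"
      then obtain ts where ts: "set ts \<subseteq> trials (num_scales n) (rate_exp d)"
        "queries A = concat (map (trial_queries (rate_exp d)) ts)"
        using set_pmf_tester[OF n d l1] by auto
      show "set (queries A) \<subseteq> grid n d"
        using trial_queries_grid ts(1) unfolding ts(2) by fastforce
    qed
    show "prob_returns (T n d \<epsilon>) f YES = 1" if f: "grid_mono n d f"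
    proof -
      have "?s = avg (trials (num_scales n) (rate_exp d)) (\<lambda>_. 0)"
        using detects_imp_not_mono[OF _ f] by (intro avg_cong) auto
      then have "?s = 0" by (simp add: avg_def)
      then show ?thesis unfolding T_def prob_tester[OF n d l1] by simp
    qed
    show "prob_returns (T n d \<epsilon>) f NO > 2 / 3" if far: "far_from_mono n d \<epsilon> f"
    proof -
      let ?r = "detect_rate n d \<epsilon>"
      have r: "?r > 0" by (rule detect_rate_pos[OF d eps(1)])
      have rs: "?r \<le> ?s" by (rule trial_detects[OF n d eps(1) far])
      have s1: "?s \<le> 1"
        using finite_trials trials_nonempty[OF n d l1] by (intro avg_le_one) auto
      have "2 = ?r * (2 / ?r)" using r by simp
      also have "\<dots> \<le> ?s * real (reps n d \<epsilon>)"
        unfolding reps_def using r rs by (intro mult_mono real_nat_ceiling_ge) auto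
      finally have s2: "2 \<le> ?s * real (reps n d \<epsilon>)" .
      have "(1 - ?s) ^ reps n d \<epsilon> \<le> exp (- ?s) ^ reps n d \<epsilon>"
        using s1 exp_ge_add_one_self[of "- ?s"] by (intro power_mono) auto
      also have "\<dots> = exp (- (?s * real (reps n d \<epsilon>)))"
        by (simp add: exp_of_nat_mult[symmetric] mult.commute)
      also have "\<dots> \<le> exp (- 2)" using s2 by simp
      also have "\<dots> < 1 / 3"
      proof -
        have "(3::real) \<le> exp 2" using exp_ge_add_one_self[of "2::real"] by simp
        moreover have "exp (2::real) \<noteq> 3"
        proof -
          have "(2::real) * 2 \<le> exp 1 * exp 1"
            using exp_ge_add_one_self[of "1::real"] by (intro mult_mono) auto
          then show ?thesis by (simp add: exp_add[symmetric])
        qed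
        ultimately show ?thesis by (simp add: exp_minus field_simps)
      qed
      finally show ?thesis
        unfolding T_def prob_tester_NO[OF n d l1] prob_tester[OF n d l1] by simp
    qed
  qed
  define C :: real where "C = (10 ^ 16) powr (1/3) * (3 / ln 2) powr (1/3) * ln 2 powr (- 7/6) * (4 / ln 2) powr (4/3)"
  have bound: "makes_at_most (T n d \<epsilon>) (12 * C * (real d powr (5/6) * ln (real d) powr (3/2)
      * (ln (real n) + ln (real d)) powr (4/3) * \<epsilon> powr (- 4/3)))"
    if n: "n \<ge> 1" and d: "d \<ge> 2" and eps: "0 < \<epsilon>" "\<epsilon> < 1" for n d :: nat and \<epsilon>
    unfolding makes_at_most_def
  proof (intro ballI)
    fix A assume A: "A \<in> set_pmf (T n d \<epsilon>)"
    have d1: "d \<ge> 1" using d by simp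
    interpret hypergrid n d .
    let ?r = "detect_rate n d \<epsilon>"
    obtain ts where ts: "length ts = reps n d \<epsilon>" "queries A = concat (map (trial_queries (rate_exp d)) ts)"
      using A set_pmf_tester[OF n d1 l1] unfolding T_def by auto
    have r: "0 < ?r" "?r \<le> 1" using detect_rate_pos[OF d1 eps(1)] detect_rate_le_one[OF d1 eps] .
    have "length (queries A) = 4 * reps n d \<epsilon>"
      unfolding ts using ts(1) by (simp add: length_concat o_def length_trial_queries sum_list_triv)
    moreover have "real (reps n d \<epsilon>) \<le> 2 / ?r + 1" using r by (simp add: reps_def)
    moreover have "1 \<le> 1 / ?r" using r by simp
    \<comment> \<open>Four queries per trial, and rounding \<open>2 / ?r\<close> up costs at most
      another \<open>1 / ?r\<close>.\<close>
    ultimately have "real (length (queries A)) \<le> 12 * (1 / ?r)" by simp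
    also have "\<dots> \<le> 12 * (C * (real d powr (5/6) * ln (real d) powr (3/2)
        * (ln (real n) + ln (real d)) powr (4/3) * \<epsilon> powr (- 4/3)))"
      using inverse_detect_rate_le[OF n d eps(1)] unfolding C_def by (intro mult_left_mono) auto
    finally show "real (length (queries A)) \<le> 12 * C * (real d powr (5/6) * ln (real d) powr (3/2)
        * (ln (real n) + ln (real d)) powr (4/3) * \<epsilon> powr (- 4/3))" by simp
  qed
  have C0: "12 * C > 0" by (simp add: C_def)
  show ?thesis
  proof (rule exI[of _ T], intro conjI)
    show "\<forall>n\<ge>1. \<forall>d\<ge>1. \<forall>\<epsilon>. 0 < \<epsilon> \<and> \<epsilon> < 1 \<longrightarrow>
        queries_within (T n d \<epsilon>) (grid n d) \<and>
        (\<forall>f. grid_mono n d f \<longrightarrow> prob_returns (T n d \<epsilon>) f YES = 1) \<and>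
        (\<forall>f. far_from_mono n d \<epsilon> f \<longrightarrow> prob_returns (T n d \<epsilon>) f NO > 2 / 3)"
      using correct by simp
    show "\<exists>C>0. \<forall>n\<ge>1. \<forall>d\<ge>2. \<forall>\<epsilon>. 0 < \<epsilon> \<and> \<epsilon> < 1 \<longrightarrow>
        makes_at_most (T n d \<epsilon>)
          (C * (real d powr (5/6) * ln (real d) powr (3/2)
                * (ln (real n) + ln (real d)) powr (4/3) * \<epsilon> powr (- 4/3)))"
      using C0 bound by (intro exI[of _ "12 * C"]) simp
  qed
qed

end
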